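(* Consider the smooth function $\widetilde\phi\in C^{\infty}(G^{*})$ defined by $$\widetilde\phi:=-\tfrac12\ln\left|\det\left(\mathbf{1}_{\mathfrak{g}}+g_{0}^{-1}(\mathbf{\Pi}^{*}+B_{0})\right)\right|.$$ Then for every $\zeta\in\mathfrak{g}^{*}$, $$\langle d\widetilde\phi,\zeta_{R'}\rangle=\left\langle\zeta,\ \tfrac12[\widetilde{\mathbf{B}}(t^{k}),t_{k}]_{\mathfrak{g}}+\mathrm{ad}^{*}_{\mathbf{\Pi}^{*}(t_{k})}\widetilde{\mathbf{B}}(t^{k})\right\rangle .$$ In other words, the $1$-form $W'\in\Omega^{1}(G^{*})$ (defined in the context) can be written as $$W'(\zeta_{R'})=\langle d\widetilde\phi,\zeta_{R'}\rangle+\tfrac12\left\langle\zeta,\ \mathbf{a}+\widetilde{\mathbf{B}}\cdot\mathbf{Ad}(\boldsymbol{\alpha})\right\rangle .$$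
   Context: Summation over repeated indices is understood; $\{t_{k}\}$ is a fixed basis of $\mathfrak{g}$ and $\{t^{k}\}$ the dual basis of $\mathfrak{g}^{*}$. Setting. $(\mathfrak{g},\delta)$ is a real finite-dimensional Lie bialgebra: $\mathfrak{g}$ and $\mathfrak{g}^{*}$ are Lie algebras, $\delta(x)(\xi,\eta)=\langle x,[\xi,\eta]_{\mathfrak{g}^{*}}\rangle$ is a $1$-cocycle, and the double $\mathfrak{d}=\mathfrak{g}\oplus\mathfrak{g}^{*}$ has pairing $\langle(x,\xi),(y,\eta)\rangle_{\mathfrak{d}}=\eta(x)+\xi(y)$ and Lie bracket $[(x,\xi),(y,\eta)]_{\mathfrak{d}}=([x,y]_{\mathfrak{g}}+\mathrm{ad}^{*}_{\xi}y-\mathrm{ad}^{*}_{\eta}x,\ [\xi,\eta]_{\mathfrak{g}^{*}}+\mathrm{ad}^{*}_{x}\eta-\mathrm{ad}^{*}_{y}\xi)$, where $\langle\mathrm{ad}^{*}_{x}\eta,y\rangle=-\langle\eta,[x,y]_{\mathfrak{g}}\rangle$ and $\langle\mathrm{ad}^{*}_{\xi}y,\eta\rangle=-\langle y,[\xi,\eta]_{\mathfrak{g}^{*}}\rangle$. $D$ is a Lie group with Lie algebra $\mathfrak{d}$ (with $\langle\cdot,\cdot\rangle_{\mathfrak d}$ invariant under its adjoint action), $G,G^{*}\subseteq D$ are closed connected subgroups with Lie algebras $\mathfrak{g},\mathfrak{g}^{*}$, and the multiplication map $G\times G^{*}\to D$ is a diffeomorphism. $\Pi^{*}$ is the Poisson--Lie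 bivector on $G^{*}$ (multiplicative: $\Pi^*_{gh}=L_{g*}\Pi^*_h+R_{h*}\Pi^*_g$) dual to $\delta$, i.e. $(\mathcal{L}_{\tilde\zeta}\Pi^{*})_{e}(x,y)=\langle\zeta,[x,y]_{\mathfrak{g}}\rangle$ for any vector field $\tilde\zeta$ with $\tilde\zeta_e=\zeta\in\mathfrak{g}^{*}$. Notation. $\zeta_{R'}$ is the right-invariant vector field on $G^{*}$ with value $\zeta\in\mathfrak{g}^{*}$ at $e$; $x^{R'}$ the right-invariant $1$-form on $G^{*}$ with value $x\in\mathfrak{g}$ at $e$. $\mathbf{\Pi}^{*}\in C^{\infty}(G^{*},\Lambda^{2}\mathfrak{g}^{*})$, $\mathbf{\Pi}^{*}(x,y)=\Pi^{*}(x^{R'},y^{R'})$. Bilinear forms are viewed as maps by inserting the vector in the second slot: $\mathbf{\Pi}^{*}(x)=\mathbf{\Pi}^{*}(\cdot,x)\in\mathfrak{g}^{*}$, $B_{0}(x)=B_{0}(\cdot,x)$, etc. $E_{0}=g_{0}+B_{0}\in\mathrm{Hom}(\mathfrak{g},\mathfrak{g}^{*})$ with $g_{0}$ a positive definite symmetric form and $B_{0}\in\Lambda^{2}\mathfrak{g}^{*}$. $\widetilde{\mathbf{E}}=(E_{0}+\mathbf{\Pi}^{*})^{-1}=\widetilde{\mathbf{g}}+\widetilde{\mathbf{B}}\in C^{\infty}(G^{*},\mathrm{Hom}(\mathfrak{g}^{*},\mathfrak{g}))$ is decomposed into symmetric and skew-symmetric parts. $\boldsymbol{\alpha}\in\mathfrak{g}^{*}$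 and $\mathbf{a}\in\mathfrak{g}$ are the traces of the adjoint representations: $\boldsymbol{\alpha}(x)=\mathrm{Tr}(\mathrm{ad}_{x})$ on $\mathfrak{g}$, $\langle\xi,\mathbf{a}\rangle=\mathrm{Tr}(\mathrm{ad}_{\xi})$ on $\mathfrak{g}^{*}$. $\mathbf{Ad}\in C^{\infty}(G^{*},\mathrm{End}(\mathfrak{g}^{*}))$ is $(\mathbf{Ad}(\xi))_{g}=\mathrm{Ad}_{g}(\xi)$. Lie algebra operations on functions are pointwise. Definition of $W'$. Put $e^{B_{0}}(x,\xi)=(x,\xi+B_{0}(x))$ on $\mathfrak{d}$, and $[u,v]'_{\mathfrak{d}}=e^{-B_{0}}[e^{B_{0}}u,e^{B_{0}}v]_{\mathfrak{d}}$. Decompose $\mathfrak{d}=\mathcal{E}^{0}_{+}\oplus\mathcal{E}^{0}_{-}$, $\mathcal{E}^{0}_{\pm}=\{(x,\pm g_{0}(x))\mid x\in\mathfrak{g}\}$, and write $u=u_{+}+u_{-}$. Let $\widehat\nabla^{0}:\mathfrak{d}\times\mathfrak{d}\to\mathfrak{d}$ be the bilinear map with $$\langle\widehat\nabla^{0}_{u}v,w\rangle_{\mathfrak{d}}=-\langle[u_{+},v_{-}]'_{\mathfrak{d}},w_{-}\rangle_{\mathfrak{d}}-\langle[u_{-},v_{+}]'_{\mathfrak{d}},w_{+}\rangle_{\mathfrak{d}}-\tfrac13\langle[u_{+},v_{+}]'_{\mathfrak{d}},w_{+}\rangle_{\mathfrak{d}}-\tfrac13\langle[u_{-},v_{-}]'_{\mathfrak{d}},w_{-}\rangle_{\mathfrak{d}}.$$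 Let $\mathbf{j}\in C^{\infty}(G^{*},\mathrm{Hom}(\mathfrak{g},\mathfrak{d}))$, $\mathbf{j}(x)=(x,-(\mathbf{\Pi}^{*}+B_{0})(x))$. Then $W'\in\Omega^{1}(G^{*})$ is defined by $W'(\zeta_{R'})=\langle\widehat\nabla^{0}_{\mathbf{j}(\widetilde{\mathbf{g}}(t^{k}))}\mathbf{j}(t_{k}),\mathbf{j}(\widetilde{\mathbf{g}}(\zeta))\rangle_{\mathfrak{d}}$ for $\zeta\in\mathfrak{g}^{*}$ (with $\widehat\nabla^{0}$ extended pointwise, $C^\infty$-bilinearly). *)

theory Defs
  imports "HOL-Analysis.Analysis" "HOL-Algebra.Group"
begin

text \<open>To be used with \<open>U\<close> open. On open subsets of a finite-dimensional space, a function is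
  \<open>C\<^sup>k\<^sup>+\<^sup>1\<close> iff it is differentiable and all its directional derivatives are \<open>C\<^sup>k\<close>.\<close>

primrec Ck_on :: "nat \<Rightarrow> 'a::euclidean_space set \<Rightarrow> ('a \<Rightarrow> 'b::real_normed_vector) \<Rightarrow> bool" where
  "Ck_on 0 U f \<longleftrightarrow> continuous_on U f"
| "Ck_on (Suc k) U f \<longleftrightarrow> (\<forall>x\<in>U. f differentiable (at x)) \<and>
     (\<forall>v. Ck_on k U (\<lambda>x. frechet_derivative f (at x) v))"

definition smooth_on :: "'a::euclidean_space set \<Rightarrow> ('a \<Rightarrow> 'b::real_normed_vector) \<Rightarrow> bool" where
  "smooth_on U f \<longleftrightarrow> (\<forall>k. Ck_on k U f)"

text \<open>An atlas is a set of charts \<open>(U, \<phi>)\<close>; \<open>\<phi>\<close> is relevant on \<open>U\<close> only. The manifold is the whole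
  type \<open>'m\<close>.\<close>

type_synonym ('m, 'e) atlas = "('m set \<times> ('m \<Rightarrow> 'e)) set"

definition smooth_manifold ::
  "('m::{second_countable_topology,t2_space}, 'e::euclidean_space) atlas \<Rightarrow> bool" where
  "smooth_manifold A \<longleftrightarrow>
     (\<Union>(U, \<phi>)\<in>A. U) = UNIV \<and>
     (\<forall>(U, \<phi>)\<in>A. open U \<and> open (\<phi> ` U) \<and> homeomorphism U (\<phi> ` U) \<phi> (inv_into U \<phi>)) \<and>
     (\<forall>(U, \<phi>)\<in>A. \<forall>(V, \<psi>)\<in>A. smooth_on (\<phi> ` (U \<inter> V)) (\<psi> \<circ> inv_into U \<phi>))"

definition std_atlas :: "('e::euclidean_space, 'e) atlas" where
  "std_atlas = {(UNIV, id)}"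

definition prod_atlas :: "('m, 'e) atlas \<Rightarrow> ('k, 'f) atlas \<Rightarrow> ('m \<times> 'k, 'e \<times> 'f) atlas" where
  "prod_atlas A B = {(U \<times> V, map_prod \<phi> \<psi>) | U \<phi> V \<psi>. (U, \<phi>) \<in> A \<and> (V, \<psi>) \<in> B}"

definition smooth_open ::
  "('m::topological_space, 'e::euclidean_space) atlas \<Rightarrow>
   ('k::topological_space, 'f::euclidean_space) atlas \<Rightarrow> 'm set \<Rightarrow> ('m \<Rightarrow> 'k) \<Rightarrow> bool" where
  "smooth_open A B U F \<longleftrightarrow> open U \<and>
     (\<forall>p\<in>U. \<exists>(V, \<phi>)\<in>A. \<exists>(W, \<psi>)\<in>B. \<exists>N. open N \<and> p \<in> N \<and> N \<subseteq> U \<inter> V \<and> F ` N \<subseteq> W \<and>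
        smooth_on (\<phi> ` N) (\<psi> \<circ> F \<circ> inv_into V \<phi>))"

text \<open>Smoothness on an arbitrary subset \<open>S\<close> of a manifold means: locally the restriction of a smooth
  map defined on an open set. If \<open>S\<close> is open this is plain smoothness; if \<open>S\<close> is an embedded
  submanifold (such as a closed subgroup of a Lie group) it is smoothness for the induced
  manifold structure. Likewise, a map into the ambient manifold with values in an embedded
  submanifold is smooth into the submanifold iff it is smooth into the ambient manifold.\<close>

definition smooth_map ::
  "('m::topological_space, 'e::euclidean_space) atlas \<Rightarrow>
   ('k::topological_space, 'f::euclidean_space) atlas \<Rightarrow> 'm set \<Rightarrow> ('m \<Rightarrow> 'k) \<Rightarrow> bool" where
  "smooth_map A B S f \<longleftrightarrow>
     (\<forall>p\<in>S. \<exists>U F. p \<in> U \<and> smooth_open A B U F \<and> (\<forall>q\<in>S \<inter> U. F q = f q))"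

definition smooth_near ::
  "('m::topological_space, 'e::euclidean_space) atlas \<Rightarrow> 'm set \<Rightarrow> 'm \<Rightarrow> ('m \<Rightarrow> real) \<Rightarrow> bool" where
  "smooth_near A S p f \<longleftrightarrow> (\<exists>U. open U \<and> p \<in> U \<and> smooth_map A std_atlas (S \<inter> U) f)"

text \<open>A tangent vector of \<open>S\<close> at \<open>p\<close> is the velocity of a smooth curve in \<open>S\<close> through \<open>p\<close>,
  represented by the derivation it induces on functions smooth near \<open>p\<close>. Setting the derivation to
  \<open>0\<close> on all other functions makes the representation unique. The vector space operations
  are the pointwise ones.\<close>

type_synonym 'm tvec = "('m \<Rightarrow> real) \<Rightarrow> real"

definition velocity ::
  "('m::topological_space, 'e::euclidean_space) atlas \<Rightarrow> 'm set \<Rightarrow> (real \<Rightarrow> 'm) \<Rightarrow> 'm tvec" where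
  "velocity A S c = (\<lambda>f. if smooth_near A S (c 0) f then deriv (\<lambda>s. f (c s)) 0 else 0)"

definition tangent_space ::
  "('m::topological_space, 'e::euclidean_space) atlas \<Rightarrow> 'm set \<Rightarrow> 'm \<Rightarrow> 'm tvec set" where
  "tangent_space A S p = {velocity A S c | c. c 0 = p \<and>
     (\<exists>e>0. smooth_map std_atlas A {-e<..<e} c \<and> c ` {-e<..<e} \<subseteq> S)}"

text \<open>Push-forward of a tangent vector along a diffeomorphism \<open>h\<close>.\<close>

definition push :: "('m \<Rightarrow> 'm) \<Rightarrow> 'm tvec \<Rightarrow> 'm tvec" where
  "push h v = (\<lambda>f. v (f \<circ> h))"

text \<open>Covectors are linear functionals on the tangent space, extended by \<open>0\<close> to the whole type.\<close>

type_synonym 'm covec = "'m tvec \<Rightarrow> real"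

definition cotangent_space ::
  "('m::topological_space, 'e::euclidean_space) atlas \<Rightarrow> 'm set \<Rightarrow> 'm \<Rightarrow> 'm covec set" where
  "cotangent_space A S p = {\<omega>.
     (\<forall>v\<in>tangent_space A S p. \<forall>w\<in>tangent_space A S p. \<forall>a b.
        \<omega> (\<lambda>f. a * v f + b * w f) = a * \<omega> v + b * \<omega> w) \<and>
     (\<forall>v. v \<notin> tangent_space A S p \<longrightarrow> \<omega> v = 0)}"

text \<open>\<open>pull A S p h \<omega>\<close> is the pull-back to \<open>p\<close> of a covector \<open>\<omega>\<close> at \<open>h p\<close>.\<close>

definition pull ::
  "('m::topological_space, 'e::euclidean_space) atlas \<Rightarrow> 'm set \<Rightarrow> 'm \<Rightarrow> ('m \<Rightarrow> 'm) \<Rightarrow>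
   'm covec \<Rightarrow> 'm covec" where
  "pull A S p h \<omega> = (\<lambda>v. if v \<in> tangent_space A S p then \<omega> (push h v) else 0)"

definition differential ::
  "('m::topological_space, 'e::euclidean_space) atlas \<Rightarrow> 'm set \<Rightarrow> ('m \<Rightarrow> real) \<Rightarrow> 'm \<Rightarrow> 'm covec" where
  "differential A S f p = (\<lambda>v. if v \<in> tangent_space A S p then v f else 0)"

definition vector_field ::
  "('m::topological_space, 'e::euclidean_space) atlas \<Rightarrow> 'm set \<Rightarrow> ('m \<Rightarrow> 'm tvec) \<Rightarrow> bool" where
  "vector_field A S X \<longleftrightarrow> (\<forall>p\<in>S. X p \<in> tangent_space A S p \<and>
     (\<forall>f. smooth_near A S p f \<longrightarrow> smooth_near A S p (\<lambda>q. X q f)))"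

text \<open>A bivector at \<open>p\<close> is a skew-symmetric bilinear form on the cotangent space at \<open>p\<close>.\<close>

type_synonym 'm bivec = "'m \<Rightarrow> 'm covec \<Rightarrow> 'm covec \<Rightarrow> real"

definition pbracket ::
  "('m::topological_space, 'e::euclidean_space) atlas \<Rightarrow> 'm set \<Rightarrow> 'm bivec \<Rightarrow>
   ('m \<Rightarrow> real) \<Rightarrow> ('m \<Rightarrow> real) \<Rightarrow> 'm \<Rightarrow> real" where
  "pbracket A S PiS f h p = PiS p (differential A S f p) (differential A S h p)"

definition bivector_field ::
  "('m::topological_space, 'e::euclidean_space) atlas \<Rightarrow> 'm set \<Rightarrow> 'm bivec \<Rightarrow> bool" where
  "bivector_field A S PiS \<longleftrightarrow> (\<forall>p\<in>S.
     (\<forall>\<omega>\<in>cotangent_space A S p. \<forall>\<eta>\<in>cotangent_space A S p.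
        PiS p \<omega> \<eta> = - PiS p \<eta> \<omega> \<and>
        (\<forall>\<theta>\<in>cotangent_space A S p. \<forall>a b.
           PiS p (\<lambda>v. a * \<omega> v + b * \<eta> v) \<theta> = a * PiS p \<omega> \<theta> + b * PiS p \<eta> \<theta>)) \<and>
     (\<forall>f h. smooth_near A S p f \<longrightarrow> smooth_near A S p h \<longrightarrow>
        smooth_near A S p (pbracket A S PiS f h)))"

definition poisson_bivector ::
  "('m::topological_space, 'e::euclidean_space) atlas \<Rightarrow> 'm set \<Rightarrow> 'm bivec \<Rightarrow> bool" where
  "poisson_bivector A S PiS \<longleftrightarrow> bivector_field A S PiS \<and>
     (\<forall>p\<in>S. \<forall>f g h. smooth_near A S p f \<longrightarrow> smooth_near A S p g \<longrightarrow> smooth_near A S p h \<longrightarrow>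
        pbracket A S PiS f (pbracket A S PiS g h) p + pbracket A S PiS g (pbracket A S PiS h f) p +
        pbracket A S PiS h (pbracket A S PiS f g) p = 0)"

text \<open>The value \<open>(L\<^sub>X PiS)(df, dh)\<close> at \<open>p\<close> of the Lie derivative, by the Leibniz rule and
  \<open>L\<^sub>X df = d(X f)\<close>.\<close>

definition lie_derivative_bivec ::
  "('m::topological_space, 'e::euclidean_space) atlas \<Rightarrow> 'm set \<Rightarrow> ('m \<Rightarrow> 'm tvec) \<Rightarrow> 'm bivec \<Rightarrow>
   ('m \<Rightarrow> real) \<Rightarrow> ('m \<Rightarrow> real) \<Rightarrow> 'm \<Rightarrow> real" where
  "lie_derivative_bivec A S X PiS f h p =
     X p (pbracket A S PiS f h) - pbracket A S PiS (\<lambda>q. X q f) h p - pbracket A S PiS f (\<lambda>q. X q h) p"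

definition lie_group ::
  "('m::{second_countable_topology,t2_space}) monoid \<Rightarrow> ('m, 'e::euclidean_space) atlas \<Rightarrow> bool" where
  "lie_group D A \<longleftrightarrow> group D \<and> carrier D = UNIV \<and> smooth_manifold A \<and>
     smooth_map (prod_atlas A A) A UNIV (\<lambda>(p, q). p \<otimes>\<^bsub>D\<^esub> q) \<and>
     smooth_map A A UNIV (\<lambda>p. inv\<^bsub>D\<^esub> p)"

definition left_field :: "'m monoid \<Rightarrow> ('v \<Rightarrow> 'm tvec) \<Rightarrow> 'v \<Rightarrow> 'm \<Rightarrow> 'm tvec" where
  "left_field D lam u p = push (\<lambda>q. p \<otimes>\<^bsub>D\<^esub> q) (lam u)"

definition right_field :: "'m monoid \<Rightarrow> ('v \<Rightarrow> 'm tvec) \<Rightarrow> 'v \<Rightarrow> 'm \<Rightarrow> 'm tvec" where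
  "right_field D lam u p = push (\<lambda>q. q \<otimes>\<^bsub>D\<^esub> p) (lam u)"

text \<open>\<open>lam\<close> identifies the vector space \<open>'v\<close> with the tangent space at the unit of the Lie
  subgroup \<open>S\<close> of \<open>D\<close> (possibly \<open>S = UNIV\<close>), in such a way that \<open>br\<close> corresponds to the
  commutator of left-invariant vector fields.\<close>

definition lie_algebra_of ::
  "('m::topological_space) monoid \<Rightarrow> ('m, 'e::euclidean_space) atlas \<Rightarrow> 'm set \<Rightarrow>
   ('v::real_vector \<Rightarrow> 'm tvec) \<Rightarrow> ('v \<Rightarrow> 'v \<Rightarrow> 'v) \<Rightarrow> bool" where
  "lie_algebra_of D A S lam br \<longleftrightarrow>
     bij_betw lam UNIV (tangent_space A S \<one>\<^bsub>D\<^esub>) \<and>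
     (\<forall>u v a b f. lam (a *\<^sub>R u + b *\<^sub>R v) f = a * lam u f + b * lam v f) \<and>
     (\<forall>u v. \<forall>p\<in>S. \<forall>f. smooth_near A S p f \<longrightarrow>
        left_field D lam u p (\<lambda>q. left_field D lam v q f) -
        left_field D lam v p (\<lambda>q. left_field D lam u q f) = left_field D lam (br u v) p f)"

definition lie_Ad :: "'m monoid \<Rightarrow> ('v \<Rightarrow> 'm tvec) \<Rightarrow> 'm \<Rightarrow> 'v \<Rightarrow> 'v" where
  "lie_Ad D lam g u =
     inv_into UNIV lam (push (\<lambda>p. g \<otimes>\<^bsub>D\<^esub> p \<otimes>\<^bsub>D\<^esub> inv\<^bsub>D\<^esub> g) (lam u))"

text \<open>The element of the Lie algebra obtained by right-translating a tangent vector at \<open>g\<close>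
  back to the unit.\<close>

definition right_triv :: "'m monoid \<Rightarrow> ('v \<Rightarrow> 'm tvec) \<Rightarrow> 'm \<Rightarrow> 'm tvec \<Rightarrow> 'v" where
  "right_triv D lam g v = inv_into UNIV lam (push (\<lambda>p. p \<otimes>\<^bsub>D\<^esub> inv\<^bsub>D\<^esub> g) v)"

definition multiplicative_bivec ::
  "('m::topological_space) monoid \<Rightarrow> ('m, 'e::euclidean_space) atlas \<Rightarrow> 'm set \<Rightarrow> 'm bivec \<Rightarrow> bool" where
  "multiplicative_bivec D A S PiS \<longleftrightarrow> (\<forall>g\<in>S. \<forall>h\<in>S.
     \<forall>\<omega>\<in>cotangent_space A S (g \<otimes>\<^bsub>D\<^esub> h). \<forall>\<eta>\<in>cotangent_space A S (g \<otimes>\<^bsub>D\<^esub> h).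
       PiS (g \<otimes>\<^bsub>D\<^esub> h) \<omega> \<eta> =
         PiS h (pull A S h (\<lambda>q. g \<otimes>\<^bsub>D\<^esub> q) \<omega>) (pull A S h (\<lambda>q. g \<otimes>\<^bsub>D\<^esub> q) \<eta>) +
         PiS g (pull A S g (\<lambda>q. q \<otimes>\<^bsub>D\<^esub> h) \<omega>) (pull A S g (\<lambda>q. q \<otimes>\<^bsub>D\<^esub> h) \<eta>))"

type_synonym 'g dual = "'g \<Rightarrow>\<^sub>L real"

definition dual_bases :: "('n::finite \<Rightarrow> 'g::euclidean_space) \<Rightarrow> ('n \<Rightarrow> 'g dual) \<Rightarrow> bool" where
  "dual_bases t t' \<longleftrightarrow> inj t \<and> independent (range t) \<and> span (range t) = UNIV \<and>
     (\<forall>i j. t' i (t j) = (if i = j then 1 else 0))"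

definition lin_det ::
  "('n::finite \<Rightarrow> 'g::euclidean_space) \<Rightarrow> ('n \<Rightarrow> 'g dual) \<Rightarrow> ('g \<Rightarrow> 'g) \<Rightarrow> real" where
  "lin_det t t' f = det (\<chi> i j. t' i (f (t j)))"

definition lin_trace ::
  "('n::finite \<Rightarrow> 'g::euclidean_space) \<Rightarrow> ('n \<Rightarrow> 'g dual) \<Rightarrow> ('g \<Rightarrow> 'g) \<Rightarrow> real" where
  "lin_trace t t' f = trace (\<chi> i j. t' i (f (t j)))"

definition lin_trace_dual ::
  "('n::finite \<Rightarrow> 'g::euclidean_space) \<Rightarrow> ('n \<Rightarrow> 'g dual) \<Rightarrow> ('g dual \<Rightarrow> 'g dual) \<Rightarrow> real" where
  "lin_trace_dual t t' f = trace (\<chi> i j. (f (t' j)) (t i))"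

text \<open>A bilinear form as a map to the dual, inserting the vector in the second slot.\<close>

definition form_map :: "('g::euclidean_space \<Rightarrow> 'g \<Rightarrow> real) \<Rightarrow> 'g \<Rightarrow> 'g dual" where
  "form_map B x = Blinfun (\<lambda>y. B y x)"

definition skew_form :: "('g::euclidean_space \<Rightarrow> 'g \<Rightarrow> real) \<Rightarrow> bool" where
  "skew_form B \<longleftrightarrow> bilinear B \<and> (\<forall>x y. B x y = - B y x)"

definition pos_def_form :: "('g::euclidean_space \<Rightarrow> 'g \<Rightarrow> real) \<Rightarrow> bool" where
  "pos_def_form B \<longleftrightarrow> bilinear B \<and> (\<forall>x y. B x y = B y x) \<and> (\<forall>x. x \<noteq> 0 \<longrightarrow> B x x > 0)"

text \<open>Symmetric and skew-symmetric parts of a linear map from the dual, regarded as the bilinear form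
  \<open>(\<eta>, \<xi>) \<mapsto> \<eta> (E \<xi>)\<close>.\<close>

definition sym_part :: "('g::euclidean_space dual \<Rightarrow> 'g) \<Rightarrow> 'g dual \<Rightarrow> 'g" where
  "sym_part E \<xi> = (THE z. \<forall>\<eta>. blinfun_apply \<eta> z = (\<eta> (E \<xi>) + \<xi> (E \<eta>)) / 2)"

definition skew_part :: "('g::euclidean_space dual \<Rightarrow> 'g) \<Rightarrow> 'g dual \<Rightarrow> 'g" where
  "skew_part E \<xi> = (THE z. \<forall>\<eta>. blinfun_apply \<eta> z = (\<eta> (E \<xi>) - \<xi> (E \<eta>)) / 2)"

definition lie_algebra :: "('v::real_vector \<Rightarrow> 'v \<Rightarrow> 'v) \<Rightarrow> bool" where
  "lie_algebra br \<longleftrightarrow> bilinear br \<and> (\<forall>x. br x x = 0) \<and>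
     (\<forall>x y z. br x (br y z) + br y (br z x) + br z (br x y) = 0)"

definition coad :: "('g::euclidean_space \<Rightarrow> 'g \<Rightarrow> 'g) \<Rightarrow> 'g \<Rightarrow> 'g dual \<Rightarrow> 'g dual" where
  "coad br x \<eta> = Blinfun (\<lambda>y. - \<eta> (br x y))"

definition coad_dual ::
  "('g::euclidean_space dual \<Rightarrow> 'g dual \<Rightarrow> 'g dual) \<Rightarrow> 'g dual \<Rightarrow> 'g \<Rightarrow> 'g" where
  "coad_dual brs \<xi> y = (THE z. \<forall>\<eta>. blinfun_apply \<eta> z = - (brs \<xi> \<eta>) y)"

definition cobracket ::
  "('g::euclidean_space dual \<Rightarrow> 'g dual \<Rightarrow> 'g dual) \<Rightarrow> 'g \<Rightarrow> 'g dual \<Rightarrow> 'g dual \<Rightarrow> real" where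
  "cobracket brs x \<xi> \<eta> = (brs \<xi> \<eta>) x"

text \<open>The adjoint action on the tensor square, regarded as bilinear forms on the dual; \<open>- coad br x\<close>
  is the transpose of \<open>br x\<close>.\<close>

definition ad_tensor ::
  "('g::euclidean_space \<Rightarrow> 'g \<Rightarrow> 'g) \<Rightarrow> 'g \<Rightarrow> ('g dual \<Rightarrow> 'g dual \<Rightarrow> real) \<Rightarrow>
   'g dual \<Rightarrow> 'g dual \<Rightarrow> real" where
  "ad_tensor br x \<pi> \<xi> \<eta> = - \<pi> (coad br x \<xi>) \<eta> - \<pi> \<xi> (coad br x \<eta>)"

definition lie_bialgebra ::
  "('g::euclidean_space \<Rightarrow> 'g \<Rightarrow> 'g) \<Rightarrow> ('g dual \<Rightarrow> 'g dual \<Rightarrow> 'g dual) \<Rightarrow> bool" where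
  "lie_bialgebra br brs \<longleftrightarrow> lie_algebra br \<and> lie_algebra brs \<and>
     (\<forall>x y \<xi> \<eta>. cobracket brs (br x y) \<xi> \<eta> =
        ad_tensor br x (cobracket brs y) \<xi> \<eta> - ad_tensor br y (cobracket brs x) \<xi> \<eta>)"

type_synonym 'g double = "'g \<times> 'g dual"

fun dpair :: "'g::euclidean_space double \<Rightarrow> 'g double \<Rightarrow> real" where
  "dpair (x, \<xi>) (y, \<eta>) = \<eta> x + \<xi> y"

fun dbr ::
  "('g::euclidean_space \<Rightarrow> 'g \<Rightarrow> 'g) \<Rightarrow> ('g dual \<Rightarrow> 'g dual \<Rightarrow> 'g dual) \<Rightarrow>
   'g double \<Rightarrow> 'g double \<Rightarrow> 'g double" where
  "dbr br brs (x, \<xi>) (y, \<eta>) =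
     (br x y + coad_dual brs \<xi> y - coad_dual brs \<eta> x, brs \<xi> \<eta> + coad br x \<eta> - coad br y \<xi>)"

definition trace_ad ::
  "('n::finite \<Rightarrow> 'g::euclidean_space) \<Rightarrow> ('n \<Rightarrow> 'g dual) \<Rightarrow> ('g \<Rightarrow> 'g \<Rightarrow> 'g) \<Rightarrow> 'g dual" where
  "trace_ad t t' br = Blinfun (\<lambda>x. lin_trace t t' (br x))"

definition trace_ad_dual ::
  "('n::finite \<Rightarrow> 'g::euclidean_space) \<Rightarrow> ('n \<Rightarrow> 'g dual) \<Rightarrow>
   ('g dual \<Rightarrow> 'g dual \<Rightarrow> 'g dual) \<Rightarrow> 'g" where
  "trace_ad_dual t t' brs = (THE z. \<forall>\<xi>. blinfun_apply \<xi> z = lin_trace_dual t t' (brs \<xi>))"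

fun exp_B :: "('g::euclidean_space \<Rightarrow> 'g \<Rightarrow> real) \<Rightarrow> 'g double \<Rightarrow> 'g double" where
  "exp_B B (x, \<xi>) = (x, \<xi> + form_map B x)"

definition dbr' ::
  "('g::euclidean_space \<Rightarrow> 'g \<Rightarrow> 'g) \<Rightarrow> ('g dual \<Rightarrow> 'g dual \<Rightarrow> 'g dual) \<Rightarrow>
   ('g \<Rightarrow> 'g \<Rightarrow> real) \<Rightarrow> 'g double \<Rightarrow> 'g double \<Rightarrow> 'g double" where
  "dbr' br brs B0 u v = exp_B (\<lambda>x y. - B0 x y) (dbr br brs (exp_B B0 u) (exp_B B0 v))"

definition E_plus :: "('g::euclidean_space \<Rightarrow> 'g \<Rightarrow> real) \<Rightarrow> 'g double set" where
  "E_plus g0 = {(x, form_map g0 x) | x. True}"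

definition E_minus :: "('g::euclidean_space \<Rightarrow> 'g \<Rightarrow> real) \<Rightarrow> 'g double set" where
  "E_minus g0 = {(x, - form_map g0 x) | x. True}"

definition pr_plus :: "('g::euclidean_space \<Rightarrow> 'g \<Rightarrow> real) \<Rightarrow> 'g double \<Rightarrow> 'g double" where
  "pr_plus g0 u = (THE a. a \<in> E_plus g0 \<and> u - a \<in> E_minus g0)"

definition pr_minus :: "('g::euclidean_space \<Rightarrow> 'g \<Rightarrow> real) \<Rightarrow> 'g double \<Rightarrow> 'g double" where
  "pr_minus g0 u = (THE a. a \<in> E_minus g0 \<and> u - a \<in> E_plus g0)"

definition nabla0 ::
  "('g::euclidean_space \<Rightarrow> 'g \<Rightarrow> 'g) \<Rightarrow> ('g dual \<Rightarrow> 'g dual \<Rightarrow> 'g dual) \<Rightarrow>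
   ('g \<Rightarrow> 'g \<Rightarrow> real) \<Rightarrow> ('g \<Rightarrow> 'g \<Rightarrow> real) \<Rightarrow> 'g double \<Rightarrow> 'g double \<Rightarrow> 'g double" where
  "nabla0 br brs g0 B0 u v = (THE z. \<forall>w. dpair z w =
     - dpair (dbr' br brs B0 (pr_plus g0 u) (pr_minus g0 v)) (pr_minus g0 w)
     - dpair (dbr' br brs B0 (pr_minus g0 u) (pr_plus g0 v)) (pr_plus g0 w)
     - dpair (dbr' br brs B0 (pr_plus g0 u) (pr_plus g0 v)) (pr_plus g0 w) / 3
     - dpair (dbr' br brs B0 (pr_minus g0 u) (pr_minus g0 v)) (pr_minus g0 w) / 3)"

text \<open>The right-invariant \<open>1\<close>-form with value \<open>x\<close> at the unit; \<open>lam\<close> identifies the dual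
  \<open>'g dual\<close> with the tangent space of \<open>S\<close> at the unit.\<close>

definition right_form ::
  "('m::topological_space) monoid \<Rightarrow> ('m, 'e::euclidean_space) atlas \<Rightarrow> 'm set \<Rightarrow>
   ('g::euclidean_space dual \<Rightarrow> 'm tvec) \<Rightarrow> 'g \<Rightarrow> 'm \<Rightarrow> 'm covec" where
  "right_form D A S lam x g =
     (\<lambda>v. if v \<in> tangent_space A S g then (right_triv D lam g v) x else 0)"

text \<open>\<open>(L\<^sub>X PiS)(x, y) = \<langle>\<zeta>, [x, y]\<rangle>\<close> at the unit, for all vector fields \<open>X\<close> with value \<open>\<zeta>\<close> there.
  The covectors \<open>x\<close> and \<open>y\<close> at the unit are represented as differentials of functions.\<close>

definition dual_bivec ::
  "('m::topological_space) monoid \<Rightarrow> ('m, 'e::euclidean_space) atlas \<Rightarrow> 'm set \<Rightarrow>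
   ('g::euclidean_space dual \<Rightarrow> 'm tvec) \<Rightarrow> ('g \<Rightarrow> 'g \<Rightarrow> 'g) \<Rightarrow> 'm bivec \<Rightarrow> bool" where
  "dual_bivec D A S lam br PiS \<longleftrightarrow> (\<forall>X \<zeta> f h x y.
     vector_field A S X \<longrightarrow> X \<one>\<^bsub>D\<^esub> = lam \<zeta> \<longrightarrow>
     smooth_near A S \<one>\<^bsub>D\<^esub> f \<longrightarrow> smooth_near A S \<one>\<^bsub>D\<^esub> h \<longrightarrow>
     (\<forall>\<xi>. differential A S f \<one>\<^bsub>D\<^esub> (lam \<xi>) = \<xi> x) \<longrightarrow>
     (\<forall>\<xi>. differential A S h \<one>\<^bsub>D\<^esub> (lam \<xi>) = \<xi> y) \<longrightarrow>
     lie_derivative_bivec A S X PiS f h \<one>\<^bsub>D\<^esub> = \<zeta> (br x y))"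

definition Pi_bold ::
  "('m::topological_space) monoid \<Rightarrow> ('m, 'e::euclidean_space) atlas \<Rightarrow> 'm set \<Rightarrow>
   ('g::euclidean_space dual \<Rightarrow> 'm tvec) \<Rightarrow> 'm bivec \<Rightarrow> 'm \<Rightarrow> 'g \<Rightarrow> 'g \<Rightarrow> real" where
  "Pi_bold D A S lam PiS g x y = PiS g (right_form D A S lam x g) (right_form D A S lam y g)"

text \<open>In the following, \<open>P\<close> is the value of \<open>Pi_bold\<close> at a point of the dual group.\<close>

definition E_tilde ::
  "('g::euclidean_space \<Rightarrow> 'g \<Rightarrow> real) \<Rightarrow> ('g \<Rightarrow> 'g \<Rightarrow> real) \<Rightarrow> ('g \<Rightarrow> 'g \<Rightarrow> real) \<Rightarrow>
   'g dual \<Rightarrow> 'g" where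
  "E_tilde g0 B0 P = inv_into UNIV (\<lambda>x. form_map g0 x + form_map B0 x + form_map P x)"

definition j_map ::
  "('g::euclidean_space \<Rightarrow> 'g \<Rightarrow> real) \<Rightarrow> ('g \<Rightarrow> 'g \<Rightarrow> real) \<Rightarrow> 'g \<Rightarrow> 'g double" where
  "j_map B0 P x = (x, - (form_map P x + form_map B0 x))"

definition phi_tilde ::
  "('g::euclidean_space \<Rightarrow> 'g \<Rightarrow> real) \<Rightarrow> ('g \<Rightarrow> 'g \<Rightarrow> real) \<Rightarrow>
   ('n::finite \<Rightarrow> 'g) \<Rightarrow> ('n \<Rightarrow> 'g dual) \<Rightarrow> ('m \<Rightarrow> 'g \<Rightarrow> 'g \<Rightarrow> real) \<Rightarrow> 'm \<Rightarrow> real" where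
  "phi_tilde g0 B0 t t' Pb g = - (1/2) * ln \<bar>lin_det t t'
     (\<lambda>x. x + inv_into UNIV (form_map g0) (form_map (Pb g) x + form_map B0 x))\<bar>"

text \<open>The \<open>1\<close>-form \<open>W'\<close> on the dual group; a tangent vector \<open>v\<close> at \<open>g\<close> is the value at \<open>g\<close> of the
  right-invariant vector field of \<open>\<zeta> = right_triv D lam g v\<close>.\<close>

definition W_prime ::
  "'m monoid \<Rightarrow> ('g::euclidean_space dual \<Rightarrow> 'm tvec) \<Rightarrow>
   ('g \<Rightarrow> 'g \<Rightarrow> 'g) \<Rightarrow> ('g dual \<Rightarrow> 'g dual \<Rightarrow> 'g dual) \<Rightarrow>
   ('g \<Rightarrow> 'g \<Rightarrow> real) \<Rightarrow> ('g \<Rightarrow> 'g \<Rightarrow> real) \<Rightarrow> ('n::finite \<Rightarrow> 'g) \<Rightarrow> ('n \<Rightarrow> 'g dual) \<Rightarrow>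
   ('m \<Rightarrow> 'g \<Rightarrow> 'g \<Rightarrow> real) \<Rightarrow> 'm \<Rightarrow> 'm covec" where
  "W_prime D lam br brs g0 B0 t t' Pb g v =
     (let P = Pb g; gt = sym_part (E_tilde g0 B0 P); \<zeta> = right_triv D lam g v in
      \<Sum>k\<in>UNIV. dpair (nabla0 br brs g0 B0 (j_map B0 P (gt (t' k))) (j_map B0 P (t k)))
                      (j_map B0 P (gt \<zeta>)))"

end

theory Submission
  imports Defs
begin

text \<open>
  In the right trivialisation the multiplicativity of the bivector reads
  \<open>P\<^sub>h\<^sub>g = P\<^sub>h + Ad\<^sub>h \<cdot> P\<^sub>g\<close>, and differentiating in \<open>h\<close> at the unit expresses the derivative
  of \<open>P\<close> along a right-invariant field through \<open>P\<close> and the two brackets. By Jacobi's formula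
  \<open>d\<phi>\<close> is then \<open>-1/2\<close> times the trace of \<open>(E\<^sub>0 + P)\<^sup>-\<^sup>1\<close> against this derivative, to which only the
  skew part of \<open>(E\<^sub>0 + P)\<^sup>-\<^sup>1\<close> contributes.

  For \<open>W'\<close> the defining trace is expanded in the double: the terms with coefficient \<open>1/3\<close> contract
  a symmetric tensor with a skew form and vanish, and all terms containing \<open>g\<^sub>0\<close> or \<open>B\<^sub>0\<close>
  explicitly cancel. The remaining difference to \<open>d\<phi>\<close> is removed by the Jacobi identity of the
  bivector, contracted with the skew part, and by a formula for \<open>Ad\<^sub>g \<alpha> - \<alpha>\<close> as a
  contraction of \<open>P\<^sub>g\<close>. Both sides of that formula are cocycles on the connected group whose
  derivatives at the unit agree by the contracted cocycle condition of the bialgebra. The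
  projection \<open>D = G G\<^sup>* \<rightarrow> G\<^sup>*\<close> is a smooth retraction, so that the closed
  subgroup is locally connected by smooth curves and no charts of it are needed.
\<close>

section \<open>Smooth functions on open subsets of Euclidean spaces\<close>

text \<open>Two features of the definitions shape the analytic half. A tangent vector is a
  functional on all functions, with value \<open>0\<close> on those that are not smooth near the
  point, so equalities of tangent vectors are plain equalities while the rules of differentiation
  carry smoothness hypotheses. And the bivector is known to be smooth only through brackets of
  functions: the smoothness of its components has to be recovered, at the unit by solving linear
  systems and elsewhere by multiplicativity. The algebraic half rests on one observation: the plus
  and minus parts of \<open>j (gt \<xi>)\<close> are given by \<open>E \<xi>\<close> and by the
  transpose \<open>ET \<xi>\<close>. Operators can then be moved between the two factors of a
  contraction until \<open>W'\<close> depends on \<open>\<zeta>\<close> only through the difference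
  of its two parts, in which \<open>E\<close> occurs through its skew part alone. This is why the
  final formulas involve \<open>Bt\<close> but not \<open>gt\<close>.\<close>

lemma Ck_on_cong:
  fixes f g :: "'a::euclidean_space \<Rightarrow> 'b::real_normed_vector"
  assumes "open U" "Ck_on k U f" "\<And>x. x \<in> U \<Longrightarrow> f x = g x"
  shows "Ck_on k U g"
  using assms(2,3)
proof (induction k arbitrary: f g)
  case 0
  then show ?case by (auto cong: continuous_on_cong)
next
  case (Suc k)
  have d: "g differentiable (at x) \<and> frechet_derivative f (at x) = frechet_derivative g (at x)" if "x \<in> U" for x
  proof -
    have "(f has_derivative frechet_derivative f (at x)) (at x)"
      using Suc.prems that by (simp add: frechet_derivative_works)
    then have "(g has_derivative frechet_derivative f (at x)) (at x)"
      by (rule has_derivative_transform_within_open[OF _ \<open>open U\<close> that]) (use Suc.prems in auto)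
    then show ?thesis
      using frechet_derivative_at differentiable_def by metis
  qed
  have "Ck_on k U (\<lambda>x. frechet_derivative g (at x) v)" for v
    by (rule Suc.IH[of "\<lambda>x. frechet_derivative f (at x) v"]) (use Suc.prems d in auto)
  then show ?case using d by simp
qed

text \<open>\<open>Ck_on\<close> is phrased with the choice-defined
  \<open>frechet_derivative\<close>; by uniqueness of derivatives on an open set any explicit
  derivative \<open>f'\<close> may stand in for it. The inductions over \<open>k\<close> for sums,
  products, compositions, inverses and logarithms run through this rule.\<close>

lemma Ck_on_SucI:
  assumes "open U" "\<And>x. x \<in> U \<Longrightarrow> (f has_derivative f' x) (at x)"
    and "\<And>v. Ck_on k U (\<lambda>x. f' x v)"
  shows "Ck_on (Suc k) U f"
proof -
  have *: "frechet_derivative f (at x) = f' x" if "x \<in> U" for x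
    using assms(2)[OF that] frechet_derivative_at by metis
  have "Ck_on k U (\<lambda>x. frechet_derivative f (at x) v)" for v
    by (rule Ck_on_cong[OF assms(1) assms(3)[of v]]) (simp add: *)
  then show ?thesis
    using assms(2) by (auto simp: differentiable_def)
qed

lemma Ck_on_SucD:
  assumes "Ck_on (Suc k) U f" "x \<in> U"
  shows "(f has_derivative frechet_derivative f (at x)) (at x)"
  using assms by (simp add: frechet_derivative_works)

lemma Ck_on_SucD': "Ck_on (Suc k) U f \<Longrightarrow> Ck_on k U (\<lambda>x. frechet_derivative f (at x) v)"
  by simp

lemma Ck_on_subset: "Ck_on k U f \<Longrightarrow> V \<subseteq> U \<Longrightarrow> Ck_on k V f"
  by (induction k arbitrary: f) (auto intro: continuous_on_subset)

lemma Ck_on_Suc_imp: "Ck_on (Suc k) U f \<Longrightarrow> Ck_on k U f"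
proof (induction k arbitrary: f)
  case 0
  then show ?case
    by (simp add: continuous_at_imp_continuous_on differentiable_imp_continuous_within)
next
  case (Suc k)
  then show ?case by simp
qed

lemma Ck_on_const: "open U \<Longrightarrow> Ck_on k U (\<lambda>x. c)"
proof (induction k arbitrary: c)
  case (Suc k)
  then show ?case by (intro Ck_on_SucI[where f' = "\<lambda>x v. 0"]) auto
qed simp

lemma Ck_on_linear_comp:
  assumes L: "bounded_linear L" and U: "open U"
  shows "Ck_on k U f \<Longrightarrow> Ck_on k U (\<lambda>x. L (f x))"
proof (induction k arbitrary: f)
  case 0
  then show ?case by (simp add: L bounded_linear.continuous_on)
next
  case (Suc k)
  show ?case
    by (rule Ck_on_SucI[where f' = "\<lambda>x v. L (frechet_derivative f (at x) v)"])
      (use U Ck_on_SucD[OF Suc.prems] Suc in \<open>auto intro: bounded_linear.has_derivative[OF L]\<close>)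
qed

lemma Ck_on_linear: "bounded_linear L \<Longrightarrow> open U \<Longrightarrow> Ck_on k U L"
proof (induction k)
  case 0
  then show ?case by (simp add: linear_continuous_on)
next
  case (Suc k)
  then show ?case 
    by (intro Ck_on_SucI[where f' = "\<lambda>x. L"]) (auto intro: bounded_linear_imp_has_derivative Ck_on_const)
qed

lemma Ck_on_add: "open U \<Longrightarrow> Ck_on k U f \<Longrightarrow> Ck_on k U g \<Longrightarrow> Ck_on k U (\<lambda>x. f x + g x)"
proof (induction k arbitrary: f g)
  case 0
  then show ?case by (simp add: continuous_on_add)
next
  case (Suc k)
  show ?case
    by (rule Ck_on_SucI[where f' = "\<lambda>x v. frechet_derivative f (at x) v + frechet_derivative g (at x) v"])
      (use Suc Ck_on_SucD[OF Suc.prems(2)] Ck_on_SucD[OF Suc.prems(3)] in \<open>auto intro: has_derivative_add\<close>)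
qed

lemma Ck_on_sum: "open U \<Longrightarrow> (\<And>i. i \<in> I \<Longrightarrow> Ck_on k U (f i)) \<Longrightarrow> Ck_on k U (\<lambda>x. \<Sum>i\<in>I. f i x)"
  by (induction I rule: infinite_finite_induct) (auto intro: Ck_on_const Ck_on_add)

lemma Ck_on_bilinear:
  assumes B: "bounded_bilinear m" and U: "open U"
  shows "Ck_on k U f \<Longrightarrow> Ck_on k U g \<Longrightarrow> Ck_on k U (\<lambda>x. m (f x) (g x))"
proof (induction k arbitrary: f g)
  case 0
  then show ?case by (auto intro: bounded_bilinear.continuous_on[OF B])
next
  case (Suc k)
  have "Ck_on k U (\<lambda>x. m (f x) (frechet_derivative g (at x) v) + m (frechet_derivative f (at x) v) (g x))" for v
    by (intro Ck_on_add U Suc.IH Ck_on_SucD' Ck_on_Suc_imp[OF Suc.prems(1)] Ck_on_Suc_imp[OF Suc.prems(2)] Suc.prems)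
  moreover have "((\<lambda>x. m (f x) (g x)) has_derivative
      (\<lambda>v. m (f x) (frechet_derivative g (at x) v) + m (frechet_derivative f (at x) v) (g x))) (at x)"
    if "x \<in> U" for x
    by (rule bounded_bilinear.FDERIV[OF B Ck_on_SucD[OF Suc.prems(1) that] Ck_on_SucD[OF Suc.prems(2) that]])
  ultimately show ?case
    by (intro Ck_on_SucI U)
qed

text \<open>\<open>Ck_on\<close> controls the derivative in fixed directions only, whereas the chain
  rule evaluates the derivative of \<open>g\<close> in a direction that moves with \<open>x\<close>.
  Expanding this direction in \<open>Basis\<close> yields a finite sum of products to which the
  induction hypothesis and the product rule apply.\<close>

lemma Ck_on_compose:
  fixes f :: "'a::euclidean_space \<Rightarrow> 'b::euclidean_space" and g :: "'b \<Rightarrow> 'c::real_normed_vector"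
  assumes U: "open U" and V: "open V" and UV: "f ` U \<subseteq> V"
  shows "Ck_on k V g \<Longrightarrow> Ck_on k U f \<Longrightarrow> Ck_on k U (\<lambda>x. g (f x))"
proof (induction k arbitrary: g)
  case 0
  then show ?case using UV by (auto intro: continuous_on_compose2)
next
  case (Suc k)
  let ?D = "\<lambda>x v. \<Sum>b\<in>Basis. (frechet_derivative f (at x) v \<bullet> b) *\<^sub>R frechet_derivative g (at (f x)) b"
  show ?case
  proof (rule Ck_on_SucI[OF U, where f' = ?D])
    fix x assume x: "x \<in> U"
    note df = Ck_on_SucD[OF Suc.prems(2) x]
    have "f x \<in> V" using x UV by auto
    note dg = Ck_on_SucD[OF Suc.prems(1) this]
    have lin: "linear (frechet_derivative g (at (f x)))"
      using dg has_derivative_linear by blast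
    have eq: "frechet_derivative g (at (f x)) w = (\<Sum>b\<in>Basis. (w \<bullet> b) *\<^sub>R frechet_derivative g (at (f x)) b)" for w
      by (subst euclidean_representation[symmetric, of w]) (simp only: linear_sum[OF lin] linear_scale[OF lin])
    have "((\<lambda>x. g (f x)) has_derivative (\<lambda>v. frechet_derivative g (at (f x)) (frechet_derivative f (at x) v))) (at x)"
      using df dg by (rule has_derivative_compose)
    then show "((\<lambda>x. g (f x)) has_derivative ?D x) (at x)"
      by (subst (asm) eq)
  next
    fix v
    have "Ck_on k U (\<lambda>x. frechet_derivative g (at (f x)) b)" for b
      using Suc.IH[OF Ck_on_SucD'[OF Suc.prems(1)] Ck_on_Suc_imp[OF Suc.prems(2)]] .
    moreover have "Ck_on k U (\<lambda>x. frechet_derivative f (at x) v \<bullet> b)" for b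
      by (rule Ck_on_linear_comp[OF bounded_linear_inner_left U Ck_on_SucD'[OF Suc.prems(2)]])
    ultimately show "Ck_on k U (\<lambda>x. ?D x v)"
      by (intro Ck_on_sum[OF U] Ck_on_bilinear[OF bounded_bilinear_scaleR U])
  qed
qed

lemma Ck_on_inverse:
  fixes f :: "'a::euclidean_space \<Rightarrow> real"
  assumes U: "open U" and nz: "\<And>x. x \<in> U \<Longrightarrow> f x \<noteq> 0"
  shows "Ck_on k U f \<Longrightarrow> Ck_on k U (\<lambda>x. inverse (f x))"
proof (induction k)
  case 0
  then show ?case using nz by (simp add: continuous_on_inverse)
next
  case (Suc k)
  let ?D = "\<lambda>x v. - (inverse (f x) * frechet_derivative f (at x) v * inverse (f x))"
  have "Ck_on k U (\<lambda>x. inverse (f x))"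
    using Suc Ck_on_Suc_imp by blast
  then have "Ck_on k U (\<lambda>x. ?D x v)" for v
    by (intro Ck_on_linear_comp[OF bounded_linear_minus[OF bounded_linear_ident] U]
        Ck_on_bilinear[OF bounded_bilinear_mult U] Ck_on_SucD' Suc.prems)
  then show ?case
    by (intro Ck_on_SucI[where f' = ?D] U Deriv.has_derivative_inverse nz Ck_on_SucD[OF Suc.prems])
qed

lemma DERIV_ln_abs: "y \<noteq> 0 \<Longrightarrow> ((\<lambda>y. ln \<bar>y\<bar>) has_real_derivative inverse y) (at y)" for y :: real
proof (cases "y > 0")
  case True
  have "(ln has_real_derivative inverse y) (at y)"
    using True by (auto intro!: derivative_eq_intros simp: field_simps)
  then show ?thesis
    by (rule has_field_derivative_transform_within_open[where S = "{0<..}"]) (use True in auto)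
next
  case False
  assume y: "y \<noteq> 0"
  have "((\<lambda>y. ln (- y)) has_real_derivative inverse y) (at y)"
    using False y by (auto intro!: derivative_eq_intros simp: field_simps)
  then show ?thesis
    by (rule has_field_derivative_transform_within_open[where S = "{..<0}"]) (use False y in auto)
qed

lemma Ck_on_ln_abs:
  fixes f :: "'a::euclidean_space \<Rightarrow> real"
  assumes U: "open U" and nz: "\<And>x. x \<in> U \<Longrightarrow> f x \<noteq> 0"
  shows "Ck_on k U f \<Longrightarrow> Ck_on k U (\<lambda>x. ln \<bar>f x\<bar>)"
proof (induction k)
  case 0
  then have "continuous_on U (\<lambda>x. ln \<bar>f x\<bar>)"
    using nz by (intro continuous_on_ln continuous_on_rabs) auto
  then show ?case by simp
next
  case (Suc k)
  let ?D = "\<lambda>x v. frechet_derivative f (at x) v * inverse (f x)"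
  have "((\<lambda>x. ln \<bar>f x\<bar>) has_derivative ?D x) (at x)" if x: "x \<in> U" for x
  proof -
    from DERIV_ln_abs[OF nz[OF x]] have "((\<lambda>y. ln \<bar>y\<bar>) has_derivative (\<lambda>v. v * inverse (f x))) (at (f x))"
      by (simp add: has_field_derivative_def mult_commute_abs)
    from has_derivative_compose[OF Ck_on_SucD[OF Suc.prems x] this] show ?thesis .
  qed
  moreover have "Ck_on k U (\<lambda>x. ?D x v)" for v
    by (intro Ck_on_bilinear[OF bounded_bilinear_mult U] Ck_on_inverse U nz Ck_on_SucD' Ck_on_Suc_imp[OF Suc.prems] Suc.prems)
  ultimately show ?case by (intro Ck_on_SucI[where f' = ?D] U)
qed


section \<open>Closure rules for smooth functions on open sets\<close>

lemma smooth_on_cong: "open U \<Longrightarrow> smooth_on U f \<Longrightarrow> (\<And>x. x \<in> U \<Longrightarrow> f x = g x) \<Longrightarrow> smooth_on U g"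
  unfolding smooth_on_def using Ck_on_cong by blast

lemma smooth_on_subset: "smooth_on U f \<Longrightarrow> V \<subseteq> U \<Longrightarrow> smooth_on V f"
  unfolding smooth_on_def using Ck_on_subset by blast

lemma smooth_on_imp_continuous_on: "smooth_on U f \<Longrightarrow> continuous_on U f"
  unfolding smooth_on_def by (metis Ck_on.simps(1))

lemma smooth_on_has_derivative:
  "smooth_on U f \<Longrightarrow> x \<in> U \<Longrightarrow> (f has_derivative frechet_derivative f (at x)) (at x)"
  unfolding smooth_on_def using Ck_on_SucD by blast

lemma smooth_on_frechet_derivative: "smooth_on U f \<Longrightarrow> smooth_on U (\<lambda>x. frechet_derivative f (at x) v)"
  unfolding smooth_on_def using Ck_on_SucD' by blast

lemma smooth_on_const: "open U \<Longrightarrow> smooth_on U (\<lambda>x. c)"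
  by (simp add: smooth_on_def Ck_on_const)

lemma smooth_on_linear: "bounded_linear L \<Longrightarrow> open U \<Longrightarrow> smooth_on U L"
  by (simp add: smooth_on_def Ck_on_linear)

lemma smooth_on_ident: "open U \<Longrightarrow> smooth_on U (\<lambda>x. x)"
  by (rule smooth_on_linear[OF bounded_linear_ident])

lemma smooth_on_linear_comp:
  "bounded_linear L \<Longrightarrow> open U \<Longrightarrow> smooth_on U f \<Longrightarrow> smooth_on U (\<lambda>x. L (f x))"
  by (simp add: smooth_on_def Ck_on_linear_comp)

lemma smooth_on_add: "open U \<Longrightarrow> smooth_on U f \<Longrightarrow> smooth_on U g \<Longrightarrow> smooth_on U (\<lambda>x. f x + g x)"
  by (simp add: smooth_on_def Ck_on_add)

lemma smooth_on_mult:
  fixes f g :: "'a::euclidean_space \<Rightarrow> real"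
  shows "open U \<Longrightarrow> smooth_on U f \<Longrightarrow> smooth_on U g \<Longrightarrow> smooth_on U (\<lambda>x. f x * g x)"
  by (simp add: smooth_on_def Ck_on_bilinear[OF bounded_bilinear_mult])

lemma smooth_on_inverse:
  fixes f :: "'a::euclidean_space \<Rightarrow> real"
  shows "open U \<Longrightarrow> (\<And>x. x \<in> U \<Longrightarrow> f x \<noteq> 0) \<Longrightarrow> smooth_on U f \<Longrightarrow> smooth_on U (\<lambda>x. inverse (f x))"
  by (simp add: smooth_on_def Ck_on_inverse)

lemma smooth_on_ln_abs:
  fixes f :: "'a::euclidean_space \<Rightarrow> real"
  shows "open U \<Longrightarrow> (\<And>x. x \<in> U \<Longrightarrow> f x \<noteq> 0) \<Longrightarrow> smooth_on U f \<Longrightarrow> smooth_on U (\<lambda>x. ln \<bar>f x\<bar>)"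
  by (simp add: smooth_on_def Ck_on_ln_abs)

lemma smooth_on_compose:
  fixes f :: "'a::euclidean_space \<Rightarrow> 'b::euclidean_space" and g :: "'b \<Rightarrow> 'c::real_normed_vector"
  assumes "open U" "open V" "f ` U \<subseteq> V" "smooth_on V g" "smooth_on U f"
  shows "smooth_on U (\<lambda>x. g (f x))"
  using assms by (simp add: smooth_on_def Ck_on_compose[of U V])

lemma smooth_on_Pair:
  assumes "open U" "smooth_on U f" "smooth_on U g"
  shows "smooth_on U (\<lambda>x. (f x, g x))"
proof -
  have "bounded_linear (\<lambda>y. (y, 0::'c))" "bounded_linear (\<lambda>z. (0::'b, z))"
    by (auto intro!: bounded_linear_Pair bounded_linear_ident bounded_linear_zero)
  then have "smooth_on U (\<lambda>x. (f x, 0::'c) + (0::'b, g x))"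
    using assms by (intro smooth_on_add smooth_on_linear_comp[of "\<lambda>y. (y, 0::'c)"] smooth_on_linear_comp[of "\<lambda>z. (0::'b, z)"])
  then show ?thesis by simp
qed

text \<open>Two applications of the mean value theorem: in the direction \<open>u\<close> to the
  increment of \<open>f\<close> by \<open>t v\<close>, then in the direction \<open>v\<close> to the
  derivative obtained.\<close>

lemma second_difference_mean_value:
  fixes f :: "'a::euclidean_space \<Rightarrow> real"
  assumes f: "smooth_on N f" and t: "t > 0"
    and box: "\<And>\<alpha> \<beta>. 0 \<le> \<alpha> \<Longrightarrow> \<alpha> \<le> t \<Longrightarrow> 0 \<le> \<beta> \<Longrightarrow> \<beta> \<le> t \<Longrightarrow> p + \<alpha> *\<^sub>R u + \<beta> *\<^sub>R v \<in> N"
  obtains \<alpha> \<beta> where "0 \<le> \<alpha>" "\<alpha> \<le> t" "0 \<le> \<beta>" "\<beta> \<le> t"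
    "f (p + t *\<^sub>R u + t *\<^sub>R v) - f (p + t *\<^sub>R u) - f (p + t *\<^sub>R v) + f p =
      t * t * frechet_derivative (\<lambda>x. frechet_derivative f (at x) u) (at (p + \<alpha> *\<^sub>R u + \<beta> *\<^sub>R v)) v"
proof -
  have line: "((\<lambda>s. g (q + s *\<^sub>R w)) has_real_derivative frechet_derivative g (at (q + s *\<^sub>R w)) w) (at s)"
    if "smooth_on N g" "q + s *\<^sub>R w \<in> N" for g :: "'a \<Rightarrow> real" and q w s
  proof -
    have 1: "((\<lambda>s. q + s *\<^sub>R w) has_derivative (\<lambda>h. h *\<^sub>R w)) (at s)"
      by (auto intro!: derivative_eq_intros)
    note 2 = smooth_on_has_derivative[OF that]
    from has_derivative_compose[OF 1 2] show ?thesis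
      using linear_scale[OF has_derivative_linear[OF 2]]
      by (simp add: has_field_derivative_def mult_commute_abs)
  qed
  let ?g = "\<lambda>x. frechet_derivative f (at x) u"
  have "\<exists>\<alpha>>0. \<alpha> < t \<and> (f ((p + t *\<^sub>R v) + t *\<^sub>R u) - f (p + t *\<^sub>R u)) - (f ((p + t *\<^sub>R v) + 0 *\<^sub>R u) - f (p + 0 *\<^sub>R u)) =
      (t - 0) * (?g ((p + t *\<^sub>R v) + \<alpha> *\<^sub>R u) - ?g (p + \<alpha> *\<^sub>R u))"
  proof (rule MVT2[OF t, where f = "\<lambda>s. f ((p + t *\<^sub>R v) + s *\<^sub>R u) - f (p + s *\<^sub>R u)"])
    fix s assume "0 \<le> s" "s \<le> t"
    then have "(p + t *\<^sub>R v) + s *\<^sub>R u \<in> N" "p + s *\<^sub>R u \<in> N"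
      using box[of s t] box[of s 0] t by (auto simp: algebra_simps)
    then show "((\<lambda>s. f ((p + t *\<^sub>R v) + s *\<^sub>R u) - f (p + s *\<^sub>R u)) has_real_derivative
       (?g ((p + t *\<^sub>R v) + s *\<^sub>R u) - ?g (p + s *\<^sub>R u))) (at s)"
      by (intro DERIV_diff line f)
  qed
  then obtain \<alpha> where \<alpha>: "0 < \<alpha>" "\<alpha> < t"
    "(f ((p + t *\<^sub>R v) + t *\<^sub>R u) - f (p + t *\<^sub>R u)) - (f ((p + t *\<^sub>R v) + 0 *\<^sub>R u) - f (p + 0 *\<^sub>R u)) =
      (t - 0) * (?g ((p + t *\<^sub>R v) + \<alpha> *\<^sub>R u) - ?g (p + \<alpha> *\<^sub>R u))"
    by blast
  have "\<exists>\<beta>>0. \<beta> < t \<and> ?g ((p + \<alpha> *\<^sub>R u) + t *\<^sub>R v) - ?g ((p + \<alpha> *\<^sub>R u) + 0 *\<^sub>R v) =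
      (t - 0) * frechet_derivative ?g (at ((p + \<alpha> *\<^sub>R u) + \<beta> *\<^sub>R v)) v"
    by (rule MVT2[OF t, where f = "\<lambda>s. ?g ((p + \<alpha> *\<^sub>R u) + s *\<^sub>R v)"])
      (rule line[OF smooth_on_frechet_derivative[OF f]], use \<alpha> box in auto)
  then obtain \<beta> where \<beta>: "0 < \<beta>" "\<beta> < t" "?g ((p + \<alpha> *\<^sub>R u) + t *\<^sub>R v) - ?g ((p + \<alpha> *\<^sub>R u) + 0 *\<^sub>R v) =
      (t - 0) * frechet_derivative ?g (at ((p + \<alpha> *\<^sub>R u) + \<beta> *\<^sub>R v)) v"
    by blast
  show thesis
    by (rule that[of \<alpha> \<beta>]) (use \<alpha> \<beta> in \<open>simp_all add: algebra_simps\<close>)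
qed

text \<open>The second difference over a small parallelogram does not depend on the order of
  \<open>u\<close> and \<open>v\<close>, so the two mixed derivatives, taken at suitable points near
  \<open>p\<close>, coincide. By continuity each of these values differs from the value at
  \<open>p\<close> by less than half of the assumed gap, a contradiction.\<close>

lemma frechet_derivative_commute:
  fixes f :: "'a::euclidean_space \<Rightarrow> real"
  assumes f: "smooth_on N f" and N: "open N" "p \<in> N"
  shows "frechet_derivative (\<lambda>x. frechet_derivative f (at x) u) (at p) v =
    frechet_derivative (\<lambda>x. frechet_derivative f (at x) v) (at p) u"
proof (rule ccontr)
  define Q where "Q = (\<lambda>u v x. frechet_derivative (\<lambda>x. frechet_derivative f (at x) u) (at x) v)"
  assume "\<not> ?thesis"
  then have e: "\<bar>Q u v p - Q v u p\<bar> / 2 > 0" (is "?e > 0") by (simp add: Q_def)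
  have "continuous_on N (Q a b)" for a b
    unfolding Q_def by (intro smooth_on_imp_continuous_on smooth_on_frechet_derivative f)
  then have "(Q a b \<longlongrightarrow> Q a b p) (nhds p)" for a b
    using N by (simp add: continuous_on_eq_continuous_at isCont_def tendsto_nhds_iff)
  then have ev: "\<forall>\<^sub>F x in nhds p. dist (Q a b x) (Q a b p) < ?e" for a b
    using e by (intro tendstoD)
  have "\<forall>\<^sub>F x in nhds p. x \<in> N \<and> dist (Q u v x) (Q u v p) < ?e \<and> dist (Q v u x) (Q v u p) < ?e"
    using ev[of u v] ev[of v u] eventually_nhds_in_open[OF N] by eventually_elim auto
  then obtain d where d: "d > 0" "\<And>x. dist x p < d \<Longrightarrow> x \<in> N \<and> dist (Q u v x) (Q u v p) < ?e \<and> dist (Q v u x) (Q v u p) < ?e"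
    unfolding eventually_nhds_metric by blast
  \<comment> \<open>With this \<open>t\<close> the whole parallelogram stays within distance
    \<open>d\<close> of \<open>p\<close>; the \<open>+ 1\<close> keeps the denominator positive when
    both directions vanish.\<close>
  define t where "t = d / (2 * (norm u + norm v + 1))"
  have t: "t > 0" using d by (auto simp: t_def add_nonneg_pos)
  have near: "dist (p + \<alpha> *\<^sub>R u + \<beta> *\<^sub>R v) p < d" if "0 \<le> \<alpha>" "\<alpha> \<le> t" "0 \<le> \<beta>" "\<beta> \<le> t" for \<alpha> \<beta>
  proof -
    have "dist (p + \<alpha> *\<^sub>R u + \<beta> *\<^sub>R v) p \<le> \<alpha> * norm u + \<beta> * norm v"
      using norm_triangle_ineq[of "\<alpha> *\<^sub>R u" "\<beta> *\<^sub>R v"] that by (simp add: dist_norm algebra_simps)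
    also have "\<dots> \<le> t * norm u + t * norm v"
      using that by (intro add_mono mult_right_mono) auto
    also have "\<dots> < 2 * t * (norm u + norm v + 1)"
      using t mult_nonneg_nonneg[of t "norm u"] mult_nonneg_nonneg[of t "norm v"]
      by (simp add: algebra_simps del: mult_nonneg_nonneg zero_le_mult_iff)
    also have "\<dots> = d"
    proof -
      have "norm u + norm v + 1 \<noteq> 0" using norm_ge_zero[of u] norm_ge_zero[of v] by linarith
      moreover have "2 * (d / (2 * w)) * w = d" if "w \<noteq> 0" for w
        using that by simp
      ultimately show ?thesis unfolding t_def by blast
    qed
    finally show ?thesis .
  qed
  have near': "dist (p + \<alpha> *\<^sub>R v + \<beta> *\<^sub>R u) p < d" if "0 \<le> \<alpha>" "\<alpha> \<le> t" "0 \<le> \<beta>" "\<beta> \<le> t" for \<alpha> \<beta>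
    using near[of \<beta> \<alpha>] that by (simp add: algebra_simps)
  obtain \<alpha> \<beta> where 1: "0 \<le> \<alpha>" "\<alpha> \<le> t" "0 \<le> \<beta>" "\<beta> \<le> t"
    "f (p + t *\<^sub>R u + t *\<^sub>R v) - f (p + t *\<^sub>R u) - f (p + t *\<^sub>R v) + f p = t * t * Q u v (p + \<alpha> *\<^sub>R u + \<beta> *\<^sub>R v)"
    unfolding Q_def by (rule second_difference_mean_value[OF f t, of p u v]) (use near d(2) in auto)
  obtain \<alpha>' \<beta>' where 2: "0 \<le> \<alpha>'" "\<alpha>' \<le> t" "0 \<le> \<beta>'" "\<beta>' \<le> t"
    "f (p + t *\<^sub>R v + t *\<^sub>R u) - f (p + t *\<^sub>R v) - f (p + t *\<^sub>R u) + f p = t * t * Q v u (p + \<alpha>' *\<^sub>R v + \<beta>' *\<^sub>R u)"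
    unfolding Q_def by (rule second_difference_mean_value[OF f t, of p v u]) (use near' d(2) in auto)
  have sw: "p + t *\<^sub>R v + t *\<^sub>R u = p + t *\<^sub>R u + t *\<^sub>R v" by (simp add: algebra_simps)
  have "t * t * Q u v (p + \<alpha> *\<^sub>R u + \<beta> *\<^sub>R v) = t * t * Q v u (p + \<alpha>' *\<^sub>R v + \<beta>' *\<^sub>R u)"
    using 1(5) 2(5) unfolding sw by linarith
  then have "Q u v (p + \<alpha> *\<^sub>R u + \<beta> *\<^sub>R v) = Q v u (p + \<alpha>' *\<^sub>R v + \<beta>' *\<^sub>R u)"
    using t by simp
  moreover have "\<bar>Q u v (p + \<alpha> *\<^sub>R u + \<beta> *\<^sub>R v) - Q u v p\<bar> < ?e" "\<bar>Q v u (p + \<alpha>' *\<^sub>R v + \<beta>' *\<^sub>R u) - Q v u p\<bar> < ?e"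
    using d(2)[OF near[OF 1(1-4)]] d(2)[OF near'[OF 2(1-4)]] by (auto simp: dist_real_def)
  moreover have "\<bar>a - b\<bar> \<le> \<bar>x - a\<bar> + \<bar>x - b\<bar>" for a b x :: real
    by linarith
  ultimately show False
    by (smt (verit) field_sum_of_halves)
qed

section \<open>Plots and smooth functions on a manifold\<close>

text \<open>Parametrised smooth maps from Euclidean spaces serve as test objects: a map between manifolds
  is used only through its effect on such plots.\<close>

definition plot :: "('m::topological_space, 'e::euclidean_space) atlas \<Rightarrow> ('v::euclidean_space \<Rightarrow> 'm) \<Rightarrow> 'v \<Rightarrow> bool" where
  "plot A H x \<longleftrightarrow> (\<exists>(W, \<psi>)\<in>A. \<exists>N. open N \<and> x \<in> N \<and> H ` N \<subseteq> W \<and> smooth_on N (\<lambda>y. \<psi> (H y)))"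

definition smooth_at :: "('m::topological_space, 'e::euclidean_space) atlas \<Rightarrow> 'm \<Rightarrow> ('m \<Rightarrow> real) \<Rightarrow> bool" where
  "smooth_at A p F \<longleftrightarrow> (\<exists>(V, \<phi>)\<in>A. \<exists>N. open N \<and> p \<in> N \<and> N \<subseteq> V \<and> smooth_on (\<phi> ` N) (\<lambda>u. F (inv_into V \<phi> u)))"

lemma plotI:
  "(W, \<psi>) \<in> A \<Longrightarrow> open N \<Longrightarrow> x \<in> N \<Longrightarrow> H ` N \<subseteq> W \<Longrightarrow> smooth_on N (\<lambda>y. \<psi> (H y)) \<Longrightarrow> plot A H x"
  unfolding plot_def by blast

lemma plotE:
  assumes "plot A H x"
  obtains W \<psi> N where "(W, \<psi>) \<in> A" "open N" "x \<in> N" "H ` N \<subseteq> W" "smooth_on N (\<lambda>y. \<psi> (H y))"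
  using assms unfolding plot_def by blast

lemma smooth_atE:
  assumes "smooth_at A p F"
  obtains V \<phi> N where "(V, \<phi>) \<in> A" "open N" "p \<in> N" "N \<subseteq> V" "smooth_on (\<phi> ` N) (\<lambda>u. F (inv_into V \<phi> u))"
proof -
  obtain c where "c \<in> A" "case c of (V, \<phi>) \<Rightarrow> \<exists>N. open N \<and> p \<in> N \<and> N \<subseteq> V \<and> smooth_on (\<phi> ` N) (\<lambda>u. F (inv_into V \<phi> u))"
    using assms unfolding smooth_at_def by (rule bexE)
  then show ?thesis by (cases c) (auto intro: that)
qed

lemma smooth_openE:
  assumes "smooth_open A B U F" "p \<in> U"
  obtains V \<phi> W \<psi> N where "(V, \<phi>) \<in> A" "(W, \<psi>) \<in> B" "open N" "p \<in> N" "N \<subseteq> U \<inter> V" "F ` N \<subseteq> W"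
      "smooth_on (\<phi> ` N) (\<lambda>u. \<psi> (F (inv_into V \<phi> u)))"
proof -
  have "\<exists>c\<in>A. \<exists>d\<in>B. \<exists>N. open N \<and> p \<in> N \<and> N \<subseteq> U \<inter> fst c \<and> F ` N \<subseteq> fst d \<and>
      smooth_on (snd c ` N) (\<lambda>u. snd d (F (inv_into (fst c) (snd c) u)))"
    using assms unfolding smooth_open_def comp_def case_prod_beta by auto
  then show ?thesis using that by (metis prod.collapse)
qed

text \<open>For real-valued functions the target chart is the identity, and smoothness becomes the
  pointwise condition \<open>smooth_at\<close>, for which a single chart around the point
  suffices.\<close>

lemma smooth_open_std_iff: "smooth_open A std_atlas U F \<longleftrightarrow> open U \<and> (\<forall>p\<in>U. smooth_at A p F)"
proof
  assume L: "smooth_open A std_atlas U F"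
  have "smooth_at A p F" if p: "p \<in> U" for p
  proof -
    obtain V \<phi> W \<psi> N where "(V, \<phi>) \<in> A" "(W, \<psi>) \<in> std_atlas" "open N" "p \<in> N" "N \<subseteq> U \<inter> V"
      "smooth_on (\<phi> ` N) (\<psi> \<circ> F \<circ> inv_into V \<phi>)"
      using smooth_openE[OF L p] unfolding comp_def by metis
    then show ?thesis
      unfolding smooth_at_def
      by (intro bexI[of _ "(V, \<phi>)"] case_prodI exI[of _ N]) (auto simp: std_atlas_def comp_def)
  qed
  then show "open U \<and> (\<forall>p\<in>U. smooth_at A p F)"
    using L unfolding smooth_open_def by blast
next
  assume *: "open U \<and> (\<forall>p\<in>U. smooth_at A p F)"
  have "\<exists>(V, \<phi>)\<in>A. \<exists>(W, \<psi>)\<in>std_atlas. \<exists>N. open N \<and> p \<in> N \<and> N \<subseteq> U \<inter> V \<and> F ` N \<subseteq> W \<and>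
      smooth_on (\<phi> ` N) (\<psi> \<circ> F \<circ> inv_into V \<phi>)" if "p \<in> U" for p
  proof -
    from * that have "smooth_at A p F" by blast
    then obtain V \<phi> N where N: "(V, \<phi>) \<in> A" "open N" "p \<in> N" "N \<subseteq> V" "smooth_on (\<phi> ` N) (\<lambda>u. F (inv_into V \<phi> u))"
      by (rule smooth_atE)
    have "smooth_on (\<phi> ` (N \<inter> U)) (\<lambda>u. F (inv_into V \<phi> u))"
      by (rule smooth_on_subset[OF N(5)]) auto
    then show ?thesis
      using * that N
      by (intro bexI[of _ "(V, \<phi>)"] bexI[of _ "(UNIV, id)"] case_prodI exI[of _ "N \<inter> U"])
        (auto simp: std_atlas_def comp_def)
  qed
  with * show "smooth_open A std_atlas U F"
    unfolding smooth_open_def by blast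
qed

lemma plot_transform:
  assumes "plot A H x" "open M" "x \<in> M" "\<And>y. y \<in> M \<Longrightarrow> H y = K y"
  shows "plot A K x"
proof -
  obtain W \<psi> N where N: "(W, \<psi>) \<in> A" "open N" "x \<in> N" "H ` N \<subseteq> W" "smooth_on N (\<lambda>y. \<psi> (H y))"
    using assms(1) by (rule plotE)
  have "smooth_on (N \<inter> M) (\<lambda>y. \<psi> (K y))"
    by (rule smooth_on_cong[OF _ smooth_on_subset[OF N(5)]]) (use N assms in auto)
  then show ?thesis
    using N assms by (intro plotI[of W \<psi> A "N \<inter> M"]) (auto simp: image_subset_iff)
qed

lemma plot_compose:
  assumes "plot A H (h x)" "open M" "x \<in> M" "smooth_on M h"
  shows "plot A (\<lambda>y. H (h y)) x"
proof -
  obtain W \<psi> N where N: "(W, \<psi>) \<in> A" "open N" "h x \<in> N" "H ` N \<subseteq> W" "smooth_on N (\<lambda>y. \<psi> (H y))"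
    using assms(1) by (rule plotE)
  let ?M = "h -` N \<inter> M"
  have o: "open ?M"
    using continuous_on_open_vimage[OF \<open>open M\<close>] smooth_on_imp_continuous_on[OF assms(4)] N by blast
  have "smooth_on ?M (\<lambda>y. \<psi> (H (h y)))"
    by (rule smooth_on_compose[OF o N(2) _ N(5) smooth_on_subset[OF assms(4)]]) auto
  then show ?thesis
    using N assms o by (intro plotI[of W \<psi> A ?M]) auto
qed

lemma smooth_open_std_domain_iff:
  "smooth_open std_atlas A U c \<longleftrightarrow> open U \<and> (\<forall>x\<in>U. plot A c x)"
proof
  assume L: "smooth_open std_atlas A U c"
  have "plot A c x" if x: "x \<in> U" for x
  proof -
    obtain V \<phi> W \<psi> N where "(V, \<phi>) \<in> std_atlas" "(W, \<psi>) \<in> A" "open N" "x \<in> N" "c ` N \<subseteq> W"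
      "smooth_on (\<phi> ` N) (\<psi> \<circ> c \<circ> inv_into V \<phi>)"
      using smooth_openE[OF L x] unfolding comp_def by metis
    then show ?thesis
      by (intro plotI[of W \<psi> A N]) (auto simp: std_atlas_def comp_def)
  qed
  then show "open U \<and> (\<forall>x\<in>U. plot A c x)"
    using L unfolding smooth_open_def by blast
next
  assume *: "open U \<and> (\<forall>x\<in>U. plot A c x)"
  have "\<exists>(V, \<phi>)\<in>std_atlas. \<exists>(W, \<psi>)\<in>A. \<exists>N. open N \<and> x \<in> N \<and> N \<subseteq> U \<inter> V \<and> c ` N \<subseteq> W \<and>
      smooth_on (\<phi> ` N) (\<psi> \<circ> c \<circ> inv_into V \<phi>)" if "x \<in> U" for x
  proof -
    from * that have "plot A c x" by blast
    then obtain W \<psi> N where N: "(W, \<psi>) \<in> A" "open N" "x \<in> N" "c ` N \<subseteq> W" "smooth_on N (\<lambda>y. \<psi> (c y))"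
      by (rule plotE)
    then show ?thesis
      using * that smooth_on_subset[OF N(5), of "N \<inter> U"]
      by (intro bexI[of _ "(W, \<psi>)"] bexI[of _ "(UNIV, id)"] case_prodI exI[of _ "N \<inter> U"])
        (auto simp: std_atlas_def comp_def)
  qed
  with * show "smooth_open std_atlas A U c"
    unfolding smooth_open_def by blast
qed

text \<open>On an open Euclidean domain the local extensions in \<open>smooth_map\<close> may be
  taken to be the map itself. The curves in \<open>tangent_space\<close> thereby become
  plots.\<close>

lemma smooth_map_std_domain_iff:
  assumes "open S"
  shows "smooth_map std_atlas A S c \<longleftrightarrow> (\<forall>x\<in>S. plot A c x)"
proof
  assume L: "smooth_map std_atlas A S c"
  show "\<forall>x\<in>S. plot A c x"
  proof
    fix x assume x: "x \<in> S"
    then obtain U F where F: "x \<in> U" "smooth_open std_atlas A U F" "\<forall>q\<in>S \<inter> U. F q = c q"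
      using L unfolding smooth_map_def by blast
    have "open U" "plot A F x"
      using F(1,2) by (simp_all add: smooth_open_std_domain_iff)
    then show "plot A c x"
      by - (rule plot_transform[of A F x "S \<inter> U"], use F \<open>open U\<close> assms x in auto)
  qed
next
  assume "\<forall>x\<in>S. plot A c x"
  then have "smooth_open std_atlas A S c" using assms by (simp add: smooth_open_std_domain_iff)
  then show "smooth_map std_atlas A S c" unfolding smooth_map_def by blast
qed

lemma chart_open_image_aux:
  assumes "open (\<phi> ` V)" "homeomorphism V (\<phi> ` V) \<phi> (inv_into V \<phi>)" "open N" "N \<subseteq> V"
  shows "open (\<phi> ` N)"
proof -
  have "\<phi> ` N = inv_into V \<phi> -` N \<inter> \<phi> ` V"
  proof (rule subset_antisym; rule subsetI)
    fix u assume "u \<in> \<phi> ` N"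
    then show "u \<in> inv_into V \<phi> -` N \<inter> \<phi> ` V"
      using assms(2,4) by (auto simp: homeomorphism_def subset_iff)
  next
    fix u assume "u \<in> inv_into V \<phi> -` N \<inter> \<phi> ` V"
    then show "u \<in> \<phi> ` N" by (metis IntE f_inv_into_f image_eqI vimage_eq)
  qed
  moreover have "continuous_on (\<phi> ` V) (inv_into V \<phi>)"
    using assms(2) by (simp add: homeomorphism_def)
  then have "open (inv_into V \<phi> -` N \<inter> \<phi> ` V)"
    using continuous_on_open_vimage[OF assms(1)] assms(3) by blast
  ultimately show ?thesis by simp
qed

section \<open>Charts of a manifold and their effect on plots\<close>

locale manifold =
  fixes A :: "('m::{second_countable_topology,t2_space}, 'e::euclidean_space) atlas"
  assumes smooth_manifold: "smooth_manifold A"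
begin

lemma chart_at: obtains V \<phi> where "(V, \<phi>) \<in> A" "p \<in> V"
proof -
  have "p \<in> (\<Union>(U, \<phi>)\<in>A. U)"
    using smooth_manifold unfolding smooth_manifold_def by auto
  then show ?thesis using that by auto
qed

context
  fixes V \<phi> assumes chart: "(V, \<phi>) \<in> A"
begin

lemma chart_homeo: "open V" "open (\<phi> ` V)" "homeomorphism V (\<phi> ` V) \<phi> (inv_into V \<phi>)"
  using chart smooth_manifold unfolding smooth_manifold_def by auto

lemma chart_inv [simp]: "p \<in> V \<Longrightarrow> inv_into V \<phi> (\<phi> p) = p"
  using chart_homeo(3) by (auto simp: homeomorphism_def)

lemma chart_open_image: "open N \<Longrightarrow> N \<subseteq> V \<Longrightarrow> open (\<phi> ` N)"
  by (rule chart_open_image_aux[OF chart_homeo(2,3)])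

lemma plot_inv_chart: "u \<in> \<phi> ` V \<Longrightarrow> plot A (inv_into V \<phi>) u"
  by (rule plotI[OF chart chart_homeo(2)])
    (auto intro: smooth_on_cong[OF chart_homeo(2) smooth_on_ident[OF chart_homeo(2)]])

end

text \<open>Continuity of plots. A chart is open and injective on its domain, so whether
  \<open>H y\<close> lies in an open set can be read off from the smooth function
  \<open>\<psi> (H y)\<close>.\<close>

lemma plot_vimage:
  assumes "plot A H x" "open \<Omega>" "H x \<in> \<Omega>"
  shows "\<exists>N. open N \<and> x \<in> N \<and> H ` N \<subseteq> \<Omega>"
proof -
  obtain W \<psi> N where N: "(W, \<psi>) \<in> A" "open N" "x \<in> N" "H ` N \<subseteq> W" "smooth_on N (\<lambda>y. \<psi> (H y))"
    using assms(1) by (rule plotE)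
  let ?N = "(\<lambda>y. \<psi> (H y)) -` (\<psi> ` (\<Omega> \<inter> W)) \<inter> N"
  have "open (\<psi> ` (\<Omega> \<inter> W))"
    using chart_homeo[OF N(1)] assms by (intro chart_open_image[OF N(1)]) auto
  then have "open ?N"
    using continuous_on_open_vimage[OF N(2)] smooth_on_imp_continuous_on[OF N(5)] by blast
  moreover have "x \<in> ?N" using N assms by auto
  moreover have "H ` ?N \<subseteq> \<Omega>"
  proof clarsimp
    fix y q assume "\<psi> (H y) = \<psi> q" "y \<in> N" "q \<in> \<Omega>" "q \<in> W"
    then show "H y \<in> \<Omega>"
      using chart_inv[OF N(1)] N(4) by (metis image_subset_iff)
  qed
  ultimately show ?thesis by blast
qed

text \<open>The definition of a plot provides one unspecified chart; composition with the smooth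
  transition map allows the plot to be read in any prescribed chart around
  \<open>H x\<close>.\<close>

lemma plot_chart:
  assumes "plot A H x" "(W, \<psi>) \<in> A" "open \<Omega>" "H x \<in> W \<inter> \<Omega>"
  shows "\<exists>N. open N \<and> x \<in> N \<and> H ` N \<subseteq> W \<inter> \<Omega> \<and> smooth_on N (\<lambda>y. \<psi> (H y))"
proof -
  obtain W0 \<psi>0 N0 where N0: "(W0, \<psi>0) \<in> A" "open N0" "x \<in> N0" "H ` N0 \<subseteq> W0" "smooth_on N0 (\<lambda>y. \<psi>0 (H y))"
    using assms(1) by (rule plotE)
  obtain N1 where N1: "open N1" "x \<in> N1" "H ` N1 \<subseteq> W \<inter> \<Omega>"
    using plot_vimage[OF assms(1), of "W \<inter> \<Omega>"] assms chart_homeo(1)[OF assms(2)] by auto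
  have tr: "smooth_on (\<psi>0 ` (W0 \<inter> W)) (\<lambda>u. \<psi> (inv_into W0 \<psi>0 u))"
    using smooth_manifold N0(1) assms(2) unfolding smooth_manifold_def comp_def by blast
  have op: "open (\<psi>0 ` (W0 \<inter> W))"
    using chart_homeo(1)[OF N0(1)] chart_homeo(1)[OF assms(2)] by (intro chart_open_image[OF N0(1)]) auto
  let ?N = "N0 \<inter> N1"
  have o: "open ?N" using N0 N1 by auto
  have "smooth_on ?N (\<lambda>y. \<psi> (inv_into W0 \<psi>0 (\<psi>0 (H y))))"
    by (rule smooth_on_compose[OF o op _ tr smooth_on_subset[OF N0(5)]]) (use N0 N1 in auto)
  then have "smooth_on ?N (\<lambda>y. \<psi> (H y))"
    by (rule smooth_on_cong[OF o]) (use N0 chart_inv[OF N0(1)] in \<open>auto simp: image_subset_iff\<close>)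
  then show ?thesis using N0 N1 o by (intro exI[of _ ?N]) auto
qed

lemma plot_image:
  assumes F: "smooth_open A B U F" and H: "plot A H x" "H x \<in> U"
  shows "plot B (\<lambda>y. F (H y)) x"
proof -
  obtain V \<phi> W \<psi> N where *: "(V, \<phi>) \<in> A" "(W, \<psi>) \<in> B" "open N" "H x \<in> N" "N \<subseteq> U \<inter> V" "F ` N \<subseteq> W"
    "smooth_on (\<phi> ` N) (\<lambda>u. \<psi> (F (inv_into V \<phi> u)))"
    using F H(2) by (rule smooth_openE)
  obtain M where M: "open M" "x \<in> M" "H ` M \<subseteq> V \<inter> N" "smooth_on M (\<lambda>y. \<phi> (H y))"
    using plot_chart[OF H(1) *(1) *(3)] * by blast
  have op: "open (\<phi> ` N)" using * by (intro chart_open_image[OF *(1)]) auto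
  have "smooth_on M (\<lambda>y. \<psi> (F (inv_into V \<phi> (\<phi> (H y)))))"
    by (rule smooth_on_compose[OF M(1) op _ *(7) M(4)]) (use M in auto)
  then have "smooth_on M (\<lambda>y. \<psi> (F (H y)))"
    by (rule smooth_on_cong[OF M(1)]) (use M chart_inv[OF *(1)] in \<open>auto simp: image_subset_iff\<close>)
  then show ?thesis
    using * M by (intro plotI[of W \<psi> B M]) (auto simp: image_subset_iff)
qed

lemma smooth_at_plot:
  assumes F: "smooth_at A (H x) F" and H: "plot A H x"
  shows "\<exists>N. open N \<and> x \<in> N \<and> smooth_on N (\<lambda>y. F (H y))"
proof -
  obtain V \<phi> N where *: "(V, \<phi>) \<in> A" "open N" "H x \<in> N" "N \<subseteq> V" "smooth_on (\<phi> ` N) (\<lambda>u. F (inv_into V \<phi> u))"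
    using F by (rule smooth_atE)
  obtain M where M: "open M" "x \<in> M" "H ` M \<subseteq> V \<inter> N" "smooth_on M (\<lambda>y. \<phi> (H y))"
    using plot_chart[OF H *(1) *(2)] * by blast
  have op: "open (\<phi> ` N)" using * by (intro chart_open_image[OF *(1)]) auto
  have "smooth_on M (\<lambda>y. F (inv_into V \<phi> (\<phi> (H y))))"
    by (rule smooth_on_compose[OF M(1) op _ *(5) M(4)]) (use M in auto)
  then have "smooth_on M (\<lambda>y. F (H y))"
    by (rule smooth_on_cong[OF M(1)]) (use M chart_inv[OF *(1)] in \<open>auto simp: image_subset_iff\<close>)
  then show ?thesis using M by blast
qed

lemma smooth_at_chart:
  assumes "smooth_at A p F" "(V, \<phi>) \<in> A" "p \<in> V"
  shows "\<exists>N. open N \<and> \<phi> p \<in> N \<and> N \<subseteq> \<phi> ` V \<and> smooth_on N (\<lambda>u. F (inv_into V \<phi> u))"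
proof -
  obtain N where "open N" "\<phi> p \<in> N" "smooth_on N (\<lambda>u. F (inv_into V \<phi> u))"
    using smooth_at_plot[of "inv_into V \<phi>" "\<phi> p" F] plot_inv_chart[OF assms(2), of "\<phi> p"] assms(1,3)
      chart_inv[OF assms(2,3)] by auto
  then show ?thesis
    using chart_homeo(2)[OF assms(2)] assms(3)
    by (intro exI[of _ "N \<inter> \<phi> ` V"]) (auto intro: smooth_on_subset)
qed

lemma smooth_atI:
  assumes "(V, \<phi>) \<in> A" "p \<in> V" "open N" "\<phi> p \<in> N" "smooth_on N (\<lambda>u. F (inv_into V \<phi> u))"
  shows "smooth_at A p F"
proof -
  let ?N = "\<phi> -` N \<inter> V"
  have "continuous_on V \<phi>" using chart_homeo(3)[OF assms(1)] by (simp add: homeomorphism_def)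
  then have "open ?N"
    using continuous_on_open_vimage[OF chart_homeo(1)[OF assms(1)]] assms(3) by blast
  moreover have "smooth_on (\<phi> ` ?N) (\<lambda>u. F (inv_into V \<phi> u))"
    by (rule smooth_on_subset[OF assms(5)]) auto
  ultimately show ?thesis
    unfolding smooth_at_def using assms by (intro bexI[OF _ assms(1)] case_prodI exI[of _ ?N]) auto
qed

lemma smooth_at_nbhd: "smooth_at A p F \<Longrightarrow> \<exists>U. open U \<and> p \<in> U \<and> (\<forall>q\<in>U. smooth_at A q F)"
  unfolding smooth_at_def by (elim bexE) (auto simp: case_prod_beta)

text \<open>The first hypothesis expresses smoothness of \<open>h\<close> at \<open>p\<close> by
  testing it on inverse charts, the only plots for which it has to be known.\<close>

lemma smooth_at_comp:
  assumes "\<And>V \<phi>. (V, \<phi>) \<in> A \<Longrightarrow> p \<in> V \<Longrightarrow> plot A (\<lambda>u. h (inv_into V \<phi> u)) (\<phi> p)" "smooth_at A (h p) F"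
  shows "smooth_at A p (\<lambda>q. F (h q))"
proof -
  obtain V \<phi> where V: "(V, \<phi>) \<in> A" "p \<in> V" by (rule chart_at)
  obtain N where "open N" "\<phi> p \<in> N" "smooth_on N (\<lambda>u. F (h (inv_into V \<phi> u)))"
    using smooth_at_plot[OF _ assms(1)[OF V], of F] assms(2) chart_inv[OF V] by auto
  then show ?thesis by (rule smooth_atI[OF V])
qed

lemma smooth_at_const: "smooth_at A p (\<lambda>q. c)"
proof -
  obtain V \<phi> where V: "(V, \<phi>) \<in> A" "p \<in> V" by (rule chart_at)
  show ?thesis by (rule smooth_atI[OF V open_UNIV _ smooth_on_const]) auto
qed

lemma smooth_at_binop:
  assumes m: "\<And>N (f::'e \<Rightarrow> real) g. open N \<Longrightarrow> smooth_on N f \<Longrightarrow> smooth_on N g \<Longrightarrow> smooth_on N (\<lambda>x. m (f x) (g x))"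
    and "smooth_at A p F" "smooth_at A p G"
  shows "smooth_at A p (\<lambda>q. m (F q) (G q))"
proof -
  obtain V \<phi> where V: "(V, \<phi>) \<in> A" "p \<in> V" by (rule chart_at)
  obtain N M where "open N" "\<phi> p \<in> N" "smooth_on N (\<lambda>u. F (inv_into V \<phi> u))"
     "open M" "\<phi> p \<in> M" "smooth_on M (\<lambda>u. G (inv_into V \<phi> u))"
    using smooth_at_chart[OF assms(2) V] smooth_at_chart[OF assms(3) V] by blast
  then show ?thesis
    by (intro smooth_atI[OF V, of "N \<inter> M"] m) (auto intro: smooth_on_subset)
qed

lemma smooth_at_add: "smooth_at A p F \<Longrightarrow> smooth_at A p G \<Longrightarrow> smooth_at A p (\<lambda>q. F q + G q)"
  by (rule smooth_at_binop[of "(+)"]) (auto intro: smooth_on_add)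

lemma smooth_at_mult: "smooth_at A p F \<Longrightarrow> smooth_at A p G \<Longrightarrow> smooth_at A p (\<lambda>q. F q * G q)"
  by (rule smooth_at_binop[of "(*)"]) (auto intro: smooth_on_mult)

lemma smooth_at_unop:
  assumes m: "\<And>N (f::'e \<Rightarrow> real). open N \<Longrightarrow> (\<And>x. x \<in> N \<Longrightarrow> f x \<noteq> 0) \<Longrightarrow> smooth_on N f \<Longrightarrow> smooth_on N (\<lambda>x. m (f x))"
    and F: "smooth_at A p F" "F p \<noteq> 0"
  shows "smooth_at A p (\<lambda>q. m (F q))"
proof -
  obtain V \<phi> where V: "(V, \<phi>) \<in> A" "p \<in> V" by (rule chart_at)
  obtain N where N: "open N" "\<phi> p \<in> N" "smooth_on N (\<lambda>u. F (inv_into V \<phi> u))"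
    using smooth_at_chart[OF F(1) V] by blast
  let ?M = "(\<lambda>u. F (inv_into V \<phi> u)) -` (-{0}) \<inter> N"
  have "open ?M"
    using continuous_on_open_vimage[OF N(1)] smooth_on_imp_continuous_on[OF N(3)] by blast
  moreover have "smooth_on ?M (\<lambda>u. m (F (inv_into V \<phi> u)))"
    using calculation by (intro m smooth_on_subset[OF N(3)]) auto
  ultimately show ?thesis
    using F N chart_inv[OF V] by (intro smooth_atI[OF V, of ?M]) auto
qed

lemma smooth_at_inverse: "smooth_at A p F \<Longrightarrow> F p \<noteq> 0 \<Longrightarrow> smooth_at A p (\<lambda>q. inverse (F q))"
  by (rule smooth_at_unop[of inverse]) (auto intro: smooth_on_inverse)

lemma smooth_at_ln_abs: "smooth_at A p F \<Longrightarrow> F p \<noteq> 0 \<Longrightarrow> smooth_at A p (\<lambda>q. ln \<bar>F q\<bar>)"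
  by (rule smooth_at_unop[of "\<lambda>x. ln \<bar>x\<bar>"]) (auto intro: smooth_on_ln_abs)

text \<open>In a chart, \<open>F (\<Phi> q s)\<close> is smooth in both variables jointly, and its
  derivative in \<open>s\<close> at \<open>0\<close> is the directional derivative along
  \<open>(0, 1)\<close> restricted to \<open>s = 0\<close>. This is the source of the fact that
  invariant fields map smooth functions to smooth functions.\<close>

lemma smooth_at_partial_derivative:
  fixes \<Phi> :: "'m \<Rightarrow> real \<Rightarrow> 'm"
  assumes \<Phi>: "\<And>V \<phi>. (V, \<phi>) \<in> A \<Longrightarrow> p \<in> V \<Longrightarrow> plot A (\<lambda>(u, s). \<Phi> (inv_into V \<phi> u) s) (\<phi> p, 0)"
    and F: "smooth_at A (\<Phi> p 0) F"
  shows "smooth_at A p (\<lambda>q. deriv (\<lambda>s. F (\<Phi> q s)) 0)"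
proof -
  obtain V \<phi> where V: "(V, \<phi>) \<in> A" "p \<in> V" by (rule chart_at)
  obtain N where N: "open N" "(\<phi> p, 0) \<in> N" "smooth_on N (\<lambda>(u, s). F (\<Phi> (inv_into V \<phi> u) s))"
    using smooth_at_plot[OF _ \<Phi>[OF V], of F] F chart_inv[OF V] by (auto simp: case_prod_unfold)
  let ?G = "\<lambda>(u, s). F (\<Phi> (inv_into V \<phi> u) s)"
  let ?M = "(\<lambda>u. (u, 0::real)) -` N"
  have M: "open ?M"
    using N(1) by (intro open_vimage continuous_intros)
  have "smooth_on ?M (\<lambda>u. frechet_derivative ?G (at (u, 0)) (0, 1))"
    by (rule smooth_on_compose[where f = "\<lambda>u. (u, 0::real)", OF M N(1) _ smooth_on_frechet_derivative[OF N(3)]])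
      (auto intro!: smooth_on_Pair smooth_on_ident smooth_on_const M)
  moreover have "frechet_derivative ?G (at (u, 0)) (0, 1) = deriv (\<lambda>s. F (\<Phi> (inv_into V \<phi> u) s)) 0" if "u \<in> ?M" for u
  proof -
    have 1: "((\<lambda>s. (u, s::real)) has_derivative (\<lambda>h. (0, h))) (at 0)"
      by (auto intro!: derivative_eq_intros)
    have 2: "(?G has_derivative frechet_derivative ?G (at (u, 0))) (at (u, 0))"
      using smooth_on_has_derivative[OF N(3)] that by auto
    from has_derivative_compose[OF 1 2]
    have "((\<lambda>s. F (\<Phi> (inv_into V \<phi> u) s)) has_derivative (\<lambda>h. frechet_derivative ?G (at (u, 0)) (0, h))) (at 0)"
      by simp
    moreover have "(\<lambda>h. frechet_derivative ?G (at (u, 0)) (0, h)) = (*) (frechet_derivative ?G (at (u, 0)) (0, 1))"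
    proof
      fix h :: real
      have "frechet_derivative ?G (at (u, 0)) (h *\<^sub>R (0, 1)) = h *\<^sub>R frechet_derivative ?G (at (u, 0)) (0, 1)"
        by (rule linear_scale[OF has_derivative_linear[OF 2]])
      moreover have "h *\<^sub>R (0, 1) = (0::'e, h)" by simp
      ultimately show "frechet_derivative ?G (at (u, 0)) (0, h) = frechet_derivative ?G (at (u, 0)) (0, 1) * h"
        by (simp only: real_scaleR_def mult.commute)
    qed
    ultimately have "((\<lambda>s. F (\<Phi> (inv_into V \<phi> u) s)) has_real_derivative frechet_derivative ?G (at (u, 0)) (0, 1)) (at 0)"
      by (simp only: has_field_derivative_def)
    then show ?thesis by (simp add: DERIV_imp_deriv)
  qed
  ultimately have "smooth_on ?M (\<lambda>u. deriv (\<lambda>s. F (\<Phi> (inv_into V \<phi> u) s)) 0)"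
    by (rule smooth_on_cong[OF M])
  then show ?thesis
    using N by (intro smooth_atI[OF V M]) auto
qed

end

section \<open>Products, submanifolds and curves\<close>

lemma plot_snd:
  assumes "plot (prod_atlas A B) K x"
  shows "plot B (\<lambda>y. snd (K y)) x"
proof -
  obtain W \<psi> N where N: "(W, \<psi>) \<in> prod_atlas A B" "open N" "x \<in> N" "K ` N \<subseteq> W" "smooth_on N (\<lambda>y. \<psi> (K y))"
    using assms by (rule plotE)
  obtain U \<phi> V \<theta> where *: "(U, \<phi>) \<in> A" "(V, \<theta>) \<in> B" "W = U \<times> V" "\<psi> = map_prod \<phi> \<theta>"
    using N(1) by (auto simp: prod_atlas_def)
  have "smooth_on N (\<lambda>y. snd (\<psi> (K y)))"
    by (rule smooth_on_linear_comp[OF bounded_linear_snd N(2,5)])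
  then have "smooth_on N (\<lambda>y. \<theta> (snd (K y)))"
    by (simp add: *(4))
  then show ?thesis
    using N(2-4) * by (intro plotI[of V \<theta> B N]) (auto simp: image_subset_iff mem_Times_iff)
qed

context manifold begin

lemma plot_const: "plot A (\<lambda>y. p) x"
proof -
  obtain V \<phi> where V: "(V, \<phi>) \<in> A" "p \<in> V" by (rule chart_at)
  show ?thesis by (rule plotI[OF V(1) open_UNIV _ _ smooth_on_const]) (use V in auto)
qed

lemma plot_smooth_map:
  assumes "smooth_map A B UNIV F" "plot A H x"
  shows "plot B (\<lambda>y. F (H y)) x"
proof -
  obtain U F' where F: "H x \<in> U" "smooth_open A B U F'" "\<forall>q\<in>U. F' q = F q"
    using assms(1) unfolding smooth_map_def by (metis IntI UNIV_I Int_UNIV_left)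
  have "open U" using F(2) unfolding smooth_open_def by blast
  then obtain N where N: "open N" "x \<in> N" "H ` N \<subseteq> U" using plot_vimage[OF assms(2)] F by blast
  show ?thesis
    by (rule plot_transform[OF plot_image[OF F(2) assms(2) F(1)] N(1,2)]) (use F N in auto)
qed

text \<open>The pair \<open>(H, K)\<close> is treated directly in a box of two charts, so the
  product atlas never has to be recognised as a manifold in its own right.\<close>

lemma plot_smooth_map_prod:
  assumes F: "smooth_map (prod_atlas A A) B UNIV F" and H: "plot A H x" and K: "plot A K x"
  shows "plot B (\<lambda>y. F (H y, K y)) x"
proof -
  obtain U F' where F': "(H x, K x) \<in> U" "smooth_open (prod_atlas A A) B U F'" "\<forall>q\<in>U. F' q = F q"
    using F unfolding smooth_map_def by (metis IntI UNIV_I Int_UNIV_left)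
  obtain C \<theta> W \<psi> N where N: "(C, \<theta>) \<in> prod_atlas A A" "(W, \<psi>) \<in> B" "open N" "(H x, K x) \<in> N" "N \<subseteq> U \<inter> C"
    "F' ` N \<subseteq> W" "smooth_on (\<theta> ` N) (\<lambda>u. \<psi> (F' (inv_into C \<theta> u)))"
    using F'(2,1) by (rule smooth_openE)
  obtain V \<phi> V' \<phi>' where C: "(V, \<phi>) \<in> A" "(V', \<phi>') \<in> A" "C = V \<times> V'" "\<theta> = map_prod \<phi> \<phi>'"
    using N(1) by (auto simp: prod_atlas_def)
  obtain N1 N2 where N12: "open N1" "open N2" "(H x, K x) \<in> N1 \<times> N2" "N1 \<times> N2 \<subseteq> N"
    using open_prod_elim[OF N(3,4)] by metis
  have sub: "N1 \<subseteq> V" "N2 \<subseteq> V'" using N12(3,4) N(5) C(3) by auto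
  obtain M1 where M1: "open M1" "x \<in> M1" "H ` M1 \<subseteq> V \<inter> N1" "smooth_on M1 (\<lambda>y. \<phi> (H y))"
    using plot_chart[OF H C(1) N12(1)] N12(3) sub by blast
  obtain M2 where M2: "open M2" "x \<in> M2" "K ` M2 \<subseteq> V' \<inter> N2" "smooth_on M2 (\<lambda>y. \<phi>' (K y))"
    using plot_chart[OF K C(2) N12(2)] N12(3) sub by blast
  have "inj_on \<phi> V" "inj_on \<phi>' V'"
    by (metis inj_onI chart_inv[OF C(1)], metis inj_onI chart_inv[OF C(2)])
  then have "inj_on \<theta> C"
    unfolding C(3,4) by (rule map_prod_inj_on)
  then have inv: "inv_into C \<theta> (\<phi> p, \<phi>' q) = (p, q)" if "p \<in> V" "q \<in> V'" for p q
    using inv_into_f_f[of \<theta> C "(p, q)"] that by (simp add: C(3,4))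
  have o: "open (M1 \<inter> M2)" "open (\<phi> ` N1 \<times> \<phi>' ` N2)"
    using M1(1) M2(1) chart_open_image[OF C(1) N12(1) sub(1)] chart_open_image[OF C(2) N12(2) sub(2)]
    by (auto intro: open_Times)
  have in_N: "(H y, K y) \<in> N1 \<times> N2" "H y \<in> V" "K y \<in> V'" if "y \<in> M1 \<inter> M2" for y
    using that M1(3) M2(3) by auto
  have eq: "F' (H y, K y) = F (H y, K y)" if "y \<in> M1 \<inter> M2" for y
    using F'(3) N(5) N12(4) in_N(1)[OF that] by blast
  have "smooth_on (M1 \<inter> M2) (\<lambda>y. \<psi> (F' (inv_into C \<theta> (\<phi> (H y), \<phi>' (K y)))))"
  proof (rule smooth_on_compose[OF o, where g = "\<lambda>u. \<psi> (F' (inv_into C \<theta> u))"])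
    show "smooth_on (\<phi> ` N1 \<times> \<phi>' ` N2) (\<lambda>u. \<psi> (F' (inv_into C \<theta> u)))"
      by (rule smooth_on_subset[OF N(7)]) (use N12(4) in \<open>force simp: C(4)\<close>)
    show "smooth_on (M1 \<inter> M2) (\<lambda>y. (\<phi> (H y), \<phi>' (K y)))"
      by (intro smooth_on_Pair o smooth_on_subset[OF M1(4)] smooth_on_subset[OF M2(4)]) auto
  qed (use in_N in auto)
  moreover have "\<psi> (F' (inv_into C \<theta> (\<phi> (H y), \<phi>' (K y)))) = \<psi> (F (H y, K y))" if "y \<in> M1 \<inter> M2" for y
    by (simp only: inv[OF in_N(2,3)[OF that]] eq[OF that])
  ultimately have "smooth_on (M1 \<inter> M2) (\<lambda>y. \<psi> (F (H y, K y)))"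
    by (rule smooth_on_cong[OF o(1)])
  moreover have "F (H y, K y) \<in> W" if "y \<in> M1 \<inter> M2" for y
    using N(6) N12(4) in_N(1)[OF that] eq[OF that] by (metis image_subset_iff subsetD)
  ultimately show ?thesis
    using M1(2) M2(2) by (intro plotI[OF N(2) o(1)]) auto
qed

lemma vimage_nbhd:
  assumes "\<And>V \<phi>. (V, \<phi>) \<in> A \<Longrightarrow> p \<in> V \<Longrightarrow> plot A (\<lambda>u. h (inv_into V \<phi> u)) (\<phi> p)" "open \<Omega>" "h p \<in> \<Omega>"
  shows "\<exists>U. open U \<and> p \<in> U \<and> (\<forall>q\<in>U. h q \<in> \<Omega>)"
proof -
  obtain V \<phi> where V: "(V, \<phi>) \<in> A" "p \<in> V" by (rule chart_at)
  obtain N where N: "open N" "\<phi> p \<in> N" "(\<lambda>u. h (inv_into V \<phi> u)) ` N \<subseteq> \<Omega>"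
    using plot_vimage[OF assms(1)[OF V] assms(2)] assms(3) chart_inv[OF V] by auto
  let ?U = "\<phi> -` N \<inter> V"
  have "continuous_on V \<phi>" using chart_homeo(3)[OF V(1)] by (simp add: homeomorphism_def)
  then have "open ?U"
    using continuous_on_open_vimage[OF chart_homeo(1)[OF V(1)]] N(1) by blast
  moreover have "h q \<in> \<Omega>" if "q \<in> ?U" for q
    using N(3) that chart_inv[OF V(1), of q] by (auto simp: image_subset_iff)
  ultimately show ?thesis using N V by blast
qed

text \<open>\<open>smooth_near\<close> asks for a local extension at every nearby point of
  \<open>S\<close>, but one extension at \<open>p\<close> is enough: it serves at all points of its
  open domain.\<close>

lemma smooth_near_iff:
  assumes "p \<in> S"
  shows "smooth_near A S p f \<longleftrightarrow> (\<exists>U F. open U \<and> p \<in> U \<and> (\<forall>q\<in>U. smooth_at A q F) \<and> (\<forall>q\<in>S \<inter> U. F q = f q))"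
proof
  assume "smooth_near A S p f"
  then obtain U0 where U0: "open U0" "p \<in> U0" "smooth_map A std_atlas (S \<inter> U0) f"
    unfolding smooth_near_def by blast
  then obtain U F where F: "p \<in> U" "smooth_open A std_atlas U F" "\<forall>q\<in>S \<inter> U0 \<inter> U. F q = f q"
    using assms unfolding smooth_map_def by blast
  then show "\<exists>U F. open U \<and> p \<in> U \<and> (\<forall>q\<in>U. smooth_at A q F) \<and> (\<forall>q\<in>S \<inter> U. F q = f q)"
    using U0 by (intro exI[of _ "U \<inter> U0"] exI[of _ F]) (auto simp: smooth_open_std_iff)
next
  assume "\<exists>U F. open U \<and> p \<in> U \<and> (\<forall>q\<in>U. smooth_at A q F) \<and> (\<forall>q\<in>S \<inter> U. F q = f q)"
  then obtain U F where F: "open U" "p \<in> U" "\<forall>q\<in>U. smooth_at A q F" "\<forall>q\<in>S \<inter> U. F q = f q" by blast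
  then have "smooth_open A std_atlas U F" by (simp add: smooth_open_std_iff)
  then have "smooth_map A std_atlas (S \<inter> U) f"
    unfolding smooth_map_def using F(4) by blast
  then show "smooth_near A S p f" unfolding smooth_near_def using F by blast
qed

lemma smooth_nearE:
  assumes "smooth_near A S p f" "p \<in> S"
  obtains U F where "open U" "p \<in> U" "\<forall>q\<in>U. smooth_at A q F" "\<forall>q\<in>S \<inter> U. F q = f q"
  using assms unfolding smooth_near_iff[OF assms(2)] by blast

lemma smooth_nearI:
  assumes "p \<in> S" "smooth_at A p F" "open U" "p \<in> U" "\<And>q. q \<in> S \<Longrightarrow> q \<in> U \<Longrightarrow> F q = f q"
  shows "smooth_near A S p f"
proof -
  obtain U' where "open U'" "p \<in> U'" "\<forall>q\<in>U'. smooth_at A q F" using smooth_at_nbhd[OF assms(2)] by blast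
  then show ?thesis
    unfolding smooth_near_iff[OF assms(1)] using assms
    by (intro exI[of _ "U \<inter> U'"] exI[of _ F]) auto
qed

lemma smooth_near_transform:
  assumes "smooth_near A S p f" "p \<in> S" "open U" "p \<in> U" "\<And>q. q \<in> S \<Longrightarrow> q \<in> U \<Longrightarrow> f q = g q"
  shows "smooth_near A S p g"
proof -
  obtain U' F where F: "open U'" "p \<in> U'" "\<forall>q\<in>U'. smooth_at A q F" "\<forall>q\<in>S \<inter> U'. F q = f q"
    using assms(1,2) by (rule smooth_nearE)
  show ?thesis
    by (rule smooth_nearI[of p S F "U \<inter> U'"]) (use F assms in auto)
qed

lemma smooth_near_const: "p \<in> S \<Longrightarrow> smooth_near A S p (\<lambda>q. c)"
  by (rule smooth_nearI[OF _ smooth_at_const open_UNIV]) auto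

lemma smooth_near_binop:
  assumes "\<And>F G. smooth_at A p F \<Longrightarrow> smooth_at A p G \<Longrightarrow> smooth_at A p (\<lambda>q. m (F q) (G q))"
    and "p \<in> S" "smooth_near A S p f" "smooth_near A S p g"
  shows "smooth_near A S p (\<lambda>q. m (f q) (g q))"
proof -
  obtain U F where F: "open U" "p \<in> U" "\<forall>q\<in>U. smooth_at A q F" "\<forall>q\<in>S \<inter> U. F q = f q"
    using assms(3,2) by (rule smooth_nearE)
  obtain V G where G: "open V" "p \<in> V" "\<forall>q\<in>V. smooth_at A q G" "\<forall>q\<in>S \<inter> V. G q = g q"
    using assms(4,2) by (rule smooth_nearE)
  show ?thesis
    by (rule smooth_nearI[OF assms(2) assms(1)[OF F(3)[rule_format, OF F(2)] G(3)[rule_format, OF G(2)]] open_Int[OF F(1) G(1)]])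
      (use F G in auto)
qed

lemma smooth_near_add:
  "p \<in> S \<Longrightarrow> smooth_near A S p f \<Longrightarrow> smooth_near A S p g \<Longrightarrow> smooth_near A S p (\<lambda>q. f q + g q)"
  by (rule smooth_near_binop[of _ "(+)"]) (auto intro: smooth_at_add)

lemma smooth_near_mult:
  "p \<in> S \<Longrightarrow> smooth_near A S p f \<Longrightarrow> smooth_near A S p g \<Longrightarrow> smooth_near A S p (\<lambda>q. f q * g q)"
  by (rule smooth_near_binop[of _ "(*)"]) (auto intro: smooth_at_mult)

lemma smooth_near_sum:
  "p \<in> S \<Longrightarrow> (\<And>i. i \<in> I \<Longrightarrow> smooth_near A S p (F i)) \<Longrightarrow> smooth_near A S p (\<lambda>q. \<Sum>i\<in>I. F i q)"
  by (induction I rule: infinite_finite_induct) (auto intro: smooth_near_const smooth_near_add)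

lemma smooth_near_prod:
  "p \<in> S \<Longrightarrow> (\<And>i. i \<in> I \<Longrightarrow> smooth_near A S p (F i)) \<Longrightarrow> smooth_near A S p (\<lambda>q. \<Prod>i\<in>I. F i q)"
  by (induction I rule: infinite_finite_induct) (auto intro: smooth_near_const smooth_near_mult)

lemma smooth_near_unop:
  assumes "\<And>F. smooth_at A p F \<Longrightarrow> F p \<noteq> 0 \<Longrightarrow> smooth_at A p (\<lambda>q. m (F q))"
    and "p \<in> S" "smooth_near A S p f" "f p \<noteq> 0"
  shows "smooth_near A S p (\<lambda>q. m (f q))"
proof -
  obtain U F where F: "open U" "p \<in> U" "\<forall>q\<in>U. smooth_at A q F" "\<forall>q\<in>S \<inter> U. F q = f q"
    using assms(3,2) by (rule smooth_nearE)
  have "F p \<noteq> 0" using F(2,4) assms by simp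
  show ?thesis
    by (rule smooth_nearI[OF assms(2) assms(1)[OF F(3)[rule_format, OF F(2)] \<open>F p \<noteq> 0\<close>] F(1,2)]) (simp add: F(4))
qed

lemma smooth_near_inverse:
  "p \<in> S \<Longrightarrow> smooth_near A S p f \<Longrightarrow> f p \<noteq> 0 \<Longrightarrow> smooth_near A S p (\<lambda>q. inverse (f q))"
  by (rule smooth_near_unop[of _ inverse]) (auto intro: smooth_at_inverse)

lemma smooth_near_ln_abs:
  "p \<in> S \<Longrightarrow> smooth_near A S p f \<Longrightarrow> f p \<noteq> 0 \<Longrightarrow> smooth_near A S p (\<lambda>q. ln \<bar>f q\<bar>)"
  by (rule smooth_near_unop[of _ "\<lambda>x. ln \<bar>x\<bar>"]) (auto intro: smooth_at_ln_abs)

lemma smooth_near_det: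
  fixes M :: "'m \<Rightarrow> real^'n^'n"
  assumes "p \<in> S" "\<And>i j. smooth_near A S p (\<lambda>q. M q $ i $ j)"
  shows "smooth_near A S p (\<lambda>q. det (M q))"
  unfolding det_def
  by (intro smooth_near_sum smooth_near_mult smooth_near_const smooth_near_prod assms)

lemma smooth_map_std_iff:
  "smooth_map A std_atlas S f \<longleftrightarrow> (\<forall>p\<in>S. smooth_near A S p f)"
proof
  assume "smooth_map A std_atlas S f"
  then show "\<forall>p\<in>S. smooth_near A S p f"
    unfolding smooth_near_def by (intro ballI exI[of _ UNIV]) auto
next
  assume L: "\<forall>p\<in>S. smooth_near A S p f"
  have "\<exists>U F. p \<in> U \<and> smooth_open A std_atlas U F \<and> (\<forall>q\<in>S \<inter> U. F q = f q)" if "p \<in> S" for p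
  proof -
    from L that have "smooth_near A S p f" by blast
    then show ?thesis
      unfolding smooth_near_iff[OF that] smooth_open_std_iff by blast
  qed
  then show "smooth_map A std_atlas S f" unfolding smooth_map_def by blast
qed

section \<open>Curves in a subset and their velocities\<close>

definition curve :: "'m set \<Rightarrow> 'm \<Rightarrow> (real \<Rightarrow> 'm) \<Rightarrow> bool" where
  "curve S p c \<longleftrightarrow> c 0 = p \<and> (\<exists>e>0. \<forall>s\<in>{-e<..<e}. plot A c s \<and> c s \<in> S)"

lemma curveD: "curve S p c \<Longrightarrow> c 0 = p" "curve S p c \<Longrightarrow> plot A c 0" "curve S p c \<Longrightarrow> p \<in> S"
  unfolding curve_def by force+

lemma curveE:
  assumes "curve S p c" 
  obtains N where "open N" "0 \<in> N" "\<forall>s\<in>N. plot A c s \<and> c s \<in> S"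
proof -
  obtain e where "e > 0" "\<forall>s\<in>{-e<..<e}. plot A c s \<and> c s \<in> S" using assms unfolding curve_def by blast
  then show ?thesis using that[of "{-e<..<e}"] by simp
qed

lemma curveI:
  assumes "c 0 = p" "open N" "0 \<in> N" "\<And>s. s \<in> N \<Longrightarrow> plot A c s \<and> c s \<in> S"
  shows "curve S p c"
proof -
  obtain e where e: "e > 0" "ball 0 e \<subseteq> N" using openE[OF assms(2,3)] by blast
  have "{-e<..<e} \<subseteq> N" using e(2) by (auto simp: ball_def dist_real_def subset_iff)
  then show ?thesis unfolding curve_def using assms(1,4) e(1) by blast
qed

lemma tangent_space_eq: "tangent_space A S p = {velocity A S c | c. curve S p c}"
proof -
  have "(\<exists>e>0. smooth_map std_atlas A {-e<..<e} c \<and> c ` {-e<..<e} \<subseteq> S) \<longleftrightarrow>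
    (\<exists>e>0. \<forall>s\<in>{-e<..<e}. plot A c s \<and> c s \<in> S)" for c :: "real \<Rightarrow> 'm"
    by (simp add: smooth_map_std_domain_iff[OF open_greaterThanLessThan] image_subset_iff ball_conj_distrib)
  then show ?thesis unfolding tangent_space_def curve_def by simp
qed

text \<open>\<open>f\<close> is controlled on \<open>S\<close> only. The derivative exists because
  the curve stays in \<open>S\<close>, so that \<open>f \<circ> c\<close> agrees near
  \<open>0\<close> with \<open>F \<circ> c\<close> for an ambient smooth extension
  \<open>F\<close>.\<close>

lemma has_derivative_along_curve:
  assumes c: "curve S p c" and f: "smooth_near A S p f"
  shows "((\<lambda>s. f (c s)) has_real_derivative velocity A S c f) (at 0)"
proof -
  obtain U F where F: "open U" "p \<in> U" "\<forall>q\<in>U. smooth_at A q F" "\<forall>q\<in>S \<inter> U. F q = f q"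
    using f curveD(3)[OF c] by (rule smooth_nearE)
  obtain N where N: "open N" "0 \<in> N" "\<forall>s\<in>N. plot A c s \<and> c s \<in> S" using c by (rule curveE)
  obtain N' where N': "open N'" "0 \<in> N'" "c ` N' \<subseteq> U"
    using plot_vimage[OF curveD(2)[OF c] F(1)] F(2) curveD(1)[OF c] by auto
  obtain M where M: "open M" "0 \<in> M" "smooth_on M (\<lambda>s. F (c s))"
    using smooth_at_plot[OF _ curveD(2)[OF c], of F] F(2,3) curveD(1)[OF c] by auto
  have "(\<lambda>s. F (c s)) differentiable (at 0)"
    using smooth_on_has_derivative[OF M(3,2)] by (auto simp: differentiable_def)
  then obtain d where "((\<lambda>s. F (c s)) has_real_derivative d) (at 0)"
    using real_differentiable_def by blast
  then have d: "((\<lambda>s. f (c s)) has_real_derivative d) (at 0)"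
    by (rule has_field_derivative_transform_within_open[OF _ open_Int[OF N(1) N'(1)]])
      (use N N' F in \<open>auto simp: image_subset_iff\<close>)
  then have "velocity A S c f = d"
    using f curveD(1)[OF c] by (simp add: velocity_def DERIV_imp_deriv)
  with d show ?thesis by simp
qed

end

section \<open>Lie groups and invariant vector fields\<close>

text \<open>The symmetry of second derivatives in the form needed for
  \<open>F (c r \<otimes> d s)\<close>, a function of the parameters of two curves.\<close>

lemma mixed_partials_commute:
  fixes G :: "real \<times> real \<Rightarrow> real"
  assumes N: "open N" "(0, 0) \<in> N" and G: "smooth_on N G"
  shows "deriv (\<lambda>r. deriv (\<lambda>s. G (r, s)) 0) 0 = deriv (\<lambda>s. deriv (\<lambda>r. G (r, s)) 0) 0"
proof -
  have line: "deriv (\<lambda>s. g (p + s *\<^sub>R v)) 0 = frechet_derivative g (at p) v"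
    if "smooth_on N g" "p \<in> N" for g :: "real \<times> real \<Rightarrow> real" and p v
  proof -
    have 1: "((\<lambda>s. p + s *\<^sub>R v) has_derivative (\<lambda>h. h *\<^sub>R v)) (at 0)"
      by (auto intro!: derivative_eq_intros)
    have 2: "(g has_derivative frechet_derivative g (at p)) (at (p + 0 *\<^sub>R v))"
      using smooth_on_has_derivative[OF that] by simp
    from has_derivative_compose[OF 1 2]
    have "((\<lambda>s. g (p + s *\<^sub>R v)) has_derivative (\<lambda>h. h * frechet_derivative g (at p) v)) (at 0)"
      by (simp only: linear_scale[OF has_derivative_linear[OF 2]] real_scaleR_def)
    then have "((\<lambda>s. g (p + s *\<^sub>R v)) has_real_derivative frechet_derivative g (at p) v) (at 0)"
      by (simp add: has_field_derivative_def mult_commute_abs)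
    then show ?thesis by (rule DERIV_imp_deriv)
  qed
  have "deriv (\<lambda>r. deriv (\<lambda>s. G (r, s)) 0) 0 = deriv (\<lambda>r. frechet_derivative G (at (r, 0)) (0, 1)) 0"
  proof (rule deriv_cong_ev)
    have "open ((\<lambda>r. (r, 0)) -` N)" using N(1) by (intro open_vimage continuous_intros)
    then have "\<forall>\<^sub>F r in nhds 0. (r, 0) \<in> N"
      using N(2) eventually_nhds_in_open[of "(\<lambda>r. (r, 0)) -` N"] by simp
    then show "\<forall>\<^sub>F r in nhds 0. deriv (\<lambda>s. G (r, s)) 0 = frechet_derivative G (at (r, 0)) (0, 1)"
    proof eventually_elim
      case (elim r)
      show ?case using line[OF G elim, of "(0, 1)"] by simp
    qed
  qed simp
  also have "\<dots> = frechet_derivative (\<lambda>x. frechet_derivative G (at x) (0, 1)) (at (0, 0)) (1, 0)"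
    using line[OF smooth_on_frechet_derivative[OF G] N(2), of "(1, 0)" "(0, 1)"] by simp
  also have "\<dots> = frechet_derivative (\<lambda>x. frechet_derivative G (at x) (1, 0)) (at (0, 0)) (0, 1)"
    by (rule frechet_derivative_commute[OF G N])
  also have "\<dots> = deriv (\<lambda>s. frechet_derivative G (at (0, s)) (1, 0)) 0"
    using line[OF smooth_on_frechet_derivative[OF G] N(2), of "(0, 1)" "(1, 0)"] by simp
  also have "\<dots> = deriv (\<lambda>s. deriv (\<lambda>r. G (r, s)) 0) 0"
  proof (rule deriv_cong_ev)
    have "open ((\<lambda>s. (0, s)) -` N)" using N(1) by (intro open_vimage continuous_intros)
    then have "\<forall>\<^sub>F s in nhds 0. (0, s) \<in> N"
      using N(2) eventually_nhds_in_open[of "(\<lambda>s. (0, s)) -` N"] by simp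
    then show "\<forall>\<^sub>F s in nhds 0. frechet_derivative G (at (0, s)) (1, 0) = deriv (\<lambda>r. G (r, s)) 0"
    proof eventually_elim
      case (elim s)
      show ?case using line[OF G elim, of "(1, 0)"] by simp
    qed
  qed simp
  finally show ?thesis .
qed

locale lie_grp = manifold A + group D
  for A :: "('m::{second_countable_topology,t2_space}, 'e::euclidean_space) atlas"
    and D :: "'m monoid" (structure) +
  assumes lie_group: "lie_group D A"
begin

lemma in_carrier [simp, intro]: "p \<in> carrier D"
  using lie_group by (simp add: lie_group_def)

lemma plot_mult:
  assumes "plot A H x" "plot A K x"
  shows "plot A (\<lambda>y. H y \<otimes> K y) x"
proof -
  have "smooth_map (prod_atlas A A) A UNIV (\<lambda>(p, q). p \<otimes> q)"
    using lie_group by (simp add: lie_group_def)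
  from plot_smooth_map_prod[OF this assms] show ?thesis by simp
qed

lemma plot_m_inv: "plot A H x \<Longrightarrow> plot A (\<lambda>y. inv (H y)) x"
  by (rule plot_smooth_map[of A "\<lambda>p. inv p"]) (use lie_group in \<open>simp_all add: lie_group_def\<close>)

text \<open>Smoothness at \<open>p\<close> of a map of the group into itself, tested on the inverse charts.\<close>

definition smooth_self :: "'m \<Rightarrow> ('m \<Rightarrow> 'm) \<Rightarrow> bool" where
  "smooth_self p h \<longleftrightarrow> (\<forall>V \<phi>. (V, \<phi>) \<in> A \<longrightarrow> p \<in> V \<longrightarrow> plot A (\<lambda>u. h (inv_into V \<phi> u)) (\<phi> p))"

lemma smooth_selfD: "smooth_self p h \<Longrightarrow> (V, \<phi>) \<in> A \<Longrightarrow> p \<in> V \<Longrightarrow> plot A (\<lambda>u. h (inv_into V \<phi> u)) (\<phi> p)"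
  by (simp add: smooth_self_def)

lemma smooth_self_ident: "smooth_self p (\<lambda>q. q)"
  using plot_inv_chart unfolding smooth_self_def by blast

lemma smooth_self_const: "smooth_self p (\<lambda>q. a)"
  using plot_const unfolding smooth_self_def by blast

lemma smooth_self_mult: "smooth_self p h \<Longrightarrow> smooth_self p k \<Longrightarrow> smooth_self p (\<lambda>q. h q \<otimes> k q)"
  using plot_mult unfolding smooth_self_def by blast

lemma smooth_self_inv: "smooth_self p h \<Longrightarrow> smooth_self p (\<lambda>q. inv (h q))"
  using plot_m_inv unfolding smooth_self_def by blast

lemma smooth_near_comp:
  assumes h: "smooth_self p h" "\<And>q. q \<in> S \<Longrightarrow> h q \<in> T" and p: "p \<in> S" and f: "smooth_near A T (h p) f"
  shows "smooth_near A S p (\<lambda>q. f (h q))"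
proof -
  obtain U F where F: "open U" "h p \<in> U" "\<forall>q\<in>U. smooth_at A q F" "\<forall>q\<in>T \<inter> U. F q = f q"
    using f h(2)[OF p] by (rule smooth_nearE)
  obtain U' where U': "open U'" "p \<in> U'" "\<forall>q\<in>U'. h q \<in> U"
    using vimage_nbhd[OF smooth_selfD[OF h(1)] F(1,2)] by blast
  have "smooth_at A p (\<lambda>q. F (h q))"
    by (rule smooth_at_comp[OF smooth_selfD[OF h(1)]]) (use F in auto)
  then show ?thesis
    by (rule smooth_nearI[OF p _ U'(1,2)]) (use F U' h in auto)
qed

end

text \<open>\<open>S\<close> is a bare subgroup without a manifold structure of its own. Its
  differential geometry consists of velocities of ambient smooth curves lying in \<open>S\<close>,
  acting on functions that extend locally to ambient smooth functions.\<close>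

locale lie_subgrp = lie_grp A D
  for A :: "('m::{second_countable_topology,t2_space}, 'e::euclidean_space) atlas"
    and D :: "'m monoid" (structure) +
  fixes S :: "'m set" and lam :: "'v::real_vector \<Rightarrow> 'm tvec" and br :: "'v \<Rightarrow> 'v \<Rightarrow> 'v"
  assumes subgrp: "subgroup S D" and lie_alg: "lie_algebra_of D A S lam br"
begin

lemma S_simps [simp, intro]: "\<one> \<in> S" "p \<in> S \<Longrightarrow> q \<in> S \<Longrightarrow> p \<otimes> q \<in> S" "p \<in> S \<Longrightarrow> inv p \<in> S"
  using subgrp by (auto simp: subgroup_def)

lemma lam_linear: "lam (a *\<^sub>R u + b *\<^sub>R v) f = a * lam u f + b * lam v f"
  using lie_alg by (simp add: lie_algebra_of_def)

lemma lam_add: "lam (u + v) f = lam u f + lam v f"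
  using lam_linear[of 1 u 1 v f] by simp

lemma lam_scale: "lam (a *\<^sub>R u) f = a * lam u f"
  using lam_linear[of a u 0 u f] by simp

lemma lam_inj: "lam u = lam v \<Longrightarrow> u = v"
  using lie_alg unfolding lie_algebra_of_def bij_betw_def by (metis UNIV_I inj_onD)

lemma lam_tangent: "lam u \<in> tangent_space A S \<one>"
  using lie_alg unfolding lie_algebra_of_def bij_betw_def by blast

lemma tangent_lamE: assumes "v \<in> tangent_space A S \<one>" obtains u where "v = lam u"
  using assms lie_alg unfolding lie_algebra_of_def bij_betw_def by blast

lemma inv_into_lam [simp]: "inv_into UNIV lam (lam u) = u"
  using lam_inj by (intro inv_into_f_f injI) auto

lemma lam_curveE: obtains c where "curve S \<one> c" "lam u = velocity A S c"
  using lam_tangent[of u] unfolding tangent_space_eq by blast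

text \<open>This default value lets an equality between vectors \<open>lam u\<close> and
  \<open>lam v\<close> be checked on smooth functions alone.\<close>

lemma lam_not_smooth: "\<not> smooth_near A S \<one> f \<Longrightarrow> lam u f = 0"
  using lam_curveE[of u] curveD(1) by (metis velocity_def)

text \<open>The point is the last argument, so that \<open>left_deriv u f\<close> is again a
  function on the group and invariant fields can be iterated.\<close>

definition left_deriv :: "'v \<Rightarrow> ('m \<Rightarrow> real) \<Rightarrow> 'm \<Rightarrow> real" where
  "left_deriv u f p = lam u (\<lambda>q. f (p \<otimes> q))"

definition right_deriv :: "'v \<Rightarrow> ('m \<Rightarrow> real) \<Rightarrow> 'm \<Rightarrow> real" where
  "right_deriv u f p = lam u (\<lambda>q. f (q \<otimes> p))"

lemma left_field_eq: "left_field D lam u p f = left_deriv u f p"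
  by (simp add: left_field_def push_def left_deriv_def comp_def)

lemma right_field_eq: "right_field D lam u p f = right_deriv u f p"
  by (simp add: right_field_def push_def right_deriv_def comp_def)

lemma left_deriv_one: "left_deriv u f \<one> = lam u f"
  by (simp add: left_deriv_def)

lemma right_deriv_one: "right_deriv u f \<one> = lam u f"
  by (simp add: right_deriv_def)

lemma left_deriv_commutator:
  "p \<in> S \<Longrightarrow> smooth_near A S p f \<Longrightarrow>
    left_deriv u (left_deriv v f) p - left_deriv v (left_deriv u f) p = left_deriv (br u v) f p"
proof -
  have "(\<lambda>q. left_field D lam v q f) = left_deriv v f" for v by (simp add: left_field_eq fun_eq_iff)
  then show "p \<in> S \<Longrightarrow> smooth_near A S p f \<Longrightarrow> ?thesis"
    using lie_alg unfolding lie_algebra_of_def by (metis left_field_eq)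
qed

lemma curve_translate:
  assumes "curve S p c" "a \<in> S" "b \<in> S"
  shows "curve S (a \<otimes> p \<otimes> b) (\<lambda>s. a \<otimes> c s \<otimes> b)"
proof -
  obtain N where N: "open N" "0 \<in> N" "\<forall>s\<in>N. plot A c s \<and> c s \<in> S" using assms(1) by (rule curveE)
  show ?thesis
  proof (rule curveI[OF _ N(1,2)])
    show "a \<otimes> c 0 \<otimes> b = a \<otimes> p \<otimes> b" using curveD(1)[OF assms(1)] by simp
    fix s assume "s \<in> N"
    then have "plot A c s" "c s \<in> S" using N(3) by auto
    then show "plot A (\<lambda>s. a \<otimes> c s \<otimes> b) s \<and> a \<otimes> c s \<otimes> b \<in> S"
      using assms by (intro conjI plot_mult plot_const S_simps)
  qed
qed

lemma smooth_near_translate: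
  assumes "p \<in> S" "a \<in> S" "b \<in> S" "smooth_near A S (a \<otimes> p \<otimes> b) f"
  shows "smooth_near A S p (\<lambda>q. f (a \<otimes> q \<otimes> b))"
  by (rule smooth_near_comp[OF smooth_self_mult[OF smooth_self_mult[OF smooth_self_const smooth_self_ident] smooth_self_const] _ assms(1,4)])
    (use assms in auto)

text \<open>Both directions matter: velocities vanish on functions that are not smooth, so a
  pushed-forward velocity equals the velocity of the translated curve as a functional only if
  translation preserves and reflects smoothness.\<close>

lemma smooth_near_translate_iff:
  assumes "p \<in> S" "a \<in> S" "b \<in> S"
  shows "smooth_near A S p (\<lambda>q. f (a \<otimes> q \<otimes> b)) \<longleftrightarrow> smooth_near A S (a \<otimes> p \<otimes> b) f"
proof
  assume L: "smooth_near A S p (\<lambda>q. f (a \<otimes> q \<otimes> b))"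
  have eq: "inv a \<otimes> (a \<otimes> q \<otimes> b) \<otimes> inv b = q" "a \<otimes> (inv a \<otimes> q \<otimes> inv b) \<otimes> b = q" for q
    by (simp_all add: m_assoc inv_solve_left' inv_solve_right') (simp_all add: m_assoc[symmetric])
  have "smooth_near A S (a \<otimes> p \<otimes> b) (\<lambda>q. f (a \<otimes> (inv a \<otimes> q \<otimes> inv b) \<otimes> b))"
    using smooth_near_translate[of "a \<otimes> p \<otimes> b" "inv a" "inv b" "\<lambda>q. f (a \<otimes> q \<otimes> b)"] assms L eq by simp
  then show "smooth_near A S (a \<otimes> p \<otimes> b) f" by (simp add: eq)
qed (rule smooth_near_translate[OF assms])

lemma push_velocity:
  assumes "curve S p c" "a \<in> S" "b \<in> S"
  shows "push (\<lambda>q. a \<otimes> q \<otimes> b) (velocity A S c) = velocity A S (\<lambda>s. a \<otimes> c s \<otimes> b)"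
proof (rule ext)
  fix f
  show "push (\<lambda>q. a \<otimes> q \<otimes> b) (velocity A S c) f = velocity A S (\<lambda>s. a \<otimes> c s \<otimes> b) f"
    using smooth_near_translate_iff[OF curveD(3)[OF assms(1)] assms(2,3), of f] curveD(1)[OF assms(1)]
    by (simp only: push_def velocity_def comp_def)
qed

lemma push_tangent:
  assumes "v \<in> tangent_space A S p" "a \<in> S" "b \<in> S"
  shows "push (\<lambda>q. a \<otimes> q \<otimes> b) v \<in> tangent_space A S (a \<otimes> p \<otimes> b)"
proof -
  obtain c where c: "v = velocity A S c" "curve S p c"
    using assms(1) unfolding tangent_space_eq by blast
  show ?thesis
    using curve_translate[OF c(2) assms(2,3)] push_velocity[OF c(2) assms(2,3)]
    unfolding tangent_space_eq c(1) by blast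
qed

lemma right_field_tangent: "p \<in> S \<Longrightarrow> right_field D lam u p \<in> tangent_space A S p"
  using push_tangent[OF lam_tangent, of \<one> p] by (simp add: right_field_def)

lemma right_triv_right_field [simp]: "right_triv D lam p (right_field D lam u p) = u"
proof -
  have "push (\<lambda>q. q \<otimes> inv p) (push (\<lambda>q. q \<otimes> p) (lam u)) = lam u"
    by (simp add: push_def comp_def m_assoc)
  then show ?thesis by (simp add: right_triv_def right_field_def)
qed

lemma tangent_right_fieldE:
  assumes "v \<in> tangent_space A S p" "p \<in> S"
  obtains u where "v = right_field D lam u p"
proof -
  have "push (\<lambda>q. q \<otimes> inv p) v \<in> tangent_space A S \<one>"
    using push_tangent[OF assms(1), of \<one> "inv p"] assms(2) by simp
  then obtain u where "push (\<lambda>q. q \<otimes> inv p) v = lam u" by (rule tangent_lamE)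
  then have "push (\<lambda>q. q \<otimes> p) (push (\<lambda>q. q \<otimes> inv p) v) = right_field D lam u p"
    by (simp add: right_field_def)
  then show ?thesis by (intro that[of u]) (simp add: push_def comp_def m_assoc)
qed

lemma lam_eq_deriv:
  assumes "curve S \<one> c" "lam u = velocity A S c" "smooth_near A S \<one> f"
  shows "lam u f = deriv (\<lambda>s. f (c s)) 0"
  using has_derivative_along_curve[OF assms(1,3)] assms(2) by (simp add: DERIV_imp_deriv)

text \<open>A tangent vector of \<open>S\<close> sees only the germ of a function along
  \<open>S\<close>; a formula that holds merely on \<open>S\<close> may therefore be
  differentiated.\<close>

lemma lam_cong:
  assumes "smooth_near A S \<one> f" "open U" "\<one> \<in> U" "\<And>q. q \<in> S \<Longrightarrow> q \<in> U \<Longrightarrow> f q = g q"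
  shows "lam u f = lam u g"
proof -
  obtain c where c: "curve S \<one> c" "lam u = velocity A S c" by (rule lam_curveE)
  have g: "smooth_near A S \<one> g" by (rule smooth_near_transform[OF assms(1) _ assms(2-4)]) auto
  obtain N where N: "open N" "0 \<in> N" "\<forall>s\<in>N. plot A c s \<and> c s \<in> S" using c(1) by (rule curveE)
  obtain N' where N': "open N'" "0 \<in> N'" "c ` N' \<subseteq> U"
    using plot_vimage[OF curveD(2)[OF c(1)] assms(2)] assms(3) curveD(1)[OF c(1)] by auto
  have "((\<lambda>s. g (c s)) has_real_derivative lam u f) (at 0)"
    by (rule has_field_derivative_transform_within_open[OF
          has_derivative_along_curve[OF c(1) assms(1), folded c(2)] open_Int[OF N(1) N'(1)]])
      (use N N' assms(4) in \<open>auto simp: image_subset_iff\<close>)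
  then show ?thesis
    using has_derivative_along_curve[OF c(1) g] c(2) DERIV_unique by metis
qed

lemma lam_DERIV:
  assumes "\<And>c. curve S \<one> c \<Longrightarrow> lam u = velocity A S c \<Longrightarrow> ((\<lambda>s. f (c s)) has_real_derivative d) (at 0)"
    and "smooth_near A S \<one> f"
  shows "lam u f = d"
proof -
  obtain c where c: "curve S \<one> c" "lam u = velocity A S c" by (rule lam_curveE)
  then show ?thesis using assms has_derivative_along_curve[OF c(1) assms(2)] DERIV_unique by metis
qed

text \<open>One statement for three uses: a constant \<open>\<alpha>\<close> or a constant
  \<open>\<beta>\<close> gives the smoothness of right and of left derivatives, and
  \<open>\<alpha> q = q\<close>, \<open>\<beta> q = inv q\<close> that of the adjoint
  representation.\<close>

lemma smooth_near_lam_param: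
  assumes a: "smooth_self p \<alpha>" "\<And>q. q \<in> S \<Longrightarrow> \<alpha> q \<in> S" and b: "smooth_self p \<beta>" "\<And>q. q \<in> S \<Longrightarrow> \<beta> q \<in> S"
    and p: "p \<in> S" and f: "smooth_near A S (\<alpha> p \<otimes> \<beta> p) f"
  shows "smooth_near A S p (\<lambda>q. lam u (\<lambda>r. f (\<alpha> q \<otimes> r \<otimes> \<beta> q)))"
proof -
  obtain c where c: "curve S \<one> c" "lam u = velocity A S c" by (rule lam_curveE)
  have ab: "\<alpha> p \<otimes> \<beta> p \<in> S" using a b p by auto
  obtain U F where F: "open U" "\<alpha> p \<otimes> \<beta> p \<in> U" "\<forall>q\<in>U. smooth_at A q F" "\<forall>q\<in>S \<inter> U. F q = f q"
    using f ab by (rule smooth_nearE)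
  obtain U' where U': "open U'" "p \<in> U'" "\<forall>q\<in>U'. \<alpha> q \<otimes> \<beta> q \<in> U"
    using vimage_nbhd[OF smooth_selfD[OF smooth_self_mult[OF a(1) b(1)]] F(1,2)] by blast
  have "smooth_at A p (\<lambda>q. deriv (\<lambda>s. F (\<alpha> q \<otimes> c s \<otimes> \<beta> q)) 0)"
  proof (rule smooth_at_partial_derivative)
    fix V \<phi> assume V: "(V, \<phi>) \<in> A" "p \<in> V"
    have fst: "plot A (\<lambda>y. h (inv_into V \<phi> (fst y))) (\<phi> p, 0::real)" if "smooth_self p h" for h
      by (rule plot_compose[where h = fst and M = UNIV, OF _ open_UNIV])
        (auto intro: smooth_selfD[OF that V] smooth_on_linear bounded_linear_fst)
    have "plot A (\<lambda>y. c (snd y)) (\<phi> p, 0::real)"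
      by (rule plot_compose[where h = snd and M = UNIV, OF _ open_UNIV])
        (auto intro: curveD(2)[OF c(1)] smooth_on_linear bounded_linear_snd)
    then show "plot A (\<lambda>(u, s). \<alpha> (inv_into V \<phi> u) \<otimes> c s \<otimes> \<beta> (inv_into V \<phi> u)) (\<phi> p, 0)"
      unfolding case_prod_unfold by (intro plot_mult fst a b)
  next
    show "smooth_at A (\<alpha> p \<otimes> c 0 \<otimes> \<beta> p) F" using F(2,3) curveD(1)[OF c(1)] by simp
  qed
  then show ?thesis
  proof (rule smooth_nearI[OF p _ U'(1,2)])
    fix q assume q: "q \<in> S" "q \<in> U'"
    have abq: "\<alpha> q \<in> S" "\<beta> q \<in> S" "\<alpha> q \<otimes> \<beta> q \<in> U" using a b q U' by auto
    have "smooth_near A S (\<alpha> q \<otimes> \<one> \<otimes> \<beta> q) f"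
      by (rule smooth_nearI[of _ S F U]) (use F abq in auto)
    then have sm: "smooth_near A S \<one> (\<lambda>r. f (\<alpha> q \<otimes> r \<otimes> \<beta> q))"
      using abq by (intro smooth_near_translate) auto
    have cq: "curve S (\<alpha> q \<otimes> \<one> \<otimes> \<beta> q) (\<lambda>s. \<alpha> q \<otimes> c s \<otimes> \<beta> q)"
      by (rule curve_translate[OF c(1) abq(1,2)])
    obtain N where N: "open N" "0 \<in> N" "\<forall>s\<in>N. plot A (\<lambda>s. \<alpha> q \<otimes> c s \<otimes> \<beta> q) s \<and> \<alpha> q \<otimes> c s \<otimes> \<beta> q \<in> S"
      using cq by (rule curveE)
    obtain N' where N': "open N'" "0 \<in> N'" "(\<lambda>s. \<alpha> q \<otimes> c s \<otimes> \<beta> q) ` N' \<subseteq> U"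
      using plot_vimage[OF curveD(2)[OF cq] F(1)] abq curveD(1)[OF c(1)] by auto
    have "((\<lambda>s. F (\<alpha> q \<otimes> c s \<otimes> \<beta> q)) has_real_derivative lam u (\<lambda>r. f (\<alpha> q \<otimes> r \<otimes> \<beta> q))) (at 0)"
      by (rule has_field_derivative_transform_within_open[OF
            has_derivative_along_curve[OF c(1) sm, folded c(2)] open_Int[OF N(1) N'(1)]])
        (use N N' F(4) in \<open>auto simp: image_subset_iff\<close>)
    then show "deriv (\<lambda>s. F (\<alpha> q \<otimes> c s \<otimes> \<beta> q)) 0 = lam u (\<lambda>r. f (\<alpha> q \<otimes> r \<otimes> \<beta> q))"
      by (rule DERIV_imp_deriv)
  qed
qed

lemma smooth_near_right_deriv:
  assumes "p \<in> S" "smooth_near A S p f"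
  shows "smooth_near A S p (right_deriv u f)"
  using smooth_near_lam_param[of p "\<lambda>q. \<one>" "\<lambda>q. q" f u] assms
  by (simp add: right_deriv_def[abs_def] smooth_self_const smooth_self_ident)

lemma smooth_near_left_deriv:
  assumes "p \<in> S" "smooth_near A S p f"
  shows "smooth_near A S p (left_deriv u f)"
  using smooth_near_lam_param[of p "\<lambda>q. q" "\<lambda>q. \<one>" f u] assms
  by (simp add: left_deriv_def[abs_def] smooth_self_const smooth_self_ident)

lemma vector_field_right_field: "vector_field A S (right_field D lam u)"
proof -
  have "(\<lambda>q. right_field D lam u q f) = right_deriv u f" for f
    by (simp add: right_field_eq fun_eq_iff)
  then show ?thesis
    unfolding vector_field_def using right_field_tangent smooth_near_right_deriv by simp
qed

text \<open>Both sides are the mixed second derivative at \<open>(0, 0)\<close> of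
  \<open>f (c r \<otimes> d s)\<close>, where \<open>c\<close> and \<open>d\<close> are curves with
  velocities \<open>lam u\<close> and \<open>lam v\<close>.\<close>

lemma left_right_commute:
  assumes f: "smooth_near A S \<one> f"
  shows "lam u (left_deriv v f) = lam v (right_deriv u f)"
proof -
  obtain c where c: "curve S \<one> c" "lam u = velocity A S c" by (rule lam_curveE)
  obtain d where d: "curve S \<one> d" "lam v = velocity A S d" by (rule lam_curveE)
  obtain U F where F: "open U" "\<one> \<in> U" "\<forall>q\<in>U. smooth_at A q F" "\<forall>q\<in>S \<inter> U. F q = f q"
    using f S_simps(1) by (rule smooth_nearE)
  define G where "G = (\<lambda>(r, s). F (c r \<otimes> d s))"
  have pl: "plot A (\<lambda>y. c (fst y) \<otimes> d (snd y)) (0, 0)"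
    by (intro plot_mult plot_compose[where h = fst and M = UNIV and H = c, OF _ open_UNIV]
        plot_compose[where h = snd and M = UNIV and H = d, OF _ open_UNIV])
      (auto intro: curveD(2)[OF c(1)] curveD(2)[OF d(1)] smooth_on_linear bounded_linear_fst bounded_linear_snd)
  obtain N where N: "open N" "(0, 0) \<in> N" "smooth_on N G"
    using smooth_at_plot[OF _ pl, of F] F(2,3) curveD(1)[OF c(1)] curveD(1)[OF d(1)]
    by (auto simp: G_def case_prod_unfold)
  obtain N2 where N2: "open N2" "(0, 0) \<in> N2" "(\<lambda>y. c (fst y) \<otimes> d (snd y)) ` N2 \<subseteq> U"
    using plot_vimage[OF pl F(1)] F(2) curveD(1)[OF c(1)] curveD(1)[OF d(1)] by auto
  obtain I J where IJ: "open I" "open J" "0 \<in> I" "0 \<in> J" "I \<times> J \<subseteq> N2"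
    using open_prod_elim[OF N2(1,2)] by (metis mem_Sigma_iff)
  obtain M where M: "open M" "0 \<in> M" "\<forall>s\<in>M. plot A c s \<and> c s \<in> S" using c(1) by (rule curveE)
  obtain L where L: "open L" "0 \<in> L" "\<forall>s\<in>L. plot A d s \<and> d s \<in> S" using d(1) by (rule curveE)
  have cd: "c r \<otimes> d s \<in> S" "c r \<otimes> d s \<in> U" if "r \<in> I \<inter> M" "s \<in> J \<inter> L" for r s
  proof -
    have "(r, s) \<in> N2" using IJ(5) that by blast
    then show "c r \<otimes> d s \<in> U" using N2(3) by force
    show "c r \<otimes> d s \<in> S" using M(3) L(3) that by simp
  qed
  have eq: "F (c r \<otimes> d s) = f (c r \<otimes> d s)" if "r \<in> I \<inter> M" "s \<in> J \<inter> L" for r s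
    using F(4) cd[OF that] by simp
  have smooth_cd: "smooth_near A S (c r \<otimes> d s) f" if "r \<in> I \<inter> M" "s \<in> J \<inter> L" for r s
    by (rule smooth_nearI[OF cd(1)[OF that] F(3)[rule_format, OF cd(2)[OF that]] F(1) cd(2)[OF that]])
      (use F(4) in auto)
  have lf: "left_deriv v f (c r) = deriv (\<lambda>s. G (r, s)) 0" if r: "r \<in> I \<inter> M" for r
  proof -
    have "smooth_near A S (c r \<otimes> \<one> \<otimes> \<one>) f"
      using smooth_cd[OF r, of 0] IJ L curveD(1)[OF d(1)] by simp
    then have sm: "smooth_near A S \<one> (\<lambda>q. f (c r \<otimes> q))"
      using smooth_near_translate[of \<one> "c r" \<one> f] r M(3) by simp
    have "((\<lambda>s. G (r, s)) has_real_derivative left_deriv v f (c r)) (at 0)"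
      by (rule has_field_derivative_transform_within_open[OF
            has_derivative_along_curve[OF d(1) sm, folded d(2), folded left_deriv_def] open_Int[OF IJ(2) L(1)]])
        (use IJ L r eq in \<open>auto simp: G_def\<close>)
    then show ?thesis by (simp add: DERIV_imp_deriv)
  qed
  have rf: "right_deriv u f (d s) = deriv (\<lambda>r. G (r, s)) 0" if s: "s \<in> J \<inter> L" for s
  proof -
    have "smooth_near A S (\<one> \<otimes> \<one> \<otimes> d s) f"
      using smooth_cd[OF _ s, of 0] IJ M curveD(1)[OF c(1)] by simp
    then have sm: "smooth_near A S \<one> (\<lambda>q. f (q \<otimes> d s))"
      using smooth_near_translate[of \<one> \<one> "d s" f] s L(3) by simp
    have "((\<lambda>r. G (r, s)) has_real_derivative right_deriv u f (d s)) (at 0)"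
      by (rule has_field_derivative_transform_within_open[OF
            has_derivative_along_curve[OF c(1) sm, folded c(2), folded right_deriv_def] open_Int[OF IJ(1) M(1)]])
        (use IJ M s eq in \<open>auto simp: G_def\<close>)
    then show ?thesis by (simp add: DERIV_imp_deriv)
  qed
  have "lam u (left_deriv v f) = deriv (\<lambda>r. left_deriv v f (c r)) 0"
    by (rule lam_eq_deriv[OF c smooth_near_left_deriv[OF S_simps(1) f]])
  also have "\<dots> = deriv (\<lambda>r. deriv (\<lambda>s. G (r, s)) 0) 0"
    by (rule deriv_cong_ev[OF eventually_mono[OF eventually_nhds_in_open[OF open_Int[OF IJ(1) M(1)]]]])
      (use IJ M lf in auto)
  also have "\<dots> = deriv (\<lambda>s. deriv (\<lambda>r. G (r, s)) 0) 0"
    by (rule mixed_partials_commute[OF N])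
  also have "\<dots> = deriv (\<lambda>s. right_deriv u f (d s)) 0"
    by (rule deriv_cong_ev[OF eventually_mono[OF eventually_nhds_in_open[OF open_Int[OF IJ(2) L(1)]]]])
      (use IJ L rf in auto)
  also have "\<dots> = lam v (right_deriv u f)"
    by (rule lam_eq_deriv[OF d smooth_near_right_deriv[OF S_simps(1) f], symmetric])
  finally show ?thesis .
qed

text \<open>After right translation to the unit, \<open>left_right_commute\<close> exchanges
  iterated right derivatives for iterated left derivatives in the opposite order, which is where the
  minus sign comes from.\<close>

lemma right_deriv_commutator:
  assumes p: "p \<in> S" and f: "smooth_near A S p f"
  shows "right_deriv u (right_deriv v f) p - right_deriv v (right_deriv u f) p = - right_deriv (br u v) f p"
proof -
  let ?f = "\<lambda>q. f (q \<otimes> p)"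
  have sm: "smooth_near A S \<one> ?f"
    using smooth_near_translate[of \<one> \<one> p f] p f by simp
  have eq: "right_deriv u (right_deriv v f) p = lam u (right_deriv v ?f)" for u v
    by (simp add: right_deriv_def[abs_def] m_assoc)
  have "lam u (right_deriv v ?f) - lam v (right_deriv u ?f) = lam v (left_deriv u ?f) - lam u (left_deriv v ?f)"
    by (simp add: left_right_commute[OF sm])
  also have "\<dots> = - left_deriv (br u v) ?f \<one>"
    using left_deriv_commutator[OF S_simps(1) sm, of u v] unfolding left_deriv_one by linarith
  finally show ?thesis by (simp only: eq) (simp add: right_deriv_def left_deriv_def)
qed

lemma left_field_right_field:
  "lam u (\<lambda>r. f (g \<otimes> r)) = right_deriv (lie_Ad D lam g u) f g" if g: "g \<in> S"
proof -
  have "push (\<lambda>p. g \<otimes> p \<otimes> inv g) (lam u) \<in> tangent_space A S \<one>"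
    using push_tangent[OF lam_tangent, of g "inv g"] g by simp
  then obtain w where w: "push (\<lambda>p. g \<otimes> p \<otimes> inv g) (lam u) = lam w" by (rule tangent_lamE)
  then have "lam (lie_Ad D lam g u) = lam w" by (simp add: lie_Ad_def)
  then have "right_deriv (lie_Ad D lam g u) f g = push (\<lambda>p. g \<otimes> p \<otimes> inv g) (lam u) (\<lambda>q. f (q \<otimes> g))"
    using w by (simp add: right_deriv_def)
  then show ?thesis by (simp add: push_def comp_def m_assoc)
qed

lemma lam_Ad: "lam (lie_Ad D lam g u) f = lam u (\<lambda>p. f (g \<otimes> p \<otimes> inv g))" if g: "g \<in> S"
proof -
  have "push (\<lambda>p. g \<otimes> p \<otimes> inv g) (lam u) \<in> tangent_space A S \<one>"
    using push_tangent[OF lam_tangent, of g "inv g"] g by simp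
  then obtain w where w: "push (\<lambda>p. g \<otimes> p \<otimes> inv g) (lam u) = lam w" by (rule tangent_lamE)
  then have "lam (lie_Ad D lam g u) = push (\<lambda>p. g \<otimes> p \<otimes> inv g) (lam u)" by (simp add: lie_Ad_def)
  then show ?thesis by (simp add: push_def comp_def)
qed

end

section \<open>Dual bases and invariant covectors\<close>

locale dual_basis =
  fixes t :: "'n::finite \<Rightarrow> 'g::euclidean_space" and t' :: "'n \<Rightarrow> 'g dual"
  assumes bases: "dual_bases t t'"
begin

lemma t'_t [simp]: "t' i (t j) = (if i = j then 1 else 0)"
  using bases by (simp add: dual_bases_def)

lemma vec_expand: "x = (\<Sum>k\<in>UNIV. t' k x *\<^sub>R t k)"
proof -
  have "x \<in> span (range t)" "inj t" using bases by (auto simp: dual_bases_def)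
  then obtain c where c: "x = (\<Sum>v\<in>range t. c v *\<^sub>R v)"
    by (auto simp: span_finite)
  then have c': "x = (\<Sum>k\<in>UNIV. c (t k) *\<^sub>R t k)"
    using sum.reindex[OF \<open>inj t\<close>] by (simp add: comp_def)
  have "t' k x = c (t k)" for k
    by (subst c') (simp add: blinfun.sum_right blinfun.scaleR_right if_distrib[of "(*) _"] cong: if_cong)
  then show ?thesis using c' by simp
qed

lemma dual_expand: fixes \<xi> :: "'g dual" shows "\<xi> = (\<Sum>k\<in>UNIV. \<xi> (t k) *\<^sub>R t' k)"
proof (rule blinfun_eqI)
  fix x
  show "blinfun_apply \<xi> x = blinfun_apply (\<Sum>k\<in>UNIV. \<xi> (t k) *\<^sub>R t' k) x"
  proof -
    have "blinfun_apply \<xi> x = \<xi> (\<Sum>k\<in>UNIV. t' k x *\<^sub>R t k)" using vec_expand[of x] by simp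
    then show ?thesis
      by (simp add: blinfun.sum_right blinfun.scaleR_right blinfun.sum_left blinfun.scaleR_left mult.commute)
  qed
qed

lemma vec_eqI:
  fixes x y :: 'g
  assumes "\<And>\<xi> :: 'g dual. blinfun_apply \<xi> x = \<xi> y"
  shows "x = y"
proof -
  have "x = (\<Sum>k\<in>UNIV. t' k x *\<^sub>R t k)" by (rule vec_expand)
  also have "\<dots> = (\<Sum>k\<in>UNIV. t' k y *\<^sub>R t k)" by (simp only: assms)
  also have "\<dots> = y" by (rule vec_expand[symmetric])
  finally show ?thesis .
qed

lemma dual_eqI:
  fixes \<xi> \<eta> :: "'g dual"
  assumes "\<And>k. blinfun_apply \<xi> (t k) = \<eta> (t k)"
  shows "\<xi> = \<eta>"
proof -
  have "\<xi> = (\<Sum>k\<in>UNIV. \<xi> (t k) *\<^sub>R t' k)" by (rule dual_expand)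
  also have "\<dots> = (\<Sum>k\<in>UNIV. \<eta> (t k) *\<^sub>R t' k)" by (simp only: assms)
  also have "\<dots> = \<eta>" by (rule dual_expand[symmetric])
  finally show ?thesis .
qed

lemma linear_vec_expand:
  fixes F :: "'g \<Rightarrow> 'b::real_vector"
  assumes "linear F" shows "F x = (\<Sum>k\<in>UNIV. t' k x *\<^sub>R F (t k))"
  by (subst vec_expand[of x]) (simp add: linear_sum[OF assms] linear_scale[OF assms])

lemma linear_dual_expand:
  fixes F :: "'g dual \<Rightarrow> 'b::real_vector"
  assumes "linear F" shows "F \<xi> = (\<Sum>k\<in>UNIV. \<xi> (t k) *\<^sub>R F (t' k))"
  by (subst dual_expand[of \<xi>]) (simp add: linear_sum[OF assms] linear_scale[OF assms])

lemma bilinear_vec_expand: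
  assumes "bilinear F"
  shows "F x y = (\<Sum>i\<in>UNIV. \<Sum>j\<in>UNIV. (t' i x * t' j y) *\<^sub>R F (t i) (t j))"
proof -
  have l: "linear (\<lambda>x. F x y)" "linear (F x)" for x y
    using assms by (auto simp: bilinear_def)
  have "F x y = (\<Sum>i\<in>UNIV. t' i x *\<^sub>R F (t i) y)" by (rule linear_vec_expand[OF l(1)])
  also have "\<dots> = (\<Sum>i\<in>UNIV. t' i x *\<^sub>R (\<Sum>j\<in>UNIV. t' j y *\<^sub>R F (t i) (t j)))"
    by (subst linear_vec_expand[OF l(2)]) simp
  finally show ?thesis by (simp add: scaleR_sum_right)
qed

text \<open>Reflexivity of a finite-dimensional space made explicit: a linear functional on the dual
  is evaluation at this vector. It also resolves the \<open>THE\<close> descriptions by which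
  vectors of \<open>'g\<close> are defined.\<close>

definition vec_of :: "('g dual \<Rightarrow> real) \<Rightarrow> 'g" where
  "vec_of F = (\<Sum>k\<in>UNIV. F (t' k) *\<^sub>R t k)"

lemma vec_of:
  assumes "linear F"
  shows "blinfun_apply \<xi> (vec_of F) = F \<xi>"
proof -
  have "F \<xi> = (\<Sum>k\<in>UNIV. \<xi> (t k) *\<^sub>R F (t' k))" by (rule linear_dual_expand[OF assms])
  then show ?thesis by (simp add: vec_of_def blinfun.sum_right blinfun.scaleR_right mult.commute)
qed

lemma the_vec:
  fixes F :: "'g dual \<Rightarrow> real"
  assumes F: "linear F"
  shows "blinfun_apply \<xi> (THE z. \<forall>\<eta>. blinfun_apply \<eta> z = F \<eta>) = F \<xi>"
proof -
  have "(THE z. \<forall>\<eta>. blinfun_apply \<eta> z = F \<eta>) = vec_of F"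
  proof (rule the_equality)
    fix z assume "\<forall>\<eta>. blinfun_apply \<eta> z = F \<eta>"
    then show "z = vec_of F" by (intro vec_eqI) (simp add: vec_of[OF F])
  qed (simp add: vec_of[OF F])
  then show ?thesis by (simp add: vec_of[OF F])
qed

lemma coad_dual_apply:
  fixes brs :: "'g dual \<Rightarrow> 'g dual \<Rightarrow> 'g dual"
  assumes "bilinear brs"
  shows "blinfun_apply \<eta> (coad_dual brs \<xi> y) = - brs \<xi> \<eta> y"
proof -
  have "linear (\<lambda>\<eta>. - blinfun_apply (brs \<xi> \<eta>) y)"
    by (intro linearI) (simp_all add: bilinear_radd[OF assms] bilinear_rmul[OF assms] blinfun.add_left blinfun.scaleR_left)
  then show ?thesis unfolding coad_dual_def by (rule the_vec)
qed

end

lemma blinfun_apply_Blinfun_linear: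
  fixes f :: "'g::euclidean_space \<Rightarrow> real"
  shows "linear f \<Longrightarrow> blinfun_apply (Blinfun f) = f"
  by (simp add: bounded_linear_Blinfun_apply linear_conv_bounded_linear)

section \<open>Derivation rules at the unit and the adjoint action\<close>

context lie_subgrp begin

lemma lam_const: "lam u (\<lambda>q. k) = 0"
  by (rule lam_DERIV) (auto intro: smooth_near_const)

lemma lam_fun_add:
  assumes "smooth_near A S \<one> f" "smooth_near A S \<one> g"
  shows "lam u (\<lambda>q. f q + g q) = lam u f + lam u g"
proof (rule lam_DERIV)
  fix c assume c: "curve S \<one> c" "lam u = velocity A S c"
  show "((\<lambda>s. f (c s) + g (c s)) has_real_derivative lam u f + lam u g) (at 0)"
    using DERIV_add[OF has_derivative_along_curve[OF c(1) assms(1)] has_derivative_along_curve[OF c(1) assms(2)]]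
    by (simp add: c(2))
qed (intro smooth_near_add assms S_simps)

lemma lam_fun_mult:
  assumes "smooth_near A S \<one> f" "smooth_near A S \<one> g"
  shows "lam u (\<lambda>q. f q * g q) = lam u f * g \<one> + lam u g * f \<one>"
proof (rule lam_DERIV)
  fix c assume c: "curve S \<one> c" "lam u = velocity A S c"
  show "((\<lambda>s. f (c s) * g (c s)) has_real_derivative lam u f * g \<one> + lam u g * f \<one>) (at 0)"
    using DERIV_mult[OF has_derivative_along_curve[OF c(1) assms(1)] has_derivative_along_curve[OF c(1) assms(2)]]
    by (simp add: c(2) curveD(1)[OF c(1)])
qed (intro smooth_near_mult assms S_simps)

lemma lam_fun_cmult:
  "smooth_near A S \<one> f \<Longrightarrow> lam u (\<lambda>q. k * f q) = k * lam u f"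
  using lam_fun_mult[of "\<lambda>q. k" f u] by (simp add: smooth_near_const lam_const)

lemma lam_fun_sum:
  "finite I \<Longrightarrow> (\<And>i. i \<in> I \<Longrightarrow> smooth_near A S \<one> (f i)) \<Longrightarrow> lam u (\<lambda>q. \<Sum>i\<in>I. f i q) = (\<Sum>i\<in>I. lam u (f i))"
  by (induction I rule: finite_induct) (auto simp: lam_const lam_fun_add smooth_near_sum)

lemma smooth_near_right_translate:
  "p \<in> S \<Longrightarrow> smooth_near A S p f \<Longrightarrow> smooth_near A S \<one> (\<lambda>q. f (q \<otimes> p))"
  using smooth_near_translate[of \<one> \<one> p f] by simp

lemma right_deriv_fun_mult:
  assumes "p \<in> S" "smooth_near A S p f" "smooth_near A S p g"
  shows "right_deriv u (\<lambda>q. f q * g q) p = right_deriv u f p * g p + right_deriv u g p * f p"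
  using lam_fun_mult[OF smooth_near_right_translate[OF assms(1,2)] smooth_near_right_translate[OF assms(1,3)]]
  by (simp add: right_deriv_def)

lemma right_deriv_fun_sum:
  assumes "finite I" "p \<in> S" "\<And>i. i \<in> I \<Longrightarrow> smooth_near A S p (f i)"
  shows "right_deriv u (\<lambda>q. \<Sum>i\<in>I. f i q) p = (\<Sum>i\<in>I. right_deriv u (f i) p)"
  unfolding right_deriv_def
  by (rule lam_fun_sum[OF assms(1) smooth_near_right_translate[OF assms(2,3)]])

lemma linear_Ad: "g \<in> S \<Longrightarrow> linear (lie_Ad D lam g)"
  by (intro linearI; rule lam_inj) (simp_all add: fun_eq_iff lam_Ad lam_add lam_scale)

lemma Ad_one: "lie_Ad D lam \<one> u = u"
  by (rule lam_inj) (simp add: fun_eq_iff lam_Ad)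

lemma Ad_mult: "g \<in> S \<Longrightarrow> h \<in> S \<Longrightarrow> lie_Ad D lam (g \<otimes> h) u = lie_Ad D lam g (lie_Ad D lam h u)"
  by (rule lam_inj) (simp add: fun_eq_iff lam_Ad m_assoc inv_mult_group)

text \<open>Conjugation by \<open>g\<close> is a group automorphism preserving \<open>S\<close>, so
  it carries iterated left-invariant derivatives of \<open>f\<close> to those of \<open>f\<close>
  composed with the conjugation. Functions that are not smooth at the unit are settled by the
  default value.\<close>

lemma Ad_bracket:
  assumes g: "g \<in> S"
  shows "lie_Ad D lam g (br u v) = br (lie_Ad D lam g u) (lie_Ad D lam g v)"
proof (rule lam_inj, rule ext)
  fix f
  show "lam (lie_Ad D lam g (br u v)) f = lam (br (lie_Ad D lam g u) (lie_Ad D lam g v)) f"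
  proof (cases "smooth_near A S \<one> f")
    case True
    let ?f = "\<lambda>p. f (g \<otimes> p \<otimes> inv g)"
    have sm: "smooth_near A S \<one> ?f"
      using smooth_near_translate[of \<one> g "inv g" f] g True by simp
    have c: "inv g \<otimes> (g \<otimes> q) = q" for q by (simp add: m_assoc[symmetric])
    have eq: "lam (lie_Ad D lam g u) (left_deriv (lie_Ad D lam g v) f) = lam u (left_deriv v ?f)" for u v
      by (simp add: lam_Ad[OF g] left_deriv_def[abs_def] m_assoc c)
    have "lam (br (lie_Ad D lam g u) (lie_Ad D lam g v)) f = lam (br u v) ?f"
      using left_deriv_commutator[OF S_simps(1) True, of "lie_Ad D lam g u" "lie_Ad D lam g v"]
        left_deriv_commutator[OF S_simps(1) sm, of u v] unfolding left_deriv_one eq by linarith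
    then show ?thesis by (simp add: lam_Ad[OF g])
  next
    case False
    then show ?thesis by (simp add: lam_not_smooth)
  qed
qed

end

section \<open>Covectors in the right trivialisation\<close>

locale dual_grp = lie_subgrp A D S lam brs + dual_basis t t'
  for A :: "('m::{second_countable_topology,t2_space}, 'e::euclidean_space) atlas"
    and D :: "'m monoid" (structure) and S :: "'m set"
    and lam :: "'g::euclidean_space dual \<Rightarrow> 'm tvec" and brs :: "'g dual \<Rightarrow> 'g dual \<Rightarrow> 'g dual"
    and t :: "'n::finite \<Rightarrow> 'g" and t' :: "'n \<Rightarrow> 'g dual"
begin

lemma linear_lam: "linear (\<lambda>\<xi>. lam \<xi> f)"
  by (intro linearI) (simp_all add: lam_add lam_scale)

lemma linear_right_deriv: "linear (\<lambda>\<xi>. right_deriv \<xi> f p)"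
  unfolding right_deriv_def by (rule linear_lam)

text \<open>The functionals \<open>\<xi> \<mapsto> lam \<xi> f\<close> separate the points of the dual, so they form all of \<open>'g\<close>.\<close>

lemma covector_is_differential: "\<exists>f. smooth_near A S \<one> f \<and> (\<forall>\<xi>. lam \<xi> f = \<xi> x)"
proof (rule ccontr)
  let ?V = "{x. \<exists>f. smooth_near A S \<one> f \<and> (\<forall>\<xi>. lam \<xi> f = \<xi> x)}"
  assume "\<not> ?thesis"
  then have "?V \<noteq> UNIV" by blast
  moreover have "subspace ?V"
  proof (rule subspaceI)
    show "0 \<in> ?V" using smooth_near_const[of \<one> S 0] by (auto simp: lam_const intro!: exI[of _ "\<lambda>q. 0"])
    fix x y assume "x \<in> ?V" "y \<in> ?V"
    then obtain f g where "smooth_near A S \<one> f" "\<forall>\<xi>. lam \<xi> f = \<xi> x" "smooth_near A S \<one> g" "\<forall>\<xi>. lam \<xi> g = \<xi> y"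
      by blast
    then show "x + y \<in> ?V"
      by (auto simp: lam_fun_add blinfun.add_right intro!: exI[of _ "\<lambda>q. f q + g q"] smooth_near_add)
  next
    fix c x assume "x \<in> ?V"
    then obtain f where "smooth_near A S \<one> f" "\<forall>\<xi>. lam \<xi> f = \<xi> x"
      by blast
    then show "c *\<^sub>R x \<in> ?V"
      by (auto simp: lam_fun_cmult blinfun.scaleR_right intro!: exI[of _ "\<lambda>q. c * f q"] smooth_near_mult smooth_near_const)
  qed
  then have "span ?V = ?V" by (rule span_eq_iff[THEN iffD2])
  ultimately have "span ?V \<noteq> UNIV" by (simp only: not_False_eq_True)
  \<comment> \<open>A nonzero vector orthogonal to \<open>?V\<close> yields a nonzero element
    \<open>?\<xi>\<close> of the dual which \<open>lam\<close> sends to the zero functional, against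
    the injectivity of \<open>lam\<close>.\<close>
  from span_not_UNIV_orthogonal[OF this, unfolded \<open>span ?V = ?V\<close>]
  obtain a where a: "a \<noteq> 0" "\<forall>x\<in>?V. a \<bullet> x = 0" by blast
  let ?\<xi> = "Blinfun (\<lambda>x. a \<bullet> x)"
  have xi: "blinfun_apply ?\<xi> = (\<lambda>x. a \<bullet> x)"
    by (rule bounded_linear_Blinfun_apply[OF bounded_linear_inner_right])
  have "lam ?\<xi> f = lam 0 f" for f
  proof (cases "smooth_near A S \<one> f")
    case True
    have z: "\<forall>\<xi>. lam \<xi> f = \<xi> (vec_of (\<lambda>\<xi>. lam \<xi> f))"
      by (simp add: vec_of[OF linear_lam])
    then have "vec_of (\<lambda>\<xi>. lam \<xi> f) \<in> ?V" using True by blast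
    with a(2) have "a \<bullet> vec_of (\<lambda>\<xi>. lam \<xi> f) = 0" by blast
    then have "lam ?\<xi> f = 0" using z[rule_format, of ?\<xi>] unfolding xi by (rule trans[rotated])
    then show ?thesis using lam_scale[of 0 0 f] by simp
  next
    case False
    then show ?thesis by (simp add: lam_not_smooth)
  qed
  then have "?\<xi> = 0" using lam_inj by blast
  then have "a \<bullet> a = 0" using fun_cong[OF xi, of a] by simp
  then show False using a(1) by simp
qed

text \<open>Only the differential at the unit is prescribed. These functions are not coordinates of
  a chart, but they suffice to test vectors and covectors to first order.\<close>

definition coord :: "'g \<Rightarrow> 'm \<Rightarrow> real" where
  "coord x = (SOME f. smooth_near A S \<one> f \<and> (\<forall>\<xi>. lam \<xi> f = \<xi> x))"

lemma smooth_near_coord: "smooth_near A S \<one> (coord x)" and lam_coord [simp]: "lam \<xi> (coord x) = \<xi> x"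
  using someI_ex[OF covector_is_differential[of x]] unfolding coord_def by auto

text \<open>The differential of \<open>f\<close> at \<open>p\<close>, brought to the unit by right
  translation and read as an element of \<open>'g\<close>.\<close>

definition grad :: "('m \<Rightarrow> real) \<Rightarrow> 'm \<Rightarrow> 'g" where
  "grad f p = vec_of (\<lambda>\<xi>. right_deriv \<xi> f p)"

lemma grad: "blinfun_apply \<xi> (grad f p) = right_deriv \<xi> f p"
  by (simp add: grad_def vec_of[OF linear_right_deriv])

lemma right_form_right_field [simp]:
  "p \<in> S \<Longrightarrow> right_form D A S lam x p (right_field D lam \<xi> p) = \<xi> x"
  by (simp add: right_form_def right_field_tangent)

lemma right_field_linear:
  "(\<lambda>f. a * right_field D lam \<xi> p f + b * right_field D lam \<eta> p f) = right_field D lam (a *\<^sub>R \<xi> + b *\<^sub>R \<eta>) p"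
  by (simp add: fun_eq_iff right_field_eq right_deriv_def lam_linear)

lemma right_form_cotangent: "p \<in> S \<Longrightarrow> right_form D A S lam x p \<in> cotangent_space A S p"
proof -
  assume p: "p \<in> S"
  have "right_form D A S lam x p (\<lambda>f. a * v f + b * w f) = a * right_form D A S lam x p v + b * right_form D A S lam x p w"
    if vw: "v \<in> tangent_space A S p" "w \<in> tangent_space A S p" for v w a b
  proof -
    obtain \<xi> where "v = right_field D lam \<xi> p" using vw(1) p by (rule tangent_right_fieldE)
    moreover obtain \<eta> where "w = right_field D lam \<eta> p" using vw(2) p by (rule tangent_right_fieldE)
    ultimately show ?thesis
      using p by (simp add: right_field_linear blinfun.add_left blinfun.scaleR_left)
  qed
  then show ?thesis unfolding cotangent_space_def by (auto simp: right_form_def)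
qed

lemma right_form_linear:
  "right_form D A S lam (a *\<^sub>R x + b *\<^sub>R y) p = (\<lambda>v. a * right_form D A S lam x p v + b * right_form D A S lam y p v)"
  by (auto simp: right_form_def blinfun.add_right blinfun.scaleR_right fun_eq_iff)

lemma covector_eqI:
  assumes "p \<in> S" "\<And>v. v \<notin> tangent_space A S p \<Longrightarrow> \<omega> v = 0" "\<And>\<xi>. \<omega> (right_field D lam \<xi> p) = \<xi> x"
  shows "\<omega> = right_form D A S lam x p"
proof
  fix v
  show "\<omega> v = right_form D A S lam x p v"
  proof (cases "v \<in> tangent_space A S p")
    case True
    then obtain \<xi> where "v = right_field D lam \<xi> p" using assms(1) by (rule tangent_right_fieldE)
    then show ?thesis using assms by simp
  next
    case False
    then show ?thesis using assms by (simp add: right_form_def)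
  qed
qed

lemma differential_right_field: "p \<in> S \<Longrightarrow> differential A S f p (right_field D lam \<xi> p) = right_deriv \<xi> f p"
  by (simp add: differential_def right_field_tangent right_field_eq)

lemma differential_eq: "p \<in> S \<Longrightarrow> differential A S f p = right_form D A S lam (grad f p) p"
  by (rule covector_eqI) (simp_all add: differential_right_field grad, simp add: differential_def)

text \<open>The transpose on \<open>'g\<close> of the adjoint action on the dual. It appears because
  left translation, read in the right trivialisation, is \<open>lie_Ad\<close>.\<close>

definition AdT :: "'m \<Rightarrow> 'g \<Rightarrow> 'g" where
  "AdT g x = vec_of (\<lambda>\<xi>. lie_Ad D lam g \<xi> x)"

lemma linear_Ad_apply: "g \<in> S \<Longrightarrow> linear (\<lambda>\<xi>. blinfun_apply (lie_Ad D lam g \<xi>) x)"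
  by (intro linearI)
    (simp_all add: linear_add[OF linear_Ad] linear_scale[OF linear_Ad] blinfun.add_left blinfun.scaleR_left)

lemma AdT: "g \<in> S \<Longrightarrow> blinfun_apply \<xi> (AdT g x) = lie_Ad D lam g \<xi> x"
  by (simp add: AdT_def vec_of[OF linear_Ad_apply])

lemma pull_left_right_form:
  assumes "g \<in> S" "h \<in> S"
  shows "pull A S h (\<lambda>q. g \<otimes> q) (right_form D A S lam x (g \<otimes> h)) = right_form D A S lam (AdT g x) h"
proof (rule covector_eqI)
  fix \<xi>
  have c: "inv g \<otimes> (g \<otimes> q) = q" for q by (simp add: m_assoc[symmetric])
  have "push (\<lambda>q. g \<otimes> q) (right_field D lam \<xi> h) = right_field D lam (lie_Ad D lam g \<xi>) (g \<otimes> h)"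
    by (rule ext) (simp add: push_def comp_def right_field_eq right_deriv_def lam_Ad[OF assms(1)] m_assoc c)
  then show "pull A S h (\<lambda>q. g \<otimes> q) (right_form D A S lam x (g \<otimes> h)) (right_field D lam \<xi> h) = \<xi> (AdT g x)"
    using assms by (simp add: pull_def right_field_tangent AdT)
qed (use assms in \<open>auto simp: pull_def\<close>)

lemma pull_right_right_form:
  assumes "g \<in> S" "h \<in> S"
  shows "pull A S g (\<lambda>q. q \<otimes> h) (right_form D A S lam x (g \<otimes> h)) = right_form D A S lam x g"
proof (rule covector_eqI)
  fix \<xi>
  have "push (\<lambda>q. q \<otimes> h) (right_field D lam \<xi> g) = right_field D lam \<xi> (g \<otimes> h)"
    by (rule ext) (simp add: push_def comp_def right_field_eq right_deriv_def m_assoc)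
  then show "pull A S g (\<lambda>q. q \<otimes> h) (right_form D A S lam x (g \<otimes> h)) (right_field D lam \<xi> g) = \<xi> x"
    using assms by (simp add: pull_def right_field_tangent)
qed (use assms in \<open>auto simp: pull_def\<close>)

end

section \<open>The trivialised Poisson--Lie bivector\<close>

context lie_subgrp begin

lemma smooth_near_nonzero:
  assumes "smooth_near A S p f" "p \<in> S" "f p \<noteq> 0"
  shows "\<exists>U. open U \<and> p \<in> U \<and> (\<forall>q\<in>S \<inter> U. f q \<noteq> 0)"
proof -
  obtain U F where F: "open U" "p \<in> U" "\<forall>q\<in>U. smooth_at A q F" "\<forall>q\<in>S \<inter> U. F q = f q"
    using assms(1,2) by (rule smooth_nearE)
  obtain V \<phi> where V: "(V, \<phi>) \<in> A" "p \<in> V" by (rule chart_at)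
  obtain N where N: "open N" "\<phi> p \<in> N" "N \<subseteq> \<phi> ` V" "smooth_on N (\<lambda>u. F (inv_into V \<phi> u))"
    using smooth_at_chart[OF F(3)[rule_format, OF F(2)] V] by blast
  let ?N = "(\<lambda>u. F (inv_into V \<phi> u)) -` (-{0}) \<inter> N"
  have oN: "open ?N"
    using continuous_on_open_vimage[OF N(1)] smooth_on_imp_continuous_on[OF N(4)] by blast
  let ?U = "\<phi> -` ?N \<inter> V"
  have "continuous_on V \<phi>" using chart_homeo(3)[OF V(1)] by (simp add: homeomorphism_def)
  then have "open ?U"
    using continuous_on_open_vimage[OF chart_homeo(1)[OF V(1)]] oN by blast
  moreover have "p \<in> ?U" using V N F(2,4) assms(2,3) chart_inv[OF V] by simp
  moreover have "f q \<noteq> 0" if "q \<in> S" "q \<in> U" "q \<in> ?U" for q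
    using that F(4) chart_inv[OF V(1), of q] by auto
  ultimately show ?thesis using F(1,2) by (intro exI[of _ "U \<inter> ?U"]) auto
qed

text \<open>Cramer's rule expresses each component of the solution as a quotient of determinants
  with smooth entries; the denominator stays nonzero near \<open>p\<close>.\<close>

lemma smooth_near_linear_solution:
  fixes M :: "'m \<Rightarrow> real^'k^'k" and X :: "'m \<Rightarrow> real^'k"
  assumes p: "p \<in> S" and M: "\<And>i j. smooth_near A S p (\<lambda>q. M q $ i $ j)"
    and b: "\<And>i. smooth_near A S p (\<lambda>q. (M q *v X q) $ i)" and det: "det (M p) \<noteq> 0"
  shows "smooth_near A S p (\<lambda>q. X q $ k)"
proof -
  have sd: "smooth_near A S p (\<lambda>q. det (M q))" by (rule smooth_near_det[OF p M])
  obtain U where U: "open U" "p \<in> U" "\<forall>q\<in>S \<inter> U. det (M q) \<noteq> 0"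
    using smooth_near_nonzero[OF sd p det] by blast
  let ?C = "\<lambda>q. \<chi> i j. if j = k then (M q *v X q) $ i else M q $ i $ j"
  have "smooth_near A S p (\<lambda>q. ?C q $ i $ j)" for i j
    using M b by (cases "j = k") simp_all
  then have "smooth_near A S p (\<lambda>q. det (?C q) * inverse (det (M q)))"
    by (intro smooth_near_mult smooth_near_det smooth_near_inverse p sd det)
  then show ?thesis
  proof (rule smooth_near_transform[OF _ p U(1,2)])
    fix q assume "q \<in> S" "q \<in> U"
    then have "det (M q) \<noteq> 0" using U(3) by blast
    from cramer[OF this, of "X q" "M q *v X q"]
    have "X q = (\<chi> k. det (\<chi> i j. if j = k then (M q *v X q) $ i else M q $ i $ j) / det (M q))" by simp
    from arg_cong[OF this, of "\<lambda>v. v $ k"]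
    show "det (?C q) * inverse (det (M q)) = X q $ k" by (simp add: divide_inverse)
  qed
qed

lemma lam_fun_double_sum:
  assumes "finite I" "finite J" "\<And>i j. i \<in> I \<Longrightarrow> j \<in> J \<Longrightarrow> smooth_near A S \<one> (f i j)"
  shows "lam u (\<lambda>q. \<Sum>i\<in>I. \<Sum>j\<in>J. f i j q) = (\<Sum>i\<in>I. \<Sum>j\<in>J. lam u (f i j))"
proof -
  have "lam u (\<lambda>q. \<Sum>i\<in>I. \<Sum>j\<in>J. f i j q) = (\<Sum>i\<in>I. lam u (\<lambda>q. \<Sum>j\<in>J. f i j q))"
    by (intro lam_fun_sum smooth_near_sum assms S_simps)
  also have "\<dots> = (\<Sum>i\<in>I. \<Sum>j\<in>J. lam u (f i j))"
    by (intro sum.cong refl lam_fun_sum assms)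
  finally show ?thesis .
qed

end

section \<open>The components of the bivector and their derivatives\<close>

locale pl_grp = dual_grp A D S lam brs t t'
  for A :: "('m::{second_countable_topology,t2_space}, 'e::euclidean_space) atlas"
    and D :: "'m monoid" (structure) and S :: "'m set"
    and lam :: "'g::euclidean_space dual \<Rightarrow> 'm tvec" and brs :: "'g dual \<Rightarrow> 'g dual \<Rightarrow> 'g dual"
    and t :: "'n::finite \<Rightarrow> 'g" and t' :: "'n \<Rightarrow> 'g dual" +
  fixes br :: "'g \<Rightarrow> 'g \<Rightarrow> 'g" and PiS :: "'m bivec"
  assumes lie_br: "lie_algebra br" and lie_brs: "lie_algebra brs"
    and poisson: "poisson_bivector A S PiS" and multiplicative: "multiplicative_bivec D A S PiS"
    and dual_biv: "dual_bivec D A S lam br PiS"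
begin

lemma bilinear_br: "bilinear br" and bilinear_brs: "bilinear brs"
  using lie_br lie_brs by (simp_all add: lie_algebra_def)

lemmas coad_dual = coad_dual_apply[OF bilinear_brs]

abbreviation P :: "'m \<Rightarrow> 'g \<Rightarrow> 'g \<Rightarrow> real" where
  "P \<equiv> Pi_bold D A S lam PiS"

lemma bivector: "bivector_field A S PiS"
  using poisson by (simp add: poisson_bivector_def)

lemma P_skew: "p \<in> S \<Longrightarrow> P p x y = - P p y x"
  using bivector right_form_cotangent unfolding bivector_field_def Pi_bold_def by blast

lemma P_linear: "p \<in> S \<Longrightarrow> P p (a *\<^sub>R x + b *\<^sub>R y) z = a * P p x z + b * P p y z"
  using bivector right_form_cotangent[of p] unfolding bivector_field_def Pi_bold_def right_form_linear by blast

lemma P_bilinear: assumes "p \<in> S" shows "bilinear (P p)"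
proof -
  have l: "P p (x + y) z = P p x z + P p y z" "P p (a *\<^sub>R x) z = a * P p x z" for x y z a
    using P_linear[OF assms, of 1 x 1 y z] P_linear[OF assms, of a x 0 0 z] by simp_all
  have "linear (\<lambda>x. P p x z)" "linear (\<lambda>x. P p z x)" for z
    by (intro linearI; simp add: l P_skew[OF assms, of z])+
  then show ?thesis by (simp add: bilinear_def)
qed

lemma pbracket_eq: "p \<in> S \<Longrightarrow> pbracket A S PiS f h p = P p (grad f p) (grad h p)"
  by (simp add: pbracket_def Pi_bold_def differential_eq)

lemma P_mult:
  assumes "g \<in> S" "h \<in> S"
  shows "P (g \<otimes> h) x y = P h (AdT g x) (AdT g y) + P g x y"
  using multiplicative assms right_form_cotangent[of "g \<otimes> h"]
  unfolding multiplicative_bivec_def Pi_bold_def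
  by (simp add: pull_left_right_form pull_right_right_form)

lemma AdT_one: "AdT \<one> x = x"
  by (rule vec_eqI) (simp add: AdT Ad_one)

lemma P_one: "P \<one> x y = 0"
  using P_mult[of \<one> \<one> x y] by (simp add: AdT_one)

lemma P_expand: "p \<in> S \<Longrightarrow> P p x y = (\<Sum>i\<in>UNIV. \<Sum>j\<in>UNIV. (t' i x * t' j y) * P p (t i) (t j))"
  using bilinear_vec_expand[OF P_bilinear] by simp

text \<open>Smoothness is given only for brackets of functions, that is, for \<open>P\<close>
  evaluated on gradients. The coefficient matrix \<open>?M\<close> of the gradients of the functions
  \<open>coord (t k)\<close> is the identity at the unit; solving the linear system in one slot and
  then in the other isolates the components of \<open>P\<close>.\<close>

lemma smooth_near_P_one: "smooth_near A S \<one> (\<lambda>q. P q x y)"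
proof -
  let ?f = "\<lambda>k. coord (t k)"
  let ?M = "\<lambda>q. (\<chi> k j. right_deriv (t' j) (?f k) q) :: real^'n^'n"
  have M: "smooth_near A S \<one> (\<lambda>q. ?M q $ i $ j)" for i j
    using smooth_near_right_deriv[OF S_simps(1) smooth_near_coord] by simp
  have "?M \<one> = mat 1" by (auto simp: mat_def vec_eq_iff right_deriv_one)
  then have det: "det (?M \<one>) \<noteq> 0" by simp
  have grad_f: "grad (?f k) q = (\<Sum>j\<in>UNIV. ?M q $ k $ j *\<^sub>R t j)" for k q
    by (subst vec_expand[of "grad (?f k) q"]) (simp add: grad)
  have lin: "linear (\<lambda>x. P q x z)" "linear (P q z)" if "q \<in> S" for q z
    using P_bilinear[OF that] by (simp_all add: bilinear_def)
  have mult1: "(?M q *v (\<chi> i. P q (t i) z)) $ k = P q (grad (?f k) q) z" if "q \<in> S" for q k z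
    unfolding grad_f by (simp add: matrix_vector_mult_def linear_sum[OF lin(1)[OF that]] linear_scale[OF lin(1)[OF that]])
  have mult2: "(?M q *v (\<chi> i. P q z (t i))) $ k = P q z (grad (?f k) q)" if "q \<in> S" for q k z
    unfolding grad_f by (simp add: matrix_vector_mult_def linear_sum[OF lin(2)[OF that]] linear_scale[OF lin(2)[OF that]])
  have br: "smooth_near A S \<one> (\<lambda>q. P q (grad (?f k) q) (grad (?f l) q))" for k l
  proof (rule smooth_near_transform[OF _ S_simps(1) open_UNIV UNIV_I])
    show "smooth_near A S \<one> (pbracket A S PiS (?f k) (?f l))"
      using bivector smooth_near_coord S_simps(1) unfolding bivector_field_def by blast
  qed (rule pbracket_eq)
  have 1: "smooth_near A S \<one> (\<lambda>q. (\<chi> i. P q (t i) (grad (?f l) q)) $ i)" for i l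
  proof (rule smooth_near_linear_solution[OF S_simps(1) M _ det])
    fix k
    show "smooth_near A S \<one> (\<lambda>q. (?M q *v (\<chi> i. P q (t i) (grad (?f l) q))) $ k)"
      by (rule smooth_near_transform[OF br[of k l] S_simps(1) open_UNIV UNIV_I]) (simp only: mult1)
  qed
  have 2: "smooth_near A S \<one> (\<lambda>q. (\<chi> j. P q (t i) (t j)) $ j)" for i j
  proof (rule smooth_near_linear_solution[OF S_simps(1) M _ det])
    fix l
    show "smooth_near A S \<one> (\<lambda>q. (?M q *v (\<chi> j. P q (t i) (t j))) $ l)"
      by (rule smooth_near_transform[OF 1[of l i] S_simps(1) open_UNIV UNIV_I]) (simp only: mult2 vec_lambda_beta)
  qed
  have "smooth_near A S \<one> (\<lambda>q. \<Sum>i\<in>UNIV. \<Sum>j\<in>UNIV. (t' i x * t' j y) * P q (t i) (t j))"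
    by (intro smooth_near_sum smooth_near_mult smooth_near_const S_simps 2[unfolded vec_lambda_beta])
  then show ?thesis
    by (rule smooth_near_transform[OF _ S_simps(1) open_UNIV UNIV_I]) (rule P_expand[symmetric])
qed

lemma smooth_near_Ad: "p \<in> S \<Longrightarrow> smooth_near A S p (\<lambda>h. lie_Ad D lam h \<xi> x)"
proof -
  assume p: "p \<in> S"
  have "smooth_near A S p (\<lambda>q. lam \<xi> (\<lambda>r. coord x (q \<otimes> r \<otimes> inv q)))"
    using p by (intro smooth_near_lam_param smooth_self_ident smooth_self_inv) (simp_all add: smooth_near_coord)
  then show ?thesis
    by (rule smooth_near_transform[OF _ p open_UNIV UNIV_I]) (simp add: lam_Ad[symmetric])
qed

text \<open>The left derivative of \<open>coord x\<close> along \<open>\<xi>\<close> at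
  \<open>h\<close> is its right derivative along the image of \<open>\<xi>\<close> under
  \<open>lie_Ad\<close> at \<open>h\<close>. Differentiating this in \<open>h\<close> at the unit
  gives the wanted derivative plus an iterated right derivative. The latter is exchanged by
  \<open>left_right_commute\<close>, and what remains is a commutator of left-invariant
  fields.\<close>

lemma lam_Ad_deriv: "lam \<zeta> (\<lambda>h. lie_Ad D lam h \<xi> x) = brs \<zeta> \<xi> x"
proof -
  let ?f = "coord x"
  note sm = smooth_near_coord[of x]
  have "lam \<zeta> (left_deriv \<xi> ?f) = lam \<zeta> (\<lambda>h. \<Sum>j\<in>UNIV. lie_Ad D lam h \<xi> (t j) * right_deriv (t' j) ?f h)"
  proof (rule lam_cong[OF smooth_near_left_deriv[OF S_simps(1) sm] open_UNIV UNIV_I])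
    fix h assume h: "h \<in> S"
    show "left_deriv \<xi> ?f h = (\<Sum>j\<in>UNIV. lie_Ad D lam h \<xi> (t j) * right_deriv (t' j) ?f h)"
      unfolding left_deriv_def left_field_right_field[OF h]
      by (subst linear_dual_expand[OF linear_right_deriv]) simp
  qed
  also have "\<dots> = (\<Sum>j\<in>UNIV. lam \<zeta> (\<lambda>h. lie_Ad D lam h \<xi> (t j) * right_deriv (t' j) ?f h))"
    by (intro lam_fun_sum finite smooth_near_mult smooth_near_Ad smooth_near_right_deriv S_simps sm)
  also have "\<dots> = (\<Sum>j\<in>UNIV. lam \<zeta> (\<lambda>h. lie_Ad D lam h \<xi> (t j)) * t' j x + lam \<zeta> (right_deriv (t' j) ?f) * \<xi> (t j))"
    by (subst lam_fun_mult)
      (intro smooth_near_Ad smooth_near_right_deriv S_simps sm | simp add: right_deriv_one Ad_one)+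
  also have "\<dots> = (\<Sum>j\<in>UNIV. lam \<zeta> (\<lambda>h. lie_Ad D lam h \<xi> (t j)) * t' j x) + lam \<zeta> (right_deriv \<xi> ?f)"
  proof -
    have "right_deriv \<xi> ?f = (\<lambda>q. \<Sum>j\<in>UNIV. \<xi> (t j) * right_deriv (t' j) ?f q)"
      by (rule ext, subst linear_dual_expand[OF linear_right_deriv]) simp
    then have "lam \<zeta> (right_deriv \<xi> ?f) = (\<Sum>j\<in>UNIV. lam \<zeta> (\<lambda>q. \<xi> (t j) * right_deriv (t' j) ?f q))"
      by (simp only:) (intro lam_fun_sum finite smooth_near_mult smooth_near_const smooth_near_right_deriv S_simps sm)
    also have "\<dots> = (\<Sum>j\<in>UNIV. lam \<zeta> (right_deriv (t' j) ?f) * \<xi> (t j))"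
      by (simp add: lam_fun_cmult smooth_near_right_deriv sm mult.commute)
    finally show ?thesis by (simp add: sum.distrib)
  qed
  also have "lam \<zeta> (right_deriv \<xi> ?f) = lam \<xi> (left_deriv \<zeta> ?f)"
    by (rule left_right_commute[OF sm, symmetric])
  finally have "(\<Sum>j\<in>UNIV. lam \<zeta> (\<lambda>h. lie_Ad D lam h \<xi> (t j)) * t' j x) = brs \<zeta> \<xi> x"
    using left_deriv_commutator[OF S_simps(1) sm, of \<zeta> \<xi>] unfolding left_deriv_one lam_coord by linarith
  moreover have "lam \<zeta> (\<lambda>h. lie_Ad D lam h \<xi> x) = (\<Sum>j\<in>UNIV. lam \<zeta> (\<lambda>h. lie_Ad D lam h \<xi> (t j)) * t' j x)"
  proof -
    have "lie_Ad D lam h \<xi> x = (\<Sum>j\<in>UNIV. t' j x * lie_Ad D lam h \<xi> (t j))" for h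
      using linear_vec_expand[OF blinfun.bounded_linear_right[THEN bounded_linear.linear], of "lie_Ad D lam h \<xi>" x] by simp
    then have "lam \<zeta> (\<lambda>h. lie_Ad D lam h \<xi> x) = (\<Sum>j\<in>UNIV. lam \<zeta> (\<lambda>h. t' j x * lie_Ad D lam h \<xi> (t j)))"
      by (simp only:) (intro lam_fun_sum finite smooth_near_mult smooth_near_const smooth_near_Ad S_simps)
    then show ?thesis by (simp add: lam_fun_cmult smooth_near_Ad mult.commute)
  qed
  ultimately show ?thesis by simp
qed

text \<open>Since \<open>P\<close> vanishes at the unit, the Lie derivative reduces there to the
  derivative of the bracket of \<open>coord x\<close> and \<open>coord y\<close>. For the same
  reason that derivative sees the two gradients only through their values \<open>x\<close> and
  \<open>y\<close> at the unit.\<close>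

lemma lam_P: "lam \<zeta> (\<lambda>q. P q x y) = \<zeta> (br x y)"
proof -
  let ?f = "coord x" and ?h = "coord y"
  have d: "differential A S (coord z) \<one> (lam \<xi>) = \<xi> z" for z \<xi>
    by (simp add: differential_def lam_tangent)
  have sb: "smooth_near A S \<one> (pbracket A S PiS ?f ?h)"
    using bivector smooth_near_coord S_simps(1) unfolding bivector_field_def by blast
  have one: "right_field D lam \<zeta> \<one> = lam \<zeta>" by (rule ext) (simp add: right_field_eq right_deriv_one)
  have "lie_derivative_bivec A S (right_field D lam \<zeta>) PiS ?f ?h \<one> = \<zeta> (br x y)"
    using dual_biv vector_field_right_field one smooth_near_coord d unfolding dual_bivec_def by blast
  then have "lam \<zeta> (pbracket A S PiS ?f ?h) = \<zeta> (br x y)"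
    by (simp add: lie_derivative_bivec_def one pbracket_eq P_one)
  moreover have "lam \<zeta> (pbracket A S PiS ?f ?h) = lam \<zeta> (\<lambda>q. \<Sum>i\<in>UNIV. \<Sum>j\<in>UNIV. (right_deriv (t' i) ?f q * right_deriv (t' j) ?h q) * P q (t i) (t j))"
  proof (rule lam_cong[OF sb open_UNIV UNIV_I])
    fix q assume q: "q \<in> S"
    show "pbracket A S PiS ?f ?h q = (\<Sum>i\<in>UNIV. \<Sum>j\<in>UNIV. (right_deriv (t' i) ?f q * right_deriv (t' j) ?h q) * P q (t i) (t j))"
      unfolding pbracket_eq[OF q] by (subst P_expand[OF q]) (simp add: grad)
  qed
  also have "\<dots> = (\<Sum>i\<in>UNIV. \<Sum>j\<in>UNIV. lam \<zeta> (\<lambda>q. (right_deriv (t' i) ?f q * right_deriv (t' j) ?h q) * P q (t i) (t j)))"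
    by (intro lam_fun_double_sum finite smooth_near_mult smooth_near_right_deriv S_simps smooth_near_coord smooth_near_P_one)
  also have "\<dots> = (\<Sum>i\<in>UNIV. \<Sum>j\<in>UNIV. t' i x * t' j y * lam \<zeta> (\<lambda>q. P q (t i) (t j)))"
    by (subst lam_fun_mult)
      (intro smooth_near_mult smooth_near_right_deriv S_simps smooth_near_coord smooth_near_P_one
       | simp add: P_one right_deriv_one mult.commute)+
  also have "\<dots> = lam \<zeta> (\<lambda>q. \<Sum>i\<in>UNIV. \<Sum>j\<in>UNIV. (t' i x * t' j y) * P q (t i) (t j))"
  proof -
    have "(\<Sum>i\<in>UNIV. \<Sum>j\<in>UNIV. t' i x * t' j y * lam \<zeta> (\<lambda>q. P q (t i) (t j))) =
      (\<Sum>i\<in>UNIV. \<Sum>j\<in>UNIV. lam \<zeta> (\<lambda>q. (t' i x * t' j y) * P q (t i) (t j)))"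
      by (simp add: lam_fun_cmult smooth_near_P_one)
    also have "\<dots> = lam \<zeta> (\<lambda>q. \<Sum>i\<in>UNIV. \<Sum>j\<in>UNIV. (t' i x * t' j y) * P q (t i) (t j))"
      by (rule lam_fun_double_sum[symmetric]; intro finite smooth_near_mult smooth_near_const S_simps smooth_near_P_one)
    finally show ?thesis .
  qed
  also have "\<dots> = lam \<zeta> (\<lambda>q. P q x y)"
    by (rule lam_cong[OF smooth_near_P_one open_UNIV UNIV_I, symmetric]) (rule P_expand)
  finally show ?thesis using \<open>lam \<zeta> (pbracket A S PiS ?f ?h) = \<zeta> (br x y)\<close> by simp
qed

lemma P_right_translate:
  assumes "g \<in> S" "h \<in> S"
  shows "P (h \<otimes> g) x y = (\<Sum>i\<in>UNIV. \<Sum>j\<in>UNIV. (lie_Ad D lam h (t' i) x * lie_Ad D lam h (t' j) y) * P g (t i) (t j)) + P h x y"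
  unfolding P_mult[OF assms(2,1)] by (subst P_expand[OF assms(1)]) (simp add: AdT assms)

lemma smooth_near_P_translate:
  "smooth_near A S \<one> (\<lambda>h. (\<Sum>i\<in>UNIV. \<Sum>j\<in>UNIV. (lie_Ad D lam h (t' i) x * lie_Ad D lam h (t' j) y) * P g (t i) (t j)))"
  by (intro smooth_near_sum smooth_near_mult smooth_near_const smooth_near_Ad S_simps)

text \<open>Right translation by \<open>g\<close> moves the question to the unit, where
  multiplicativity writes the translated function as \<open>P\<close> itself plus products of
  adjoint matrix coefficients with the constants \<open>P g (t i) (t j)\<close>.\<close>

lemma smooth_near_P: "g \<in> S \<Longrightarrow> smooth_near A S g (\<lambda>q. P q x y)"
proof -
  assume g: "g \<in> S"
  have "smooth_near A S \<one> (\<lambda>h. P (\<one> \<otimes> h \<otimes> g) x y)"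
    by (rule smooth_near_transform[OF smooth_near_add[OF S_simps(1) smooth_near_P_translate smooth_near_P_one] S_simps(1) open_UNIV UNIV_I])
      (simp add: P_right_translate[OF g])
  then show ?thesis
    using smooth_near_translate_iff[of \<one> \<one> g "\<lambda>q. P q x y"] g by simp
qed

text \<open>The derivative of the multiplicativity formula \<open>P\<^sub>h\<^sub>g = P\<^sub>h + Ad\<^sub>h \<cdot> P\<^sub>g\<close> in \<open>h\<close> at the unit.\<close>

lemma right_deriv_P:
  assumes g: "g \<in> S"
  shows "right_deriv \<zeta> (\<lambda>q. P q x y) g = \<zeta> (br x y) - P g (coad_dual brs \<zeta> x) y - P g x (coad_dual brs \<zeta> y)"
proof -
  let ?Q = "\<lambda>h. \<Sum>i\<in>UNIV. \<Sum>j\<in>UNIV. (lie_Ad D lam h (t' i) x * lie_Ad D lam h (t' j) y) * P g (t i) (t j)"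
  have "right_deriv \<zeta> (\<lambda>q. P q x y) g = lam \<zeta> (\<lambda>h. ?Q h + P h x y)"
    unfolding right_deriv_def
    by (rule lam_cong[symmetric, OF smooth_near_add[OF S_simps(1) smooth_near_P_translate smooth_near_P_one] open_UNIV UNIV_I])
      (simp add: P_right_translate[OF g])
  also have "\<dots> = lam \<zeta> ?Q + \<zeta> (br x y)"
    by (subst lam_fun_add[OF smooth_near_P_translate smooth_near_P_one]) (simp add: lam_P)
  also have "lam \<zeta> ?Q = (\<Sum>i\<in>UNIV. \<Sum>j\<in>UNIV. lam \<zeta> (\<lambda>h. (lie_Ad D lam h (t' i) x * lie_Ad D lam h (t' j) y) * P g (t i) (t j)))"
    by (intro lam_fun_double_sum finite smooth_near_mult smooth_near_const S_simps smooth_near_Ad)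
  also have "\<dots> = (\<Sum>i\<in>UNIV. \<Sum>j\<in>UNIV. (brs \<zeta> (t' i) x * t' j y + brs \<zeta> (t' j) y * t' i x) * P g (t i) (t j))"
  proof -
    have "lam \<zeta> (\<lambda>h. (lie_Ad D lam h (t' i) x * lie_Ad D lam h (t' j) y) * P g (t i) (t j))
       = (brs \<zeta> (t' i) x * t' j y + brs \<zeta> (t' j) y * t' i x) * P g (t i) (t j)" for i j
      by (subst lam_fun_mult)
        (intro smooth_near_mult smooth_near_const smooth_near_Ad S_simps
         | simp add: lam_const lam_fun_mult smooth_near_Ad lam_Ad_deriv Ad_one)+
    then show ?thesis by simp
  qed
  also have "\<dots> = - P g (coad_dual brs \<zeta> x) y - P g x (coad_dual brs \<zeta> y)"
    unfolding P_expand[OF g, of "coad_dual brs \<zeta> x"] P_expand[OF g, of x]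
    by (simp add: coad_dual sum_negf[symmetric] sum_subtractf[symmetric] sum.distrib[symmetric] algebra_simps)
  finally show ?thesis by simp
qed

end

section \<open>The cocycle condition and the Jacobi identity\<close>

lemma form_map_apply: "bilinear B \<Longrightarrow> blinfun_apply (form_map B x) y = B y x"
  by (simp add: form_map_def blinfun_apply_Blinfun_linear bilinear_def)

lemma coad_apply: "bilinear br \<Longrightarrow> blinfun_apply (coad br x \<eta>) y = - \<eta> (br x y)"
proof -
  assume br: "bilinear br"
  have "linear (\<lambda>y. - blinfun_apply \<eta> (br x y))"
    by (intro linearI) (simp_all add: bilinear_radd[OF br] bilinear_rmul[OF br] blinfun.add_right blinfun.scaleR_right)
  then show ?thesis by (simp add: coad_def blinfun_apply_Blinfun_linear)
qed

lemma lie_algebra_skew: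
  assumes "lie_algebra br"
  shows "br x y = - br y x"
proof -
  have b: "bilinear br" and z: "\<And>x. br x x = 0" using assms by (auto simp: lie_algebra_def)
  have "br x y + br y x = (br x x + br x y) + (br y x + br y y)"
    by (simp add: z)
  also have "\<dots> = br (x + y) (x + y)"
    by (simp only: bilinear_ladd[OF b] bilinear_radd[OF b]) (simp add: algebra_simps)
  also have "\<dots> = 0" by (rule z)
  finally show ?thesis by (simp add: eq_neg_iff_add_eq_0)
qed

section \<open>Contractions over dual bases and the cocycle condition\<close>

context dual_basis begin

text \<open>Expanding in the bases gives a double sum in which the matrix of \<open>M\<close> can be
  read by rows or by columns. An operator may thus be moved from one factor of a contraction to the
  other at the price of a transposition.\<close>

lemma contract_transpose:
  fixes h :: "'g dual \<Rightarrow> 'g \<Rightarrow> 'b::real_vector" and M :: "'g \<Rightarrow> 'g" and N :: "'g dual \<Rightarrow> 'g dual"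
  assumes h: "\<And>x. linear (\<lambda>\<xi>. h \<xi> x)" "\<And>\<xi>. linear (h \<xi>)"
    and tr: "\<And>\<xi> x. blinfun_apply \<xi> (M x) = N \<xi> x"
  shows "(\<Sum>k\<in>UNIV. h (N (t' k)) (t k)) = (\<Sum>k\<in>UNIV. h (t' k) (M (t k)))"
proof -
  have "(\<Sum>k\<in>UNIV. h (N (t' k)) (t k)) = (\<Sum>k\<in>UNIV. \<Sum>l\<in>UNIV. N (t' k) (t l) *\<^sub>R h (t' l) (t k))"
    by (rule sum.cong[OF refl]) (rule linear_dual_expand[OF h(1)])
  also have "\<dots> = (\<Sum>l\<in>UNIV. \<Sum>k\<in>UNIV. t' k (M (t l)) *\<^sub>R h (t' l) (t k))"
    by (subst sum.swap) (simp only: tr)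
  also have "\<dots> = (\<Sum>k\<in>UNIV. h (t' k) (M (t k)))"
    by (rule sum.cong[OF refl]) (rule linear_vec_expand[OF h(2), symmetric])
  finally show ?thesis .
qed

lemma trace_ad_apply:
  assumes "bilinear br"
  shows "blinfun_apply (trace_ad t t' br) x = (\<Sum>k\<in>UNIV. t' k (br x (t k)))"
proof -
  have "linear (\<lambda>x. lin_trace t t' (br x))"
    by (intro linearI)
      (simp_all add: lin_trace_def trace_def bilinear_ladd[OF assms] bilinear_lmul[OF assms]
        blinfun.add_right blinfun.scaleR_right sum.distrib sum_distrib_left)
  then show ?thesis by (simp add: trace_ad_def blinfun_apply_Blinfun_linear) (simp add: lin_trace_def trace_def)
qed

lemma trace_ad_dual_apply:
  assumes "bilinear brs"
  shows "blinfun_apply \<xi> (trace_ad_dual t t' brs) = (\<Sum>k\<in>UNIV. brs \<xi> (t' k) (t k))"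
proof -
  have "linear (\<lambda>\<xi>. lin_trace_dual t t' (brs \<xi>))"
    by (intro linearI)
      (simp_all add: lin_trace_dual_def trace_def bilinear_ladd[OF assms] bilinear_lmul[OF assms]
        blinfun.add_left blinfun.scaleR_left sum.distrib sum_distrib_left)
  from the_vec[OF this, of \<xi>] show ?thesis
    by (simp add: trace_ad_dual_def) (simp add: lin_trace_dual_def trace_def)
qed

text \<open>The cocycle identity is taken at \<open>x = t k\<close>, \<open>\<xi> = t' k\<close> and
  summed. One term on the right cancels against the left side, another collects to a bracket with
  the trace form of \<open>br\<close>, and a third to a pairing with the trace vector of
  \<open>brs\<close>.\<close>

lemma contracted_cocycle:
  assumes "lie_bialgebra br brs"
  shows "brs \<eta> (trace_ad t t' br) y = (\<Sum>k\<in>UNIV. brs (t' k) (coad br (t k) \<eta>) y) - \<eta> (br y (trace_ad_dual t t' brs))"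
proof -
  let ?a = "trace_ad_dual t t' brs" and ?\<alpha> = "trace_ad t t' br"
  have lie: "lie_algebra br" "lie_algebra brs" using assms by (simp_all add: lie_bialgebra_def)
  then have br: "bilinear br" and brs: "bilinear brs" by (simp_all add: lie_algebra_def)
  note skew = lie_algebra_skew[OF lie(1)] and skews = lie_algebra_skew[OF lie(2)]
  have coc: "brs \<xi> \<eta> (br x y) = - brs (coad br x \<xi>) \<eta> y - brs \<xi> (coad br x \<eta>) y + brs (coad br y \<xi>) \<eta> x + brs \<xi> (coad br y \<eta>) x" for \<xi> x
    using assms by (simp add: lie_bialgebra_def cobracket_def ad_tensor_def)
  have 1: "(\<Sum>k\<in>UNIV. brs (coad br (t k) (t' k)) \<eta> y) = brs ?\<alpha> \<eta> y"
  proof -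
    have eq: "?\<alpha> = (\<Sum>k\<in>UNIV. coad br (t k) (t' k))"
    proof (rule dual_eqI)
      fix l
      have "t' k (br (t l) (t k)) = coad br (t k) (t' k) (t l)" for k
        using skew[of "t l" "t k"] by (simp add: coad_apply[OF br] blinfun.minus_right)
      then show "?\<alpha> (t l) = (\<Sum>k\<in>UNIV. coad br (t k) (t' k)) (t l)"
        by (simp add: trace_ad_apply[OF br] blinfun.sum_left)
    qed
    have "linear (\<lambda>\<xi>. blinfun_apply (brs \<xi> \<eta>) y)"
      by (intro linearI) (simp_all add: bilinear_ladd[OF brs] bilinear_lmul[OF brs] blinfun.add_left blinfun.scaleR_left)
    from linear_sum[OF this, of "\<lambda>k. coad br (t k) (t' k)" UNIV] show ?thesis
      by (simp add: eq)
  qed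
  have 2: "(\<Sum>k\<in>UNIV. brs (coad br y (t' k)) \<eta> (t k)) = (\<Sum>k\<in>UNIV. brs (t' k) \<eta> (br (t k) y))"
  proof -
    have "(\<Sum>k\<in>UNIV. brs (coad br y (t' k)) \<eta> (t k)) = (\<Sum>k\<in>UNIV. brs (t' k) \<eta> (- br y (t k)))"
    proof (rule contract_transpose)
      show "linear (\<lambda>\<xi>. blinfun_apply (brs \<xi> \<eta>) x)" for x
        by (intro linearI) (simp_all add: bilinear_ladd[OF brs] bilinear_lmul[OF brs] blinfun.add_left blinfun.scaleR_left)
      show "linear (blinfun_apply (brs \<xi> \<eta>))" for \<xi>
        by (intro linearI) (simp_all add: blinfun.add_right blinfun.scaleR_right)
      show "blinfun_apply \<xi> (- br y x) = coad br y \<xi> x" for \<xi> x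
        by (simp add: coad_apply[OF br] blinfun.minus_right)
    qed
    also have "\<dots> = (\<Sum>k\<in>UNIV. brs (t' k) \<eta> (br (t k) y))" using skew[of _ y] by simp
    finally show ?thesis .
  qed
  have 3: "(\<Sum>k\<in>UNIV. brs (t' k) (coad br y \<eta>) (t k)) = \<eta> (br y ?a)"
  proof -
    have "(\<Sum>k\<in>UNIV. brs (t' k) (coad br y \<eta>) (t k)) = - (\<Sum>k\<in>UNIV. brs (coad br y \<eta>) (t' k) (t k))"
      using skews[of _ "coad br y \<eta>"] by (simp add: blinfun.minus_left sum_negf)
    also have "\<dots> = - coad br y \<eta> ?a" by (simp add: trace_ad_dual_apply[OF brs])
    finally show ?thesis by (simp add: coad_apply[OF br])
  qed
  have "(\<Sum>k\<in>UNIV. brs (t' k) \<eta> (br (t k) y)) =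
    - (\<Sum>k\<in>UNIV. brs (coad br (t k) (t' k)) \<eta> y) - (\<Sum>k\<in>UNIV. brs (t' k) (coad br (t k) \<eta>) y)
    + (\<Sum>k\<in>UNIV. brs (coad br y (t' k)) \<eta> (t k)) + (\<Sum>k\<in>UNIV. brs (t' k) (coad br y \<eta>) (t k))"
    by (simp add: coc sum_negf sum_subtractf sum.distrib)
  then have "brs ?\<alpha> \<eta> y = - (\<Sum>k\<in>UNIV. brs (t' k) (coad br (t k) \<eta>) y) + \<eta> (br y ?a)"
    unfolding 1 2 3 by linarith
  then show ?thesis using skews[of \<eta> ?\<alpha>] by (simp add: blinfun.minus_left)
qed

end

section \<open>The Jacobi identity of the bivector at a point\<close>

context pl_grp begin

lemma form_map_P: "p \<in> S \<Longrightarrow> blinfun_apply (form_map (P p) x) y = P p y x"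
  by (rule form_map_apply[OF P_bilinear])

lemma right_deriv_coord:
  assumes "p \<in> S"
  shows "smooth_near A S p (\<lambda>q. coord x (q \<otimes> inv p))" "right_deriv \<xi> (\<lambda>q. coord x (q \<otimes> inv p)) p = \<xi> x"
proof -
  show "smooth_near A S p (\<lambda>q. coord x (q \<otimes> inv p))"
    using smooth_near_translate[of p \<one> "inv p" "coord x"] assms smooth_near_coord by simp
  show "right_deriv \<xi> (\<lambda>q. coord x (q \<otimes> inv p)) p = \<xi> x"
    using assms by (simp add: right_deriv_def m_assoc)
qed

lemma right_deriv_cong:
  assumes "p \<in> S" "smooth_near A S p f" "\<And>q. q \<in> S \<Longrightarrow> f q = g q"
  shows "right_deriv u f p = right_deriv u g p"
  unfolding right_deriv_def
  by (rule lam_cong[OF smooth_near_right_translate[OF assms(1,2)] open_UNIV UNIV_I]) (use assms in auto)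

lemma right_deriv_right_deriv_expand:
  assumes "p \<in> S" "smooth_near A S p f"
  shows "right_deriv \<zeta> (right_deriv \<xi> f) p = (\<Sum>k\<in>UNIV. \<xi> (t k) * right_deriv \<zeta> (right_deriv (t' k) f) p)"
proof -
  have "right_deriv \<xi> f = (\<lambda>q. \<Sum>k\<in>UNIV. \<xi> (t k) * right_deriv (t' k) f q)"
    by (rule ext, subst linear_dual_expand[OF linear_right_deriv]) simp
  then have "right_deriv \<zeta> (right_deriv \<xi> f) p = (\<Sum>k\<in>UNIV. right_deriv \<zeta> (\<lambda>q. \<xi> (t k) * right_deriv (t' k) f q) p)"
    by (simp only:) (intro right_deriv_fun_sum finite assms smooth_near_mult smooth_near_const smooth_near_right_deriv)
  also have "\<dots> = (\<Sum>k\<in>UNIV. \<xi> (t k) * right_deriv \<zeta> (right_deriv (t' k) f) p)"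
    using assms by (intro sum.cong refl)
      (simp add: right_deriv_fun_mult smooth_near_const smooth_near_right_deriv right_deriv_def[of _ "\<lambda>q. _"] lam_const)
  finally show ?thesis .
qed

text \<open>The Leibniz rule for three factors. Contracting one gradient with \<open>P p\<close>
  turns the sum over the other index into a single iterated derivative; in the last term the
  gradients are frozen at \<open>p\<close> and only \<open>P\<close> varies.\<close>

lemma right_deriv_pbracket:
  assumes p: "p \<in> S" and f: "smooth_near A S p f" and h: "smooth_near A S p h"
  shows "right_deriv \<zeta> (pbracket A S PiS f h) p =
    right_deriv \<zeta> (right_deriv (form_map (P p) (grad h p)) f) p
    - right_deriv \<zeta> (right_deriv (form_map (P p) (grad f p)) h) p
    + right_deriv \<zeta> (\<lambda>q. P q (grad f p) (grad h p)) p"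
proof -
  let ?fi = "\<lambda>i. right_deriv (t' i) f" and ?hj = "\<lambda>j. right_deriv (t' j) h"
  note sm = smooth_near_right_deriv[OF p f] smooth_near_right_deriv[OF p h] smooth_near_P[OF p]
  have sb: "smooth_near A S p (pbracket A S PiS f h)"
    using bivector f h p unfolding bivector_field_def by blast
  have "right_deriv \<zeta> (pbracket A S PiS f h) p = right_deriv \<zeta> (\<lambda>q. \<Sum>i\<in>UNIV. \<Sum>j\<in>UNIV. (?fi i q * ?hj j q) * P q (t i) (t j)) p"
  proof (rule right_deriv_cong[OF p sb])
    fix q assume q: "q \<in> S"
    show "pbracket A S PiS f h q = (\<Sum>i\<in>UNIV. \<Sum>j\<in>UNIV. (?fi i q * ?hj j q) * P q (t i) (t j))"
      unfolding pbracket_eq[OF q] by (subst P_expand[OF q]) (simp add: grad)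
  qed
  also have "\<dots> = (\<Sum>i\<in>UNIV. right_deriv \<zeta> (\<lambda>q. \<Sum>j\<in>UNIV. (?fi i q * ?hj j q) * P q (t i) (t j)) p)"
    by (intro right_deriv_fun_sum finite p smooth_near_sum smooth_near_mult sm)
  also have "\<dots> = (\<Sum>i\<in>UNIV. \<Sum>j\<in>UNIV. right_deriv \<zeta> (\<lambda>q. (?fi i q * ?hj j q) * P q (t i) (t j)) p)"
    by (intro sum.cong refl right_deriv_fun_sum finite p smooth_near_mult sm)
  also have "\<dots> = (\<Sum>i\<in>UNIV. \<Sum>j\<in>UNIV. right_deriv \<zeta> (?fi i) p * ?hj j p * P p (t i) (t j)
      + right_deriv \<zeta> (?hj j) p * ?fi i p * P p (t i) (t j)
      + ?fi i p * ?hj j p * right_deriv \<zeta> (\<lambda>q. P q (t i) (t j)) p)"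
  proof (intro sum.cong refl)
    fix i j
    show "right_deriv \<zeta> (\<lambda>q. (?fi i q * ?hj j q) * P q (t i) (t j)) p =
      right_deriv \<zeta> (?fi i) p * ?hj j p * P p (t i) (t j) + right_deriv \<zeta> (?hj j) p * ?fi i p * P p (t i) (t j)
      + ?fi i p * ?hj j p * right_deriv \<zeta> (\<lambda>q. P q (t i) (t j)) p"
      by (simp only: right_deriv_fun_mult[OF p smooth_near_mult[OF p sm(1,2)] sm(3)] right_deriv_fun_mult[OF p sm(1,2)])
        (simp add: algebra_simps)
  qed
  also have "\<dots> = (\<Sum>i\<in>UNIV. \<Sum>j\<in>UNIV. right_deriv \<zeta> (?fi i) p * ?hj j p * P p (t i) (t j))
      + (\<Sum>i\<in>UNIV. \<Sum>j\<in>UNIV. right_deriv \<zeta> (?hj j) p * ?fi i p * P p (t i) (t j))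
      + (\<Sum>i\<in>UNIV. \<Sum>j\<in>UNIV. ?fi i p * ?hj j p * right_deriv \<zeta> (\<lambda>q. P q (t i) (t j)) p)"
    by (simp only: sum.distrib)
  also have "(\<Sum>i\<in>UNIV. \<Sum>j\<in>UNIV. right_deriv \<zeta> (?fi i) p * ?hj j p * P p (t i) (t j))
      = right_deriv \<zeta> (right_deriv (form_map (P p) (grad h p)) f) p"
  proof -
    have "(\<Sum>j\<in>UNIV. ?hj j p * P p (t i) (t j)) = form_map (P p) (grad h p) (t i)" for i
      using linear_vec_expand[of "P p (t i)" "grad h p"] P_bilinear[OF p]
      by (simp add: form_map_P[OF p] grad bilinear_def)
    then show ?thesis
      unfolding right_deriv_right_deriv_expand[OF p f, of _ "form_map (P p) (grad h p)"]
      by (intro sum.cong refl) (simp add: mult.assoc sum_distrib_left[symmetric])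
  qed
  also have "(\<Sum>i\<in>UNIV. \<Sum>j\<in>UNIV. right_deriv \<zeta> (?hj j) p * ?fi i p * P p (t i) (t j))
      = - right_deriv \<zeta> (right_deriv (form_map (P p) (grad f p)) h) p"
  proof -
    have "(\<Sum>i\<in>UNIV. ?fi i p * P p (t i) (t j)) = - form_map (P p) (grad f p) (t j)" for j
      using linear_vec_expand[of "\<lambda>x. P p x (t j)" "grad f p"] P_bilinear[OF p] P_skew[OF p, of "grad f p"]
      by (simp add: form_map_P[OF p] grad bilinear_def)
    then show ?thesis
      unfolding right_deriv_right_deriv_expand[OF p h, of _ "form_map (P p) (grad f p)"]
      by (subst sum.swap) (simp add: mult.assoc sum_distrib_left[symmetric] sum_negf[symmetric], simp add: mult.commute)
  qed
  also have "(\<Sum>i\<in>UNIV. \<Sum>j\<in>UNIV. ?fi i p * ?hj j p * right_deriv \<zeta> (\<lambda>q. P q (t i) (t j)) p)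
      = right_deriv \<zeta> (\<lambda>q. P q (grad f p) (grad h p)) p"
  proof -
    have "right_deriv \<zeta> (\<lambda>q. P q (grad f p) (grad h p)) p =
      right_deriv \<zeta> (\<lambda>q. \<Sum>i\<in>UNIV. \<Sum>j\<in>UNIV. (?fi i p * ?hj j p) * P q (t i) (t j)) p"
      by (rule right_deriv_cong[OF p sm(3)]) (subst P_expand, simp_all add: grad)
    also have "\<dots> = (\<Sum>i\<in>UNIV. right_deriv \<zeta> (\<lambda>q. \<Sum>j\<in>UNIV. (?fi i p * ?hj j p) * P q (t i) (t j)) p)"
      by (intro right_deriv_fun_sum finite p smooth_near_sum smooth_near_mult smooth_near_const sm)
    also have "\<dots> = (\<Sum>i\<in>UNIV. \<Sum>j\<in>UNIV. right_deriv \<zeta> (\<lambda>q. (?fi i p * ?hj j p) * P q (t i) (t j)) p)"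
      by (intro sum.cong refl right_deriv_fun_sum finite p smooth_near_mult smooth_near_const sm)
    also have "\<dots> = (\<Sum>i\<in>UNIV. \<Sum>j\<in>UNIV. ?fi i p * ?hj j p * right_deriv \<zeta> (\<lambda>q. P q (t i) (t j)) p)"
    proof (intro sum.cong refl)
      fix i j
      show "right_deriv \<zeta> (\<lambda>q. (?fi i p * ?hj j p) * P q (t i) (t j)) p = ?fi i p * ?hj j p * right_deriv \<zeta> (\<lambda>q. P q (t i) (t j)) p"
        by (subst right_deriv_fun_mult[OF p smooth_near_const[OF p] sm(3)])
          (simp add: right_deriv_def[of _ "\<lambda>q. _ * _"] lam_const)
    qed
    finally show ?thesis by simp
  qed
  finally show ?thesis by simp
qed

text \<open>In the cyclic sum of the Jacobi identity the second derivatives combine to commutators of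
  right-invariant vector fields.\<close>

lemma poisson_identity:
  assumes p: "p \<in> S"
  shows "P p (br x y) z + P p (br y z) x + P p (br z x) y =
    brs (form_map (P p) y) (form_map (P p) z) x + brs (form_map (P p) z) (form_map (P p) x) y
    + brs (form_map (P p) x) (form_map (P p) y) z"
proof -
  let ?c = "\<lambda>x q. coord x (q \<otimes> inv p)" and ?M = "form_map (P p)" and ?b = "pbracket A S PiS"
  note c = right_deriv_coord[OF p]
  note skews = lie_algebra_skew[OF lie_brs]
  \<comment> \<open>The translated functions have gradients exactly \<open>x\<close>,
    \<open>y\<close>, \<open>z\<close> at \<open>p\<close>, so the identity holds for arbitrary
    arguments. Their second derivatives are not controlled and have to cancel.\<close>
  have gr: "grad (?c x) p = x" for x by (rule vec_eqI) (simp add: grad c)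
  have outer: "?b (?c x) (?b (?c y) (?c z)) p = - right_deriv (?M x) (?b (?c y) (?c z)) p" for x y z
  proof -
    have "?b (?c x) (?b (?c y) (?c z)) p = - P p (grad (?b (?c y) (?c z)) p) x"
      by (simp add: pbracket_eq[OF p] gr P_skew[OF p, of x])
    then show ?thesis by (simp add: form_map_P[OF p, symmetric] grad)
  qed
  have inner: "right_deriv (?M x) (?b (?c y) (?c z)) p =
      right_deriv (?M x) (right_deriv (?M z) (?c y)) p - right_deriv (?M x) (right_deriv (?M y) (?c z)) p
      + (P p (br y z) x - brs (?M z) (?M x) y - brs (?M x) (?M y) z)" for x y z
  proof -
    have "P p (coad_dual brs (?M x) y) z = brs (?M z) (?M x) y"
      using skews[of "?M x" "?M z"] by (simp add: form_map_P[OF p, symmetric] coad_dual blinfun.minus_left)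
    moreover have "P p y (coad_dual brs (?M x) z) = brs (?M x) (?M y) z"
      using P_skew[OF p, of y] by (simp add: form_map_P[OF p, symmetric] coad_dual)
    ultimately show ?thesis
      by (simp add: right_deriv_pbracket[OF p c(1) c(1)] gr right_deriv_P[OF p] form_map_P[OF p])
  qed
  have "?b (?c x) (?b (?c y) (?c z)) p + ?b (?c y) (?b (?c z) (?c x)) p + ?b (?c z) (?b (?c x) (?c y)) p = 0"
    using poisson p c(1) unfolding poisson_bivector_def by blast
  moreover have com: "right_deriv (?M u) (right_deriv (?M v) (?c w)) p - right_deriv (?M v) (right_deriv (?M u) (?c w)) p = - brs (?M u) (?M v) w" for u v w
    using right_deriv_commutator[OF p c(1)] by (simp add: c)
  moreover have "brs (?M u) (?M v) w = - brs (?M v) (?M u) w" for u v w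
    using skews[of "?M u" "?M v"] by (simp add: blinfun.minus_left)
  ultimately show ?thesis
    unfolding outer inner using com[of x z y] com[of y x z] com[of z y x]
    by (smt (verit))
qed

end

section \<open>The adjoint orbit of the modular character\<close>

context lie_subgrp begin

text \<open>A straight segment in an ambient chart is pushed into \<open>S\<close> by
  \<open>r\<close>, which fixes its end points. Every velocity of the resulting curve is a value of
  a right-invariant field, so \<open>f\<close> is constant along it and hence locally constant on
  the connected set \<open>S\<close>.\<close>

lemma right_deriv_zero_imp_constant:
  assumes r: "\<And>q. smooth_self q r" "\<And>q. r q \<in> S" "\<And>q. q \<in> S \<Longrightarrow> r q = q"
    and conn: "connected S" and f: "\<And>g. g \<in> S \<Longrightarrow> smooth_near A S g f"
    and zero: "\<And>g u. g \<in> S \<Longrightarrow> right_deriv u f g = 0"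
    and xy: "x \<in> S" "y \<in> S"
  shows "f x = f y"
proof -
  have "\<exists>T. openin (top_of_set S) T \<and> a \<in> T \<and> (\<forall>x\<in>T. f x = f a)" if a: "a \<in> S" for a
  proof -
    obtain V \<phi> where V: "(V, \<phi>) \<in> A" "a \<in> V" by (rule chart_at)
    obtain \<epsilon> where e: "\<epsilon> > 0" "ball (\<phi> a) \<epsilon> \<subseteq> \<phi> ` V"
      using openE[OF chart_homeo(2)[OF V(1)]] V(2) by (metis imageI)
    let ?U = "\<phi> -` ball (\<phi> a) \<epsilon> \<inter> V"
    have "continuous_on V \<phi>" using chart_homeo(3)[OF V(1)] by (simp add: homeomorphism_def)
    then have oU: "open ?U"
      using continuous_on_open_vimage[OF chart_homeo(1)[OF V(1)]] open_ball by blast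
    have pr: "plot A (\<lambda>u. r (inv_into V \<phi> u)) u" if u: "u \<in> \<phi> ` V" for u
      using u smooth_selfD[OF r(1) V(1)] by (elim imageE) simp
    have "f x = f a" if x: "x \<in> S \<inter> ?U" for x
    proof -
      define l where "l = (\<lambda>s::real. \<phi> a + s *\<^sub>R (\<phi> x - \<phi> a))"
      define \<gamma> where "\<gamma> = (\<lambda>s. r (inv_into V \<phi> (l s)))"
      \<comment> \<open>An open set of parameters containing \<open>[0, 1]\<close>, so that
        two-sided derivatives exist at the end points as well.\<close>
      define J where "J = l -` ball (\<phi> a) \<epsilon>"
      have oJ: "open J" unfolding J_def l_def by (intro open_vimage continuous_intros open_ball)
      have sl: "smooth_on UNIV (\<lambda>h. l (h + s))" for s
      proof -
        have "smooth_on UNIV (\<lambda>h::real. (\<phi> a + s *\<^sub>R (\<phi> x - \<phi> a)) + h *\<^sub>R (\<phi> x - \<phi> a))"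
          by (intro smooth_on_add open_UNIV smooth_on_const smooth_on_linear bounded_linear_scaleR_left)
        then show ?thesis by (simp add: l_def algebra_simps)
      qed
      have p\<gamma>: "plot A (\<lambda>h. \<gamma> (h + s)) h" if "h + s \<in> J" for s h
        unfolding \<gamma>_def
        by (rule plot_compose[where h = "\<lambda>h. l (h + s)", OF pr open_UNIV UNIV_I sl])
          (use that e(2) in \<open>auto simp: J_def\<close>)
      have J01: "s \<in> J" if "0 \<le> s" "s \<le> 1" for s
      proof -
        have "dist (\<phi> a) (l s) = s * dist (\<phi> a) (\<phi> x)"
          using that by (simp add: l_def dist_norm norm_minus_commute)
        also have "\<dots> \<le> dist (\<phi> a) (\<phi> x)" using that by (simp add: mult_left_le_one_le)
        also have "\<dots> < \<epsilon>" using x by simp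
        finally show ?thesis by (simp add: J_def)
      qed
      have "\<exists>z. z > (0::real) \<and> z < 1 \<and> f (\<gamma> 1) - f (\<gamma> 0) = (1 - 0) * 0"
      proof (rule MVT2[where f' = "\<lambda>_. 0" and f = "\<lambda>s. f (\<gamma> s)"])
        fix s :: real assume "0 \<le> s" "s \<le> 1"
        then have s: "s \<in> J" by (rule J01)
        have \<gamma>S: "\<gamma> h \<in> S" for h unfolding \<gamma>_def by (rule r(2))
        have cv: "curve S (\<gamma> s) (\<lambda>h. \<gamma> (h + s))"
        proof (rule curveI)
          show "open ((\<lambda>h. h + s) -` J)" by (intro open_vimage oJ continuous_intros)
        qed (use s p\<gamma> \<gamma>S in auto)
        have "velocity A S (\<lambda>h. \<gamma> (h + s)) \<in> tangent_space A S (\<gamma> s)"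
          unfolding tangent_space_eq using cv by blast
        then obtain u where "velocity A S (\<lambda>h. \<gamma> (h + s)) = right_field D lam u (\<gamma> s)"
          using \<gamma>S by (rule tangent_right_fieldE)
        then have "velocity A S (\<lambda>h. \<gamma> (h + s)) f = 0"
          using zero[OF \<gamma>S] by (simp add: right_field_eq)
        then have "((\<lambda>h. f (\<gamma> (h + s))) has_real_derivative 0) (at 0)"
          using has_derivative_along_curve[OF cv f[OF \<gamma>S]] by simp
        then show "((\<lambda>s. f (\<gamma> s)) has_real_derivative 0) (at s)"
          using DERIV_shift[of "\<lambda>s. f (\<gamma> s)" 0 0 s] by simp
      qed simp
      moreover have "\<gamma> 0 = a" "\<gamma> 1 = x"
        using x a V chart_inv[OF V] chart_inv[OF V(1), of x] r(3) by (auto simp: \<gamma>_def l_def)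
      ultimately show ?thesis by auto
    qed
    moreover have "a \<in> S \<inter> ?U" using a V(2) e(1) by simp
    ultimately show ?thesis using openin_open_Int[OF oU] by blast
  qed
  from locally_constant_imp_constant[OF conn this] xy show ?thesis
    unfolding constant_on_def by metis
qed

end

section \<open>Cocycles on the dual group\<close>

context pl_grp begin

lemma form_map_P_mult:
  assumes "g \<in> S" "h \<in> S"
  shows "form_map (P (g \<otimes> h)) x = lie_Ad D lam g (form_map (P h) (AdT g x)) + form_map (P g) x"
  by (rule dual_eqI) (simp add: form_map_P assms P_mult blinfun.add_left AdT[OF assms(1), symmetric])

text \<open>\<open>lie_Ad\<close> at \<open>g\<close> is an automorphism of the dual Lie algebra, so
  it conjugates the adjoint map of \<open>\<xi>\<close> to that of its image, and the trace does not
  change.\<close>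

lemma AdT_trace_ad_dual:
  assumes g: "g \<in> S"
  shows "AdT g (trace_ad_dual t t' brs) = trace_ad_dual t t' brs"
proof (rule vec_eqI)
  fix \<xi> :: "'g dual"
  let ?Ad = "lie_Ad D lam g" and ?Ai = "lie_Ad D lam (inv g)"
  have inv: "?Ad (?Ai \<eta>) = \<eta>" "?Ai (?Ad \<eta>) = \<eta>" for \<eta>
    using Ad_mult[of g "inv g" \<eta>] Ad_mult[of "inv g" g \<eta>] g by (simp_all add: Ad_one)
  have l: "linear (\<lambda>\<eta>. blinfun_apply (?Ad (brs \<xi> \<eta>)) x)" for x
    by (intro linearI) (simp_all add: bilinear_radd[OF bilinear_brs] bilinear_rmul[OF bilinear_brs]
        linear_add[OF linear_Ad[OF g]] linear_scale[OF linear_Ad[OF g]] blinfun.add_left blinfun.scaleR_left)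
  have "\<xi> (AdT g (trace_ad_dual t t' brs)) = (\<Sum>k\<in>UNIV. brs (?Ad \<xi>) (t' k) (t k))"
    by (simp add: AdT[OF g] trace_ad_dual_apply[OF bilinear_brs])
  also have "\<dots> = (\<Sum>k\<in>UNIV. ?Ad (brs \<xi> (?Ai (t' k))) (t k))"
    by (simp add: Ad_bracket[OF g] inv)
  also have "\<dots> = (\<Sum>k\<in>UNIV. ?Ad (brs \<xi> (t' k)) (AdT (inv g) (t k)))"
    by (rule contract_transpose[OF l]) (use g in \<open>auto simp: AdT intro!: linearI simp: blinfun.add_right blinfun.scaleR_right\<close>)
  also have "\<dots> = (\<Sum>k\<in>UNIV. brs \<xi> (t' k) (t k))"
    using g by (simp add: AdT inv)
  finally show "blinfun_apply \<xi> (AdT g (trace_ad_dual t t' brs)) = \<xi> (trace_ad_dual t t' brs)"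
    by (simp add: trace_ad_dual_apply[OF bilinear_brs])
qed

text \<open>\<open>\<alpha>\<close> is not invariant; the deviation \<open>Ad\<^sub>g \<alpha> - \<alpha>\<close> and the contraction of
  the bivector on the right are \<open>1\<close>-cocycles on \<open>S\<close> with the same derivative at the unit.\<close>

lemma Ad_trace_ad:
  assumes bi: "lie_bialgebra br brs"
    and r: "\<And>q. smooth_self q r" "\<And>q. r q \<in> S" "\<And>q. q \<in> S \<Longrightarrow> r q = q"
    and conn: "connected S" and g: "g \<in> S"
  shows "lie_Ad D lam g (trace_ad t t' br) =
    trace_ad t t' br - form_map (P g) (trace_ad_dual t t' brs) + (\<Sum>k\<in>UNIV. brs (t' k) (form_map (P g) (t k)))"
proof -
  let ?a = "trace_ad_dual t t' brs" and ?\<alpha> = "trace_ad t t' br"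
  \<comment> \<open>The difference of the two sides. As \<open>w\<close> vanishes at the unit, it
    remains to prove that it is constant.\<close>
  define w where "w = (\<lambda>g. lie_Ad D lam g ?\<alpha> - ?\<alpha> + form_map (P g) ?a - (\<Sum>k\<in>UNIV. brs (t' k) (form_map (P g) (t k))))"
  have coc: "w (g \<otimes> h) = w g + lie_Ad D lam g (w h)" if gh: "g \<in> S" "h \<in> S" for g h
  proof -
    note lA = linear_add[OF linear_Ad[OF gh(1)]] linear_diff[OF linear_Ad[OF gh(1)]] linear_sum[OF linear_Ad[OF gh(1)]]
    have h1: "linear (\<lambda>\<xi>. brs \<xi> (lie_Ad D lam g (form_map (P h) x)))" for x
      by (intro linearI) (simp_all add: bilinear_ladd[OF bilinear_brs] bilinear_lmul[OF bilinear_brs])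
    have h2: "linear (\<lambda>x. brs \<xi> (lie_Ad D lam g (form_map (P h) x)))" for \<xi>
    proof -
      have "form_map (P h) (x + y) = form_map (P h) x + form_map (P h) y" "form_map (P h) (c *\<^sub>R x) = c *\<^sub>R form_map (P h) x" for x y c
        by (rule dual_eqI; simp add: form_map_P[OF gh(2)] blinfun.add_left blinfun.scaleR_left
            bilinear_radd[OF P_bilinear[OF gh(2)]] bilinear_rmul[OF P_bilinear[OF gh(2)]])+
      then show ?thesis
        by (intro linearI) (simp_all add: lA linear_scale[OF linear_Ad[OF gh(1)]] bilinear_radd[OF bilinear_brs] bilinear_rmul[OF bilinear_brs])
    qed
    \<comment> \<open>Moving the adjoint action from the vector factor to the covector factor puts
      it on both arguments of the bracket, where the automorphism property applies.\<close>
    have "(\<Sum>k\<in>UNIV. brs (t' k) (lie_Ad D lam g (form_map (P h) (AdT g (t k))))) =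
      (\<Sum>k\<in>UNIV. brs (lie_Ad D lam g (t' k)) (lie_Ad D lam g (form_map (P h) (t k))))"
      by (rule contract_transpose[OF h1 h2, symmetric]) (rule AdT[OF gh(1)])
    also have "\<dots> = lie_Ad D lam g (\<Sum>k\<in>UNIV. brs (t' k) (form_map (P h) (t k)))"
      by (simp add: lA Ad_bracket[OF gh(1)])
    finally show ?thesis
      unfolding w_def
      by (simp add: form_map_P_mult[OF gh] AdT_trace_ad_dual[OF gh(1)] Ad_mult[OF gh] lA
          bilinear_radd[OF bilinear_brs] sum.distrib)
  qed
  have w_apply: "w q x = lie_Ad D lam q ?\<alpha> x + ((- ?\<alpha> x) + (P q x ?a + (\<Sum>k\<in>UNIV. \<Sum>l\<in>UNIV. (- brs (t' k) (t' l) x) * P q (t l) (t k))))"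
    if q: "q \<in> S" for q x
  proof -
    have "brs (t' k) (form_map (P q) (t k)) x = (\<Sum>l\<in>UNIV. brs (t' k) (t' l) x * P q (t l) (t k))" for k
    proof -
      have "linear (\<lambda>\<eta>. blinfun_apply (brs (t' k) \<eta>) x)"
        by (intro linearI) (simp_all add: bilinear_radd[OF bilinear_brs] bilinear_rmul[OF bilinear_brs] blinfun.add_left blinfun.scaleR_left)
      from linear_dual_expand[OF this, of "form_map (P q) (t k)"] show ?thesis
        by (simp add: form_map_P[OF q] mult.commute)
    qed
    then show ?thesis
      by (simp add: w_def form_map_P[OF q] blinfun.add_left blinfun.diff_left blinfun.sum_left sum_negf)
  qed
  have smw: "smooth_near A S p (\<lambda>q. w q x)" if p: "p \<in> S" for p x
  proof (rule smooth_near_transform[OF _ p open_UNIV UNIV_I w_apply[symmetric]])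
    show "smooth_near A S p (\<lambda>q. lie_Ad D lam q ?\<alpha> x + ((- ?\<alpha> x) + (P q x ?a + (\<Sum>k\<in>UNIV. \<Sum>l\<in>UNIV. (- brs (t' k) (t' l) x) * P q (t l) (t k)))))"
      by (intro smooth_near_add smooth_near_mult smooth_near_sum smooth_near_const smooth_near_Ad smooth_near_P p)
  qed
  have dw: "lam \<zeta> (\<lambda>q. w q x) = 0" for \<zeta> x
  proof -
    let ?s = "\<lambda>q. \<Sum>k\<in>UNIV. \<Sum>l\<in>UNIV. (- brs (t' k) (t' l) x) * P q (t l) (t k)"
    have sms: "smooth_near A S \<one> ?s"
      by (intro smooth_near_mult smooth_near_sum smooth_near_const smooth_near_P_one S_simps)
    have br: "bilinear br" by (rule bilinear_br)
    have "lam \<zeta> (\<lambda>q. w q x) = lam \<zeta> (\<lambda>q. lie_Ad D lam q ?\<alpha> x + ((- ?\<alpha> x) + (P q x ?a + ?s q)))"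
      by (rule lam_cong[OF smw[OF S_simps(1)] open_UNIV UNIV_I]) (rule w_apply)
    also have "\<dots> = lam \<zeta> (\<lambda>q. lie_Ad D lam q ?\<alpha> x) + (lam \<zeta> (\<lambda>q. - ?\<alpha> x) + (lam \<zeta> (\<lambda>q. P q x ?a) + lam \<zeta> ?s))"
      by (simp only: lam_fun_add smooth_near_add smooth_near_const smooth_near_Ad smooth_near_P_one sms S_simps)
    also have "lam \<zeta> ?s = (\<Sum>k\<in>UNIV. \<Sum>l\<in>UNIV. lam \<zeta> (\<lambda>q. (- brs (t' k) (t' l) x) * P q (t l) (t k)))"
      by (intro lam_fun_double_sum finite smooth_near_mult smooth_near_const smooth_near_P_one S_simps)
    also have "\<dots> = - (\<Sum>k\<in>UNIV. brs (t' k) (coad br (t k) \<zeta>) x)"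
    proof -
      have "(\<Sum>l\<in>UNIV. lam \<zeta> (\<lambda>q. (- brs (t' k) (t' l) x) * P q (t l) (t k))) = - brs (t' k) (coad br (t k) \<zeta>) x" for k
      proof -
        have "linear (\<lambda>\<eta>. blinfun_apply (brs (t' k) \<eta>) x)"
          by (intro linearI) (simp_all add: bilinear_radd[OF bilinear_brs] bilinear_rmul[OF bilinear_brs] blinfun.add_left blinfun.scaleR_left)
        from linear_dual_expand[OF this, of "coad br (t k) \<zeta>"]
        have "brs (t' k) (coad br (t k) \<zeta>) x = (\<Sum>l\<in>UNIV. \<zeta> (br (t l) (t k)) * brs (t' k) (t' l) x)"
          using lie_algebra_skew[OF lie_br, of "t k"] by (simp add: coad_apply[OF br] blinfun.minus_right)
        moreover have "lam \<zeta> (\<lambda>q. (- brs (t' k) (t' l) x) * P q (t l) (t k)) = - (\<zeta> (br (t l) (t k)) * brs (t' k) (t' l) x)" for l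
          by (subst lam_fun_cmult[OF smooth_near_P_one]) (simp add: lam_P)
        ultimately show ?thesis by (simp add: sum_negf)
      qed
      then show ?thesis by (simp add: sum_negf)
    qed
    finally show ?thesis
      by (simp add: lam_Ad_deriv lam_const lam_P contracted_cocycle[OF bi])
  qed
  \<comment> \<open>A right-invariant derivative at \<open>p\<close> is the left-invariant one along
    \<open>?u\<close>. By the cocycle rule it is a linear combination of derivatives of
    \<open>w\<close> at the unit.\<close>
  have zero: "right_deriv \<zeta> (\<lambda>q. w q x) p = 0" if p: "p \<in> S" for p \<zeta> x
  proof -
    let ?u = "lie_Ad D lam (inv p) \<zeta>"
    have u: "lie_Ad D lam p ?u = \<zeta>" using Ad_mult[of p "inv p" \<zeta>] p by (simp add: Ad_one)
    have ex: "w (p \<otimes> q) x = w p x + (\<Sum>k\<in>UNIV. lie_Ad D lam p (t' k) x * w q (t k))" if q: "q \<in> S" for q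
      unfolding coc[OF p q] blinfun.add_left
      by (subst linear_dual_expand[OF linear_Ad_apply[OF p, of x], of "w q"]) (simp add: mult.commute)
    have "right_deriv \<zeta> (\<lambda>q. w q x) p = lam ?u (\<lambda>q. w (p \<otimes> q) x)"
      using left_field_right_field[OF p, of ?u "\<lambda>q. w q x"] u by simp
    also have "\<dots> = lam ?u (\<lambda>q. w p x + (\<Sum>k\<in>UNIV. lie_Ad D lam p (t' k) x * w q (t k)))"
      by (rule lam_cong[symmetric, OF _ open_UNIV UNIV_I])
       (intro smooth_near_add smooth_near_sum smooth_near_mult smooth_near_const smw S_simps, rule ex[symmetric])
    also have "\<dots> = lam ?u (\<lambda>q. w p x) + lam ?u (\<lambda>q. \<Sum>k\<in>UNIV. lie_Ad D lam p (t' k) x * w q (t k))"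
      by (intro lam_fun_add smooth_near_sum smooth_near_mult smooth_near_const smw S_simps)
    also have "lam ?u (\<lambda>q. \<Sum>k\<in>UNIV. lie_Ad D lam p (t' k) x * w q (t k)) = (\<Sum>k\<in>UNIV. lam ?u (\<lambda>q. lie_Ad D lam p (t' k) x * w q (t k)))"
      by (intro lam_fun_sum finite smooth_near_mult smooth_near_const smw S_simps)
    also have "\<dots> = 0"
      by (simp add: lam_fun_cmult[OF smw[OF S_simps(1)]] dw)
    finally show ?thesis by (simp add: lam_const)
  qed
  have "w g x = w \<one> x" for x
    by (rule right_deriv_zero_imp_constant[where f = "\<lambda>q. w q x", OF r conn smw zero g S_simps(1)])
  moreover have "w \<one> x = 0" for x
    by (subst w_apply) (simp_all add: Ad_one P_one)
  ultimately have "w g = 0" by (intro dual_eqI) simp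
  then show ?thesis by (simp add: w_def algebra_simps)
qed

end

section \<open>Linear algebra at a point\<close>

context dual_basis begin

text \<open>Both sides are the same double sum over the matrix of \<open>R\<close>. Replacing
  \<open>R\<close> by its transpose thus amounts to exchanging the arguments of \<open>h\<close>,
  which makes a symmetric \<open>R\<close> invisible to a skew \<open>h\<close>.\<close>

lemma contract_flip:
  fixes h :: "'g \<Rightarrow> 'g \<Rightarrow> real" and R RT :: "'g dual \<Rightarrow> 'g"
  assumes h: "bilinear h" and tr: "\<And>\<xi> \<eta>. blinfun_apply \<eta> (R \<xi>) = \<xi> (RT \<eta>)"
  shows "(\<Sum>k\<in>UNIV. h (R (t' k)) (t k)) = (\<Sum>k\<in>UNIV. h (t k) (RT (t' k)))"
proof -
  have l: "linear (\<lambda>x. h x y)" "linear (h x)" for x y using h by (auto simp: bilinear_def)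
  have "(\<Sum>k\<in>UNIV. h (R (t' k)) (t k)) = (\<Sum>k\<in>UNIV. \<Sum>l\<in>UNIV. t' l (R (t' k)) *\<^sub>R h (t l) (t k))"
    by (rule sum.cong[OF refl]) (rule linear_vec_expand[OF l(1)])
  also have "\<dots> = (\<Sum>l\<in>UNIV. \<Sum>k\<in>UNIV. t' k (RT (t' l)) *\<^sub>R h (t l) (t k))"
    by (subst sum.swap) (simp only: tr)
  also have "\<dots> = (\<Sum>k\<in>UNIV. h (t k) (RT (t' k)))"
    by (rule sum.cong[OF refl]) (rule linear_vec_expand[OF l(2), symmetric])
  finally show ?thesis .
qed

lemma contract_sym_skew:
  fixes h :: "'g \<Rightarrow> 'g \<Rightarrow> real" and R :: "'g dual \<Rightarrow> 'g"
  assumes h: "bilinear h" "\<And>x y. h x y = - h y x" and R: "\<And>\<xi> \<eta>. blinfun_apply \<eta> (R \<xi>) = \<xi> (R \<eta>)"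
  shows "(\<Sum>k\<in>UNIV. h (R (t' k)) (t k)) = 0"
proof -
  have "(\<Sum>k\<in>UNIV. h (R (t' k)) (t k)) = (\<Sum>k\<in>UNIV. - h (R (t' k)) (t k))"
    unfolding contract_flip[OF h(1) R] using h(2) by (intro sum.cong refl) metis
  then show ?thesis by (simp add: sum_negf)
qed

text \<open>Reading the components of \<open>L x\<close> as a vector of \<open>'g\<close> gives an
  endomorphism \<open>?T\<close>, for which injectivity implies surjectivity in finite
  dimension.\<close>

lemma linear_bij_dual:
  fixes L :: "'g \<Rightarrow> 'g dual"
  assumes L: "linear L" and inj: "\<And>x. L x = 0 \<Longrightarrow> x = 0"
  shows "inv_into UNIV L (L x) = x" "L (inv_into UNIV L \<xi>) = \<xi>"
proof -
  have i: "inj L" using linear_injective_0[OF L] inj by blast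
  then show "inv_into UNIV L (L x) = x" by simp
  let ?T = "\<lambda>x. \<Sum>k\<in>UNIV. L x (t k) *\<^sub>R t k"
  have tT: "t' l (?T x) = L x (t l)" for l x
    by (simp add: blinfun.sum_right blinfun.scaleR_right if_distrib[of "(*) _"] cong: if_cong)
  have "linear ?T"
    by (intro linearI) (simp_all add: linear_add[OF L] linear_scale[OF L] blinfun.add_left blinfun.scaleR_left
        scaleR_add_left sum.distrib scaleR_sum_right)
  moreover have "inj ?T"
  proof (rule injI)
    fix x y assume "?T x = ?T y"
    then have "L x (t l) = L y (t l)" for l using tT by metis
    then have "L x = L y" by (rule dual_eqI)
    then show "x = y" using i by (simp add: inj_eq)
  qed
  ultimately have "surj ?T" by (rule linear_inj_imp_surj)
  from surjD[OF this, of "\<Sum>k\<in>UNIV. \<xi> (t k) *\<^sub>R t k"]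
  obtain x where x: "(\<Sum>k\<in>UNIV. \<xi> (t k) *\<^sub>R t k) = ?T x" by (elim exE)
  have "L x = \<xi>"
  proof (rule dual_eqI)
    fix l
    have "L x (t l) = t' l (\<Sum>k\<in>UNIV. \<xi> (t k) *\<^sub>R t k)" by (simp only: x tT)
    then show "L x (t l) = \<xi> (t l)"
      by (simp add: blinfun.sum_right blinfun.scaleR_right if_distrib[of "(*) _"] cong: if_cong)
  qed
  then show "L (inv_into UNIV L \<xi>) = \<xi>" by (metis f_inv_into_f rangeI)
qed

end

lemma linear_form_map: "bilinear B \<Longrightarrow> linear (form_map B)"
  by (intro linearI blinfun_eqI)
    (simp_all add: form_map_apply bilinear_radd bilinear_rmul blinfun.add_left blinfun.scaleR_left)

lemma dpair_linear: "dpair u (a *\<^sub>R v + b *\<^sub>R w) = a * dpair u v + b * dpair u w"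
  by (cases u; cases v; cases w)
    (simp add: blinfun.add_right blinfun.scaleR_right blinfun.add_left blinfun.scaleR_left algebra_simps)

text \<open>The group has disappeared: at a fixed point only the form \<open>P\<close> is kept, with
  the Jacobi identity as an algebraic relation between \<open>P\<close> and the two
  brackets.\<close>

locale point_data = dual_basis t t'
  for t :: "'n::finite \<Rightarrow> 'g::euclidean_space" and t' :: "'n \<Rightarrow> 'g dual" +
  fixes br :: "'g \<Rightarrow> 'g \<Rightarrow> 'g" and brs :: "'g dual \<Rightarrow> 'g dual \<Rightarrow> 'g dual"
    and g0 B0 P :: "'g \<Rightarrow> 'g \<Rightarrow> real"
  assumes lie_br: "lie_algebra br" and lie_brs: "lie_algebra brs"
    and g0: "pos_def_form g0" and B0: "skew_form B0" and P: "skew_form P"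
    and jacobi: "P (br x y) z + P (br y z) x + P (br z x) y =
      brs (form_map P y) (form_map P z) x + brs (form_map P z) (form_map P x) y + brs (form_map P x) (form_map P y) z"
begin

abbreviation "g0m \<equiv> form_map g0"
abbreviation "B0m \<equiv> form_map B0"
abbreviation "Pm \<equiv> form_map P"
abbreviation "E \<equiv> E_tilde g0 B0 P"
abbreviation "gt \<equiv> sym_part E"
abbreviation "Bt \<equiv> skew_part E"

text \<open>\<open>LT\<close> and \<open>ET\<close> are the transposes of \<open>L\<close> and \<open>E\<close>.\<close>

definition L :: "'g \<Rightarrow> 'g dual" where "L x = g0m x + B0m x + Pm x"
definition LT :: "'g \<Rightarrow> 'g dual" where "LT x = g0m x - B0m x - Pm x"
definition ginv :: "'g dual \<Rightarrow> 'g" where "ginv = inv_into UNIV g0m"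
definition ET :: "'g dual \<Rightarrow> 'g" where "ET \<xi> = gt \<xi> - Bt \<xi>"

lemma bil: "bilinear br" "bilinear brs" "bilinear g0" "bilinear B0" "bilinear P"
  using lie_br lie_brs g0 B0 P by (simp_all add: lie_algebra_def pos_def_form_def skew_form_def)

lemma forms: "g0 x y = g0 y x" "B0 x y = - B0 y x" "P x y = - P y x"
  using g0 B0 P unfolding pos_def_form_def skew_form_def by blast+

lemmas maps_apply = bil(3)[THEN form_map_apply] bil(4)[THEN form_map_apply] bil(5)[THEN form_map_apply]

lemma maps_linear: "linear g0m" "linear B0m" "linear Pm" "linear L" "linear LT"
  using linear_form_map[OF bil(3)] linear_form_map[OF bil(4)] linear_form_map[OF bil(5)]
  by (auto simp: linear_iff L_def LT_def algebra_simps)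

lemma L_apply: "L x y = LT y x"
  using forms(1)[of x y] forms(2)[of x y] forms(3)[of x y]
  by (simp add: L_def LT_def maps_apply blinfun.add_left blinfun.diff_left)

text \<open>On the diagonal the two skew forms drop out and the positive definite \<open>g0\<close>
  alone decides; this makes \<open>E\<close> a genuine inverse at every point.\<close>

lemma L_inj: "L x = 0 \<Longrightarrow> x = 0"
proof -
  assume "L x = 0"
  then have "L x x = 0" by simp
  then have "g0 x x = 0"
    using forms(2)[of x x] forms(3)[of x x] by (simp add: L_def maps_apply blinfun.add_left)
  then show "x = 0" using g0 unfolding pos_def_form_def by force
qed

lemma E_eq: "E = inv_into UNIV L"
  by (simp add: E_tilde_def L_def[abs_def])

lemma E_L [simp]: "E (L x) = x" and L_E [simp]: "L (E \<xi>) = \<xi>"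
  unfolding E_eq using linear_bij_dual[OF maps_linear(4) L_inj] by simp_all

lemma g0m_inj: "g0m x = 0 \<Longrightarrow> x = 0"
proof -
  assume "g0m x = 0"
  then have "g0m x x = 0" by simp
  then show "x = 0" using g0 unfolding pos_def_form_def maps_apply by force
qed

lemma ginv_g0m [simp]: "ginv (g0m x) = x" and g0m_ginv [simp]: "g0m (ginv \<xi>) = \<xi>"
  unfolding ginv_def using linear_bij_dual[OF maps_linear(1) g0m_inj] by simp_all

lemma linear_E: "linear E"
proof (rule linearI)
  show "E (x + y) = E x + E y" for x y
    by (metis E_L L_E linear_add[OF maps_linear(4)])
  show "E (c *\<^sub>R x) = c *\<^sub>R E x" for c x
    by (metis E_L L_E linear_scale[OF maps_linear(4)])
qed

lemma linear_ginv: "linear ginv"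
proof (rule linearI)
  show "ginv (x + y) = ginv x + ginv y" for x y
    by (metis ginv_g0m g0m_ginv linear_add[OF maps_linear(1)])
  show "ginv (c *\<^sub>R x) = c *\<^sub>R ginv x" for c x
    by (metis ginv_g0m g0m_ginv linear_scale[OF maps_linear(1)])
qed

lemma gt_apply: "blinfun_apply \<eta> (gt \<xi>) = (\<eta> (E \<xi>) + \<xi> (E \<eta>)) / 2"
proof -
  have "linear (\<lambda>\<eta>. (blinfun_apply \<eta> (E \<xi>) + \<xi> (E \<eta>)) / 2)"
    by (intro linearI) (simp_all add: linear_add[OF linear_E] linear_scale[OF linear_E]
      blinfun.add_right blinfun.scaleR_right blinfun.add_left blinfun.scaleR_left algebra_simps add_divide_distrib diff_divide_distrib)
  then show ?thesis unfolding sym_part_def by (rule the_vec)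
qed

lemma Bt_apply: "blinfun_apply \<eta> (Bt \<xi>) = (\<eta> (E \<xi>) - \<xi> (E \<eta>)) / 2"
proof -
  have "linear (\<lambda>\<eta>. (blinfun_apply \<eta> (E \<xi>) - \<xi> (E \<eta>)) / 2)"
    by (intro linearI) (simp_all add: linear_add[OF linear_E] linear_scale[OF linear_E]
      blinfun.add_right blinfun.scaleR_right blinfun.add_left blinfun.scaleR_left algebra_simps add_divide_distrib diff_divide_distrib)
  then show ?thesis unfolding skew_part_def by (rule the_vec)
qed

lemma gt_sym: "blinfun_apply \<eta> (gt \<xi>) = \<xi> (gt \<eta>)" and Bt_skew: "blinfun_apply \<eta> (Bt \<xi>) = - \<xi> (Bt \<eta>)"
  by (simp_all add: gt_apply Bt_apply field_simps)

lemma E_decomp: "E \<xi> = gt \<xi> + Bt \<xi>"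
  by (rule vec_eqI) (simp add: blinfun.add_right gt_apply Bt_apply field_simps)

lemma ET_apply: "blinfun_apply \<eta> (ET \<xi>) = \<xi> (E \<eta>)"
  by (simp add: ET_def blinfun.diff_right gt_apply Bt_apply field_simps)

lemma linear_Bt: "linear Bt" and linear_ET: "linear ET"
  by (intro linearI vec_eqI; simp add: blinfun.add_right blinfun.scaleR_right gt_apply Bt_apply ET_apply
      linear_add[OF linear_E] linear_scale[OF linear_E] blinfun.add_left blinfun.scaleR_left field_simps)+

lemma LT_ET [simp]: "LT (ET \<xi>) = \<xi>"
  by (rule dual_eqI) (simp add: L_apply[symmetric] ET_apply)

lemma ET_LT [simp]: "ET (LT x) = x"
  by (rule vec_eqI) (simp add: ET_apply L_apply[symmetric])

lemma ginv_sym: "blinfun_apply \<eta> (ginv \<xi>) = \<xi> (ginv \<eta>)"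
proof -
  have "\<eta> (ginv \<xi>) = g0m (ginv \<eta>) (ginv \<xi>)" by simp
  also have "\<dots> = g0m (ginv \<xi>) (ginv \<eta>)" using forms(1) by (simp only: maps_apply)
  finally show ?thesis by simp
qed

lemma L_plus_LT: "L x + LT x = 2 *\<^sub>R g0m x"
  by (simp add: L_def LT_def scaleR_2)

lemmas lin_simps =
  bilinear_ladd[OF bil(1)] bilinear_radd[OF bil(1)] bilinear_lmul[OF bil(1)] bilinear_rmul[OF bil(1)]
  bilinear_ladd[OF bil(2)] bilinear_radd[OF bil(2)] bilinear_lmul[OF bil(2)] bilinear_rmul[OF bil(2)]
  bilinear_ladd[OF bil(5)] bilinear_radd[OF bil(5)] bilinear_lmul[OF bil(5)] bilinear_rmul[OF bil(5)]
  maps_linear[THEN linear_add] maps_linear[THEN linear_scale]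
  linear_E[THEN linear_add] linear_E[THEN linear_scale]
  linear_ET[THEN linear_add] linear_ET[THEN linear_scale]
  linear_Bt[THEN linear_add] linear_Bt[THEN linear_scale]
  linear_ginv[THEN linear_add] linear_ginv[THEN linear_scale]
  blinfun.add_right blinfun.scaleR_right blinfun.add_left blinfun.scaleR_left

text \<open>This combines \<open>2 gt = E + ET\<close> with \<open>L + LT = 2 g0\<close>: applying
  \<open>L\<close> to \<open>2 gt \<xi>\<close> gives \<open>\<xi> + L (ET \<xi>)\<close>, in which
  \<open>\<xi>\<close> equals \<open>LT (ET \<xi>)\<close>.\<close>

lemma gt_eq: "L (gt \<xi>) = g0m (ET \<xi>)" "LT (gt \<xi>) = g0m (E \<xi>)"
proof -
  have gt2: "gt \<xi> = (1/2) *\<^sub>R (E \<xi> + ET \<xi>)"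
    by (rule vec_eqI) (simp add: blinfun.add_right blinfun.scaleR_right gt_apply ET_apply)
  have "L (gt \<xi>) = (1/2) *\<^sub>R (\<xi> + L (ET \<xi>))" "LT (gt \<xi>) = (1/2) *\<^sub>R (LT (E \<xi>) + \<xi>)"
    unfolding gt2 by (simp_all only: maps_linear[THEN linear_add] maps_linear[THEN linear_scale] L_E LT_ET)
  moreover have "\<xi> + L (ET \<xi>) = 2 *\<^sub>R g0m (ET \<xi>)" "LT (E \<xi>) + \<xi> = 2 *\<^sub>R g0m (E \<xi>)"
    using L_plus_LT[of "ET \<xi>"] L_plus_LT[of "E \<xi>"] by (simp_all add: add.commute)
  ultimately show "L (gt \<xi>) = g0m (ET \<xi>)" "LT (gt \<xi>) = g0m (E \<xi>)"
    by simp_all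
qed

text \<open>With the third slot filled, the coadjoint terms of \<open>dbr\<close> become values of
  the two brackets, and the later computations are carried out with real numbers only.\<close>

definition T3 :: "'g double \<Rightarrow> 'g double \<Rightarrow> 'g double \<Rightarrow> real" where
  "T3 u v w = dpair (dbr br brs u v) w"

lemma T3_apply:
  "T3 (x, \<xi>) (y, \<upsilon>) (z, \<eta>) =
    \<xi> (br y z) - \<upsilon> (br x z) + \<eta> (br x y) + brs \<upsilon> \<eta> x - brs \<xi> \<eta> y + brs \<xi> \<upsilon> z"
  by (simp add: T3_def coad_dual_apply[OF bil(2)] coad_apply[OF bil(1)] blinfun.add_right blinfun.diff_right
      blinfun.add_left blinfun.diff_left)

lemma T3_linear3: "T3 u v (a *\<^sub>R w + b *\<^sub>R w') = a * T3 u v w + b * T3 u v w'"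
  by (simp add: T3_def dpair_linear)

lemma T3_skew: "T3 u v w = - T3 v u w"
  using lie_algebra_skew[OF lie_br, of "fst u" "fst v"] lie_algebra_skew[OF lie_brs, of "snd u" "snd v"]
  by (cases u; cases v; cases w) (simp add: T3_apply blinfun.minus_right blinfun.minus_left)

text \<open>\<open>xp x\<close> and \<open>xm x\<close> are the images under \<open>e\<^sup>B\<^sup>0\<close> of the elements of
  \<open>E\<^sub>+\<close> and \<open>E\<^sub>-\<close> over \<open>x\<close>, so that all brackets can be taken in the double itself.\<close>

definition xp :: "'g \<Rightarrow> 'g double" where "xp x = (x, g0m x + B0m x)"
definition xm :: "'g \<Rightarrow> 'g double" where "xm x = (x, B0m x - g0m x)"

text \<open>By skewness of \<open>B0\<close> the adjoint of \<open>e^{-B0}\<close> for the pairing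
  is \<open>e^{B0}\<close>. The modified bracket therefore never has to be computed; it is the
  original one with all three arguments shifted.\<close>

lemma exp_B_form_skew: "dpair (exp_B (\<lambda>x y. - B0 x y) u) w = dpair u (exp_B B0 w)"
proof -
  have "bilinear (\<lambda>x y. - B0 x y)"
    using bil(4) by (auto simp: bilinear_def linear_iff)
  then show ?thesis
    using forms(2)[of "fst u" "fst w"]
    by (cases u; cases w) (simp add: form_map_apply maps_apply blinfun.add_left)
qed

lemma dpair_dbr': "dpair (dbr' br brs B0 u v) w = T3 (exp_B B0 u) (exp_B B0 v) (exp_B B0 w)"
  by (simp add: dbr'_def exp_B_form_skew T3_def)

lemma pr_plus_eq: "pr_plus g0 (x, \<xi>) = ((1/2) *\<^sub>R (x + ginv \<xi>), g0m ((1/2) *\<^sub>R (x + ginv \<xi>)))"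
  unfolding pr_plus_def
proof (rule the_equality)
  \<comment> \<open>Solving \<open>(x, \<xi>) = (y, g0 y) + (x - y, - g0 (x - y))\<close> for
    \<open>y\<close> leads to \<open>2 g0 y = g0 x + \<xi>\<close>.\<close>
  let ?y = "(1/2) *\<^sub>R (x + ginv \<xi>)"
  have "2 *\<^sub>R g0m ?y = g0m x + \<xi>"
    by (simp only: maps_linear[THEN linear_add] maps_linear[THEN linear_scale] g0m_ginv) simp
  moreover have "u - v = - (w - v)" if "2 *\<^sub>R v = w + u" for u v w :: "'g dual"
    using that by (simp add: scaleR_2 diff_eq_eq) (simp add: algebra_simps)
  ultimately have "\<xi> - g0m ?y = - g0m (x - ?y)"
    unfolding linear_diff[OF maps_linear(1)] by blast
  then show "(?y, g0m ?y) \<in> E_plus g0 \<and> (x, \<xi>) - (?y, g0m ?y) \<in> E_minus g0"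
    unfolding E_plus_def E_minus_def minus_prod_def fst_conv snd_conv by blast
  fix a assume a: "a \<in> E_plus g0 \<and> (x, \<xi>) - a \<in> E_minus g0"
  then obtain y where y: "a = (y, g0m y)" by (auto simp: E_plus_def)
  with a have "\<xi> - g0m y = - g0m (x - y)" by (auto simp: E_minus_def)
  then have "\<xi> = g0m (2 *\<^sub>R y - x)"
    by (simp add: maps_linear[THEN linear_add] linear_diff[OF maps_linear(1)] scaleR_2 algebra_simps)
  then have "ginv \<xi> = 2 *\<^sub>R y - x" by simp
  then have "y = ?y" by simp
  with y show "a = (?y, g0m ?y)" by simp
qed

lemma pr_minus_eq: "pr_minus g0 (x, \<xi>) = ((1/2) *\<^sub>R (x - ginv \<xi>), - g0m ((1/2) *\<^sub>R (x - ginv \<xi>)))"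
  unfolding pr_minus_def
proof (rule the_equality)
  let ?y = "(1/2) *\<^sub>R (x - ginv \<xi>)"
  have "2 *\<^sub>R g0m ?y = g0m x - \<xi>"
    by (simp only: maps_linear[THEN linear_diff] maps_linear[THEN linear_scale] g0m_ginv) simp
  moreover have "u - - v = w - v" if "2 *\<^sub>R v = w - u" for u v w :: "'g dual"
    using that by (simp add: scaleR_2 eq_diff_eq) (simp add: algebra_simps)
  ultimately have "\<xi> - - g0m ?y = g0m (x - ?y)"
    unfolding linear_diff[OF maps_linear(1)] by blast
  then show "(?y, - g0m ?y) \<in> E_minus g0 \<and> (x, \<xi>) - (?y, - g0m ?y) \<in> E_plus g0"
    unfolding E_plus_def E_minus_def minus_prod_def fst_conv snd_conv by blast
  fix a assume a: "a \<in> E_minus g0 \<and> (x, \<xi>) - a \<in> E_plus g0"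
  then obtain y where y: "a = (y, - g0m y)" by (auto simp: E_minus_def)
  with a have "\<xi> + g0m y = g0m (x - y)" by (auto simp: E_plus_def)
  then have "\<xi> = g0m (x - 2 *\<^sub>R y)"
    by (simp add: maps_linear[THEN linear_add] linear_diff[OF maps_linear(1)] scaleR_2 algebra_simps)
  then have "ginv \<xi> = x - 2 *\<^sub>R y" by simp
  then have "y = ?y" by simp
  with y show "a = (?y, - g0m ?y)" by simp
qed

lemma exp_pr_plus: "exp_B B0 (pr_plus g0 (x, \<xi>)) = xp ((1/2) *\<^sub>R (x + ginv \<xi>))"
  by (simp add: pr_plus_eq xp_def)

lemma exp_pr_minus: "exp_B B0 (pr_minus g0 (x, \<xi>)) = xm ((1/2) *\<^sub>R (x - ginv \<xi>))"
  by (simp add: pr_minus_eq xm_def)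

lemma xp_linear: "xp (a *\<^sub>R x + b *\<^sub>R y) = a *\<^sub>R xp x + b *\<^sub>R xp y"
  and xm_linear: "xm (a *\<^sub>R x + b *\<^sub>R y) = a *\<^sub>R xm x + b *\<^sub>R xm y"
  by (simp_all add: xp_def xm_def lin_simps algebra_simps)

definition pp :: "'g double \<Rightarrow> 'g double" where "pp u = exp_B B0 (pr_plus g0 u)"
definition pm :: "'g double \<Rightarrow> 'g double" where "pm u = exp_B B0 (pr_minus g0 u)"

lemma pp_linear: "pp (a *\<^sub>R u + b *\<^sub>R v) = a *\<^sub>R pp u + b *\<^sub>R pp v"
proof (cases u; cases v)
  fix x \<xi> y \<eta> assume "u = (x, \<xi>)" "v = (y, \<eta>)"
  moreover have "(1/2) *\<^sub>R ((a *\<^sub>R x + b *\<^sub>R y) + ginv (a *\<^sub>R \<xi> + b *\<^sub>R \<eta>)) =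
    a *\<^sub>R ((1/2) *\<^sub>R (x + ginv \<xi>)) + b *\<^sub>R ((1/2) *\<^sub>R (y + ginv \<eta>))"
    by (simp add: lin_simps algebra_simps)
  ultimately show ?thesis by (simp only: pp_def scaleR_Pair add_Pair exp_pr_plus xp_linear)
qed

lemma pm_linear: "pm (a *\<^sub>R u + b *\<^sub>R v) = a *\<^sub>R pm u + b *\<^sub>R pm v"
proof (cases u; cases v)
  fix x \<xi> y \<eta> assume "u = (x, \<xi>)" "v = (y, \<eta>)"
  moreover have "(1/2) *\<^sub>R ((a *\<^sub>R x + b *\<^sub>R y) - ginv (a *\<^sub>R \<xi> + b *\<^sub>R \<eta>)) =
    a *\<^sub>R ((1/2) *\<^sub>R (x - ginv \<xi>)) + b *\<^sub>R ((1/2) *\<^sub>R (y - ginv \<eta>))"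
    by (simp add: lin_simps algebra_simps)
  ultimately show ?thesis by (simp only: pm_def scaleR_Pair add_Pair exp_pr_minus xm_linear)
qed

text \<open>Nondegeneracy of the pairing makes the description by which \<open>nabla0\<close> is
  defined meaningful for every linear functional.\<close>

lemma dual_double: 
  fixes F :: "'g double \<Rightarrow> real"
  assumes F: "\<And>a b u v. F (a *\<^sub>R u + b *\<^sub>R v) = a * F u + b * F v"
  shows "dpair (THE z. \<forall>w. dpair z w = F w) w = F w"
proof -
  have add: "F (u + v) = F u + F v" and sc: "F (a *\<^sub>R u) = a * F u" for u v a
    using F[of 1 u 1 v] F[of a u 0 u] by simp_all
  let ?z = "(vec_of (\<lambda>\<eta>. F (0, \<eta>)), Blinfun (\<lambda>y. F (y, 0)))"
  have l: "linear (\<lambda>\<eta>. F (0, \<eta>))" "linear (\<lambda>y. F (y, 0))"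
    by (intro linearI; simp add: add[symmetric] sc[symmetric])+
  have z: "dpair ?z w = F w" for w
    by (cases w) (simp add: vec_of[OF l(1)] blinfun_apply_Blinfun_linear[OF l(2)] add[symmetric])
  have "(THE z. \<forall>w. dpair z w = F w) = ?z"
  proof (rule the_equality)
    fix u assume "\<forall>w. dpair u w = F w"
    then have e: "dpair u w = dpair ?z w" for w using z by metis
    obtain x \<xi> where u: "u = (x, \<xi>)" by (cases u)
    have "x = fst ?z" by (rule vec_eqI) (use e[of "(0, _)"] u in simp)
    moreover have "\<xi> = snd ?z" by (rule blinfun_eqI) (use e[of "(_, 0)"] u in simp)
    ultimately show "u = ?z" by (simp add: u)
  qed (use z in blast)
  with z show ?thesis by simp
qed

lemma dpair_nabla0:
  "dpair (nabla0 br brs g0 B0 u v) w =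
    - T3 (pp u) (pm v) (pm w) - T3 (pm u) (pp v) (pp w) - T3 (pp u) (pp v) (pp w) / 3 - T3 (pm u) (pm v) (pm w) / 3"
  unfolding nabla0_def dpair_dbr' pp_def[symmetric] pm_def[symmetric]
  by (rule dual_double) (simp add: pp_linear pm_linear T3_linear3 field_simps)

text \<open>Writing \<open>x\<close> as \<open>ginv (g0m x)\<close> lets the two components of
  \<open>j_map\<close> combine to \<open>LT x\<close> in the plus part and to \<open>L x\<close> in
  the minus part.\<close>

lemma j_split:
  "pp (j_map B0 P x) = xp ((1/2) *\<^sub>R ginv (LT x))" "pm (j_map B0 P x) = xm ((1/2) *\<^sub>R ginv (L x))"
proof -
  have "x + ginv (- (Pm x + B0m x)) = ginv (g0m x) + ginv (- (Pm x + B0m x))" by simp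
  also have "\<dots> = ginv (LT x)"
    unfolding linear_add[OF linear_ginv, symmetric] by (simp add: LT_def algebra_simps)
  finally show "pp (j_map B0 P x) = xp ((1/2) *\<^sub>R ginv (LT x))"
    by (simp add: j_map_def pp_def exp_pr_plus)
  have "x - ginv (- (Pm x + B0m x)) = ginv (g0m x) - ginv (- (Pm x + B0m x))" by simp
  also have "\<dots> = ginv (L x)"
    unfolding linear_diff[OF linear_ginv, symmetric] by (simp add: L_def algebra_simps)
  finally show "pm (j_map B0 P x) = xm ((1/2) *\<^sub>R ginv (L x))"
    by (simp add: j_map_def pm_def exp_pr_minus)
qed

text \<open>On the range of \<open>gt\<close> the factor \<open>ginv\<close> cancels against the
  \<open>g0m\<close> produced by \<open>gt_eq\<close>, leaving \<open>E\<close> in one part and its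
  transpose in the other.\<close>

lemma j_gt: "pp (j_map B0 P (gt \<xi>)) = xp ((1/2) *\<^sub>R E \<xi>)" "pm (j_map B0 P (gt \<xi>)) = xm ((1/2) *\<^sub>R ET \<xi>)"
  by (simp_all add: j_split gt_eq)

end

section \<open>The connection form\<close>

context point_data begin

lemma T3_lin [simp]:
  "T3 (u + u') v w = T3 u v w + T3 u' v w" "T3 (a *\<^sub>R u) v w = a * T3 u v w"
  "T3 u (v + v') w = T3 u v w + T3 u v' w" "T3 u (a *\<^sub>R v) w = a * T3 u v w"
  "T3 u v (w + w') = T3 u v w + T3 u v w'" "T3 u v (a *\<^sub>R w) = a * T3 u v w"
  by (cases u; cases u'; cases v; cases v'; cases w; cases w'; simp add: T3_apply lin_simps algebra_simps)+

lemma xp_lin [simp]: "xp (x + y) = xp x + xp y" "xp (a *\<^sub>R x) = a *\<^sub>R xp x"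
  and xm_lin [simp]: "xm (x + y) = xm x + xm y" "xm (a *\<^sub>R x) = a *\<^sub>R xm x"
  by (simp_all add: xp_def xm_def lin_simps algebra_simps)

text \<open>The operator \<open>E \<circ> LT \<circ> ginv\<close>, rewritten by means of
  \<open>LT = 2 g0 - L\<close>.\<close>

definition K :: "'g dual \<Rightarrow> 'g" where "K \<xi> = 2 *\<^sub>R E \<xi> - ginv \<xi>"
definition KT :: "'g dual \<Rightarrow> 'g" where "KT \<xi> = 2 *\<^sub>R ET \<xi> - ginv \<xi>"

lemma K_transpose: "blinfun_apply \<eta> (KT \<xi>) = \<xi> (K \<eta>)"
  using ginv_sym[of \<eta> \<xi>] by (simp add: K_def KT_def blinfun.diff_right blinfun.scaleR_right ET_apply)

lemma E_LT_ginv: "E (LT (ginv \<xi>)) = K \<xi>"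
proof -
  have "LT (ginv \<xi>) = 2 *\<^sub>R \<xi> - L (ginv \<xi>)"
    using L_plus_LT[of "ginv \<xi>"] by (simp add: eq_diff_eq add.commute)
  then show ?thesis by (simp add: K_def linear_diff[OF linear_E] linear_scale[OF linear_E])
qed

lemma ET_L_ginv: "ET (L (ginv \<xi>)) = KT \<xi>"
proof -
  have "L (ginv \<xi>) = 2 *\<^sub>R \<xi> - LT (ginv \<xi>)"
    using L_plus_LT[of "ginv \<xi>"] by (simp add: eq_diff_eq)
  then show ?thesis by (simp add: KT_def linear_diff[OF linear_ET] linear_scale[OF linear_ET])
qed

lemma transpose_ginv_L: "blinfun_apply \<xi> (ginv (L x)) = LT (ginv \<xi>) x"
  and transpose_ginv_LT: "blinfun_apply \<xi> (ginv (LT x)) = L (ginv \<xi>) x"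
  using ginv_sym[of \<xi> "L x"] ginv_sym[of \<xi> "LT x"] L_apply[of x "ginv \<xi>"] L_apply[of "ginv \<xi>" x] by simp_all

text \<open>The factor \<open>ginv \<circ> L\<close> on the vector side is transposed to
  \<open>LT \<circ> ginv\<close> on the covector side, where it meets \<open>E\<close> and produces
  \<open>K\<close>.\<close>

lemma contract_xp_xm:
  "(\<Sum>k\<in>UNIV. T3 (xp (E (t' k))) (xm (ginv (L (t k)))) w) = (\<Sum>k\<in>UNIV. T3 (xp (K (t' k))) (xm (t k)) w)"
proof -
  have "(\<Sum>k\<in>UNIV. T3 (xp (E (LT (ginv (t' k))))) (xm (t k)) w) = (\<Sum>k\<in>UNIV. T3 (xp (E (t' k))) (xm (ginv (L (t k)))) w)"
    by (rule contract_transpose[where h = "\<lambda>\<xi> y. T3 (xp (E \<xi>)) (xm y) w" and N = "\<lambda>\<xi>. LT (ginv \<xi>)" and M = "\<lambda>x. ginv (L x)"])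
      (simp_all add: linear_iff linear_add[OF linear_E] linear_scale[OF linear_E] transpose_ginv_L)
  then show ?thesis by (simp add: E_LT_ginv)
qed

text \<open>Here the transposition produces \<open>KT\<close>. Flipping the contraction turns it
  into \<open>K\<close>, and skewness of \<open>T3\<close> restores the order of the arguments, so
  both mixed terms of \<open>nabla0\<close> lead to one and the same sum.\<close>

lemma contract_xm_xp:
  "(\<Sum>k\<in>UNIV. T3 (xm (ET (t' k))) (xp (ginv (LT (t k)))) w) = - (\<Sum>k\<in>UNIV. T3 (xp (K (t' k))) (xm (t k)) w)"
proof -
  have "(\<Sum>k\<in>UNIV. T3 (xm (ET (t' k))) (xp (ginv (LT (t k)))) w) = (\<Sum>k\<in>UNIV. T3 (xm (ET (L (ginv (t' k))))) (xp (t k)) w)"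
    by (rule contract_transpose[symmetric, where h = "\<lambda>\<xi> y. T3 (xm (ET \<xi>)) (xp y) w" and N = "\<lambda>\<xi>. L (ginv \<xi>)" and M = "\<lambda>x. ginv (LT x)"])
      (simp_all add: linear_iff linear_add[OF linear_ET] linear_scale[OF linear_ET] transpose_ginv_LT)
  also have "\<dots> = (\<Sum>k\<in>UNIV. T3 (xm (t k)) (xp (K (t' k))) w)"
    unfolding ET_L_ginv
    by (rule contract_flip[where h = "\<lambda>x y. T3 (xm x) (xp y) w"]) (simp_all add: bilinear_def linear_iff K_transpose)
  also have "\<dots> = - (\<Sum>k\<in>UNIV. T3 (xp (K (t' k))) (xm (t k)) w)"
    unfolding sum_negf[symmetric] by (rule sum.cong[OF refl]) (rule T3_skew)
  finally show ?thesis .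
qed

text \<open>After the transposition \<open>E\<close> meets \<open>L \<circ> ginv\<close>, and only
  the symmetric \<open>ginv\<close> remains in the contraction.\<close>

lemma contract_xp_xp: "(\<Sum>k\<in>UNIV. T3 (xp (E (t' k))) (xp (ginv (LT (t k)))) w) = 0"
proof -
  have "(\<Sum>k\<in>UNIV. T3 (xp (E (t' k))) (xp (ginv (LT (t k)))) w) = (\<Sum>k\<in>UNIV. T3 (xp (E (L (ginv (t' k))))) (xp (t k)) w)"
    by (rule contract_transpose[symmetric, where h = "\<lambda>\<xi> y. T3 (xp (E \<xi>)) (xp y) w" and N = "\<lambda>\<xi>. L (ginv \<xi>)" and M = "\<lambda>x. ginv (LT x)"])
      (simp_all add: linear_iff linear_add[OF linear_E] linear_scale[OF linear_E] transpose_ginv_LT)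
  also have "\<dots> = 0"
    unfolding E_L
    by (rule contract_sym_skew[where h = "\<lambda>x y. T3 (xp x) (xp y) w"], simp add: bilinear_def linear_iff, rule T3_skew, rule ginv_sym)
  finally show ?thesis .
qed

lemma contract_xm_xm: "(\<Sum>k\<in>UNIV. T3 (xm (ET (t' k))) (xm (ginv (L (t k)))) w) = 0"
proof -
  have "(\<Sum>k\<in>UNIV. T3 (xm (ET (t' k))) (xm (ginv (L (t k)))) w) = (\<Sum>k\<in>UNIV. T3 (xm (ET (LT (ginv (t' k))))) (xm (t k)) w)"
    by (rule contract_transpose[symmetric, where h = "\<lambda>\<xi> y. T3 (xm (ET \<xi>)) (xm y) w" and N = "\<lambda>\<xi>. LT (ginv \<xi>)" and M = "\<lambda>x. ginv (L x)"])
      (simp_all add: linear_iff linear_add[OF linear_ET] linear_scale[OF linear_ET] transpose_ginv_L)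
  also have "\<dots> = 0"
    unfolding ET_LT
    by (rule contract_sym_skew[where h = "\<lambda>x y. T3 (xm x) (xm y) w"], simp add: bilinear_def linear_iff, rule T3_skew, rule ginv_sym)
  finally show ?thesis .
qed

text \<open>The equations \<open>L (E \<zeta>) = \<zeta>\<close> and
  \<open>LT (ET \<zeta>) = \<zeta>\<close> remove \<open>g0\<close> and \<open>B0\<close> from the
  second components, so the difference of the two vectors is expressed by \<open>\<zeta>\<close>,
  \<open>P\<close> and \<open>Bt\<close> alone.\<close>

lemma xm_ET_xp_E: "xm (ET \<zeta>) = xp (E \<zeta>) + (-2) *\<^sub>R (Bt \<zeta>, \<zeta> - Pm (Bt \<zeta>))"
proof -
  have B: "2 *\<^sub>R Bt \<zeta> = E \<zeta> - ET \<zeta>"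
    by (rule vec_eqI) (simp add: blinfun.diff_right blinfun.scaleR_right Bt_apply ET_apply)
  have a: "B0m (ET \<zeta>) - g0m (ET \<zeta>) = - \<zeta> - Pm (ET \<zeta>)"
  proof -
    have "g0m (ET \<zeta>) - B0m (ET \<zeta>) = \<zeta> + Pm (ET \<zeta>)"
      using LT_ET[of \<zeta>] unfolding LT_def by (simp add: diff_eq_eq)
    then have "- (g0m (ET \<zeta>) - B0m (ET \<zeta>)) = - (\<zeta> + Pm (ET \<zeta>))" by simp
    then show ?thesis by simp
  qed
  have b: "g0m (E \<zeta>) + B0m (E \<zeta>) = \<zeta> - Pm (E \<zeta>)"
    using L_E[of \<zeta>] unfolding L_def by (simp add: eq_diff_eq)
  have c: "2 *\<^sub>R Pm (Bt \<zeta>) = Pm (E \<zeta>) - Pm (ET \<zeta>)"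
    unfolding linear_scale[OF maps_linear(3), symmetric] B by (rule linear_diff[OF maps_linear(3)])
  have "ET \<zeta> = E \<zeta> + (-2) *\<^sub>R Bt \<zeta>" using B by simp
  moreover have "- \<zeta> - Pm (ET \<zeta>) = (\<zeta> - Pm (E \<zeta>)) + (-2) *\<^sub>R (\<zeta> - Pm (Bt \<zeta>))"
    using c by (simp add: algebra_simps scaleR_2)
  ultimately show ?thesis
    unfolding xp_def xm_def a b by simp
qed

definition W :: "'g dual \<Rightarrow> real" where
  "W \<zeta> = (\<Sum>k\<in>UNIV. dpair (nabla0 br brs g0 B0 (j_map B0 P (gt (t' k))) (j_map B0 P (t k))) (j_map B0 P (gt \<zeta>)))"

text \<open>The three halves in \<open>j_gt\<close> and \<open>j_split\<close> give
  \<open>1/8\<close>, and \<open>1/24\<close> for the two terms with coefficient \<open>1/3\<close>.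
  The mixed terms evaluate one sum at \<open>xm (ET \<zeta>)\<close> and
  \<open>xp (E \<zeta>)\<close> with opposite signs; the difference supplies a factor
  \<open>2\<close>, and \<open>1/4\<close> remains.\<close>

lemma W_eq: "W \<zeta> = (\<Sum>k\<in>UNIV. T3 (xp (K (t' k))) (xm (t k)) (Bt \<zeta>, \<zeta> - Pm (Bt \<zeta>))) / 4"
proof -
  let ?S = "\<lambda>w. \<Sum>k\<in>UNIV. T3 (xp (K (t' k))) (xm (t k)) w"
  have "W \<zeta> = - (\<Sum>k\<in>UNIV. T3 (xp (E (t' k))) (xm (ginv (L (t k)))) (xm (ET \<zeta>))) / 8
    - (\<Sum>k\<in>UNIV. T3 (xm (ET (t' k))) (xp (ginv (LT (t k)))) (xp (E \<zeta>))) / 8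
    - (\<Sum>k\<in>UNIV. T3 (xp (E (t' k))) (xp (ginv (LT (t k)))) (xp (E \<zeta>))) / 24
    - (\<Sum>k\<in>UNIV. T3 (xm (ET (t' k))) (xm (ginv (L (t k)))) (xm (ET \<zeta>))) / 24"
    unfolding W_def dpair_nabla0 j_gt j_split
    by (simp add: gt_eq sum_subtractf sum_negf sum_divide_distrib)
  also have "\<dots> = - (?S (xm (ET \<zeta>)) - ?S (xp (E \<zeta>))) / 8"
    unfolding contract_xp_xm contract_xm_xp contract_xp_xp contract_xm_xm by simp
  also have "?S (xm (ET \<zeta>)) = ?S (xp (E \<zeta>)) - 2 * ?S (Bt \<zeta>, \<zeta> - Pm (Bt \<zeta>))"
    unfolding xm_ET_xp_E T3_lin sum.distrib sum_distrib_left[symmetric] by simp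
  finally show ?thesis by simp
qed

section \<open>Evaluation of the contractions with \<open>ginv\<close> and \<open>E\<close>\<close>

abbreviation "\<alpha> \<equiv> trace_ad t t' br"
abbreviation "\<a> \<equiv> trace_ad_dual t t' brs"

lemma skews: "br x y = - br y x" "brs \<xi> \<upsilon> = - brs \<upsilon> \<xi>"
  using lie_algebra_skew lie_br lie_brs by blast+

lemma trace_left: "(\<Sum>k\<in>UNIV. t' k (br (t k) x)) = - \<alpha> x"
  using skews(1)[of _ x] by (simp add: trace_ad_apply[OF bil(1)] blinfun.minus_right sum_negf)

lemma trace_dual_left: "(\<Sum>k\<in>UNIV. brs (t' k) \<xi> (t k)) = - \<xi> \<a>"
  using skews(2)[of _ \<xi>] by (simp add: trace_ad_dual_apply[OF bil(2)] blinfun.minus_left sum_negf)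

text \<open>Cancelling \<open>g0\<close> against \<open>ginv\<close> leaves traces of adjoint maps;
  terms skew in the two contracted arguments vanish since \<open>ginv\<close> is symmetric; the
  terms with a single \<open>B0\<close> cancel in pairs or combine to the last sum.\<close>

lemma contract_ginv_sum:
  "(\<Sum>k\<in>UNIV. T3 (xp (ginv (t' k))) (xm (t k)) (z, \<eta>)) =
    - 2 * \<alpha> z + 2 * \<eta> \<a> + 2 * (\<Sum>k\<in>UNIV. brs (t' k) (B0m (t k)) z)"
proof -
  have flip: "(\<Sum>k\<in>UNIV. h (ginv (t' k)) (t k)) = (\<Sum>k\<in>UNIV. h (t k) (ginv (t' k)))" if "bilinear h" for h :: "'g \<Rightarrow> 'g \<Rightarrow> real"
    by (rule contract_flip[OF that ginv_sym])
  have zero: "(\<Sum>k\<in>UNIV. h (ginv (t' k)) (t k)) = 0" if "bilinear h" "\<And>x y. h x y = - h y x" for h :: "'g \<Rightarrow> 'g \<Rightarrow> real"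
    by (rule contract_sym_skew[OF that ginv_sym])
  have 1: "(\<Sum>k\<in>UNIV. g0m (t k) (br (ginv (t' k)) z)) = - \<alpha> z"
    by (subst flip[where h = "\<lambda>x y. g0m y (br x z)"]) (simp_all add: bilinear_def linear_iff lin_simps trace_left)
  have 2: "(\<Sum>k\<in>UNIV. B0m (t k) (br (ginv (t' k)) z)) = (\<Sum>k\<in>UNIV. B0m (ginv (t' k)) (br (t k) z))"
    by (rule flip[where h = "\<lambda>x y. B0m y (br x z)"]) (simp add: bilinear_def linear_iff lin_simps)
  have 3: "(\<Sum>k\<in>UNIV. \<eta> (br (ginv (t' k)) (t k))) = 0"
    by (rule zero[where h = "\<lambda>x y. \<eta> (br x y)"], simp add: bilinear_def linear_iff lin_simps)
      (use skews(1) in \<open>metis blinfun.minus_right\<close>)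
  have 4: "(\<Sum>k\<in>UNIV. brs (g0m (t k)) \<eta> (ginv (t' k))) = - \<eta> \<a>"
    by (subst flip[where h = "\<lambda>x y. brs (g0m y) \<eta> x"]) (simp_all add: bilinear_def linear_iff lin_simps trace_dual_left)
  have 5: "(\<Sum>k\<in>UNIV. brs (B0m (t k)) \<eta> (ginv (t' k))) = (\<Sum>k\<in>UNIV. brs (B0m (ginv (t' k))) \<eta> (t k))"
    by (rule flip[where h = "\<lambda>x y. brs (B0m y) \<eta> x"]) (simp add: bilinear_def linear_iff lin_simps)
  have 6: "(\<Sum>k\<in>UNIV. brs (g0m (ginv (t' k))) (g0m (t k)) z) = 0"
    by (rule zero[where h = "\<lambda>x y. brs (g0m x) (g0m y) z"], simp add: bilinear_def linear_iff lin_simps)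
      (use skews(2) in \<open>metis blinfun.minus_left\<close>)
  have 7: "(\<Sum>k\<in>UNIV. brs (B0m (ginv (t' k))) (B0m (t k)) z) = 0"
    by (rule zero[where h = "\<lambda>x y. brs (B0m x) (B0m y) z"], simp add: bilinear_def linear_iff lin_simps)
      (use skews(2) in \<open>metis blinfun.minus_left\<close>)
  have 8: "(\<Sum>k\<in>UNIV. brs (B0m (ginv (t' k))) (g0m (t k)) z) = - (\<Sum>k\<in>UNIV. brs (t' k) (B0m (t k)) z)"
  proof -
    have "(\<Sum>k\<in>UNIV. brs (B0m (ginv (t' k))) (g0m (t k)) z) = (\<Sum>k\<in>UNIV. brs (B0m (t k)) (g0m (ginv (t' k))) z)"
      by (rule flip[where h = "\<lambda>x y. brs (B0m x) (g0m y) z"]) (simp add: bilinear_def linear_iff lin_simps)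
    also have "\<dots> = (\<Sum>k\<in>UNIV. - brs (t' k) (B0m (t k)) z)"
      by (rule sum.cong[OF refl]) (simp add: skews(2)[of "B0m _"] blinfun.minus_left)
    finally show ?thesis by (simp add: sum_negf)
  qed
  have "(\<Sum>k\<in>UNIV. T3 (xp (ginv (t' k))) (xm (t k)) (z, \<eta>)) =
    (\<Sum>k\<in>UNIV. t' k (br (t k) z)) + (\<Sum>k\<in>UNIV. B0m (ginv (t' k)) (br (t k) z))
    - (\<Sum>k\<in>UNIV. B0m (t k) (br (ginv (t' k)) z)) + (\<Sum>k\<in>UNIV. g0m (t k) (br (ginv (t' k)) z))
    + (\<Sum>k\<in>UNIV. \<eta> (br (ginv (t' k)) (t k)))
    + (\<Sum>k\<in>UNIV. brs (B0m (t k)) \<eta> (ginv (t' k))) - (\<Sum>k\<in>UNIV. brs (g0m (t k)) \<eta> (ginv (t' k)))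
    - (\<Sum>k\<in>UNIV. brs (t' k) \<eta> (t k)) - (\<Sum>k\<in>UNIV. brs (B0m (ginv (t' k))) \<eta> (t k))
    + (\<Sum>k\<in>UNIV. brs (t' k) (B0m (t k)) z) - (\<Sum>k\<in>UNIV. brs (g0m (ginv (t' k))) (g0m (t k)) z)
    + (\<Sum>k\<in>UNIV. brs (B0m (ginv (t' k))) (B0m (t k)) z) - (\<Sum>k\<in>UNIV. brs (B0m (ginv (t' k))) (g0m (t k)) z)"
    unfolding xp_def xm_def T3_apply sum.distrib[symmetric] sum_subtractf[symmetric] g0m_ginv
    by (rule sum.cong[OF refl])
      (simp add: blinfun.add_left blinfun.diff_left bilinear_ladd[OF bil(2)] bilinear_rsub[OF bil(2)] bilinear_lsub[OF bil(2)])
  then show ?thesis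
    unfolding 1 2 3 4 5 6 7 8 trace_left trace_dual_left by simp
qed

text \<open>With \<open>M = g0 - B0\<close> the equations for \<open>E\<close> and its transpose
  read \<open>g0 E + B0 E = id - P E\<close> and \<open>M ET = id + P ET\<close>. They eliminate
  \<open>g0\<close> and leave a single sum with \<open>B0\<close>; \<open>E\<close> itself survives
  only as \<open>E - ET\<close> or against a skew form, hence through \<open>Bt\<close>.\<close>

lemma contract_E_sum:
  "(\<Sum>k\<in>UNIV. T3 (xp (E (t' k))) (xm (t k)) (z, \<eta>)) =
    - 2 * \<alpha> z + 2 * \<eta> \<a> - 2 * (\<Sum>k\<in>UNIV. P (br (t k) z) (Bt (t' k)))
    + (\<Sum>k\<in>UNIV. \<eta> (br (Bt (t' k)) (t k))) + 2 * (\<Sum>k\<in>UNIV. brs (Pm (Bt (t' k))) \<eta> (t k))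
    + (\<Sum>k\<in>UNIV. brs (t' k) (B0m (t k)) z) + (\<Sum>k\<in>UNIV. brs (Pm (t k)) (t' k) z)
    + (\<Sum>k\<in>UNIV. brs (Pm (Bt (t' k))) (Pm (t k)) z)"
proof -
  define M where "M = (\<lambda>x. g0m x - B0m x)"
  have M_lin: "linear M" by (simp add: M_def linear_iff lin_simps algebra_simps)
  have M_ET: "M (ET \<xi>) = \<xi> + Pm (ET \<xi>)" for \<xi>
    using LT_ET[of \<xi>] by (simp add: M_def LT_def diff_eq_eq)
  have E0: "g0m (E \<xi>) + B0m (E \<xi>) = \<xi> - Pm (E \<xi>)" for \<xi>
    using L_E[of \<xi>] by (simp add: L_def eq_diff_eq)
  note lins = lin_simps M_lin[THEN linear_add] M_lin[THEN linear_scale]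
  have flip: "(\<Sum>k\<in>UNIV. h (E (t' k)) (t k)) = (\<Sum>k\<in>UNIV. h (t k) (ET (t' k)))" if "bilinear h" for h :: "'g \<Rightarrow> 'g \<Rightarrow> real"
    by (rule contract_flip[OF that ET_apply[symmetric]])
  have half: "(\<Sum>k\<in>UNIV. h (E (t' k)) (t k)) = (\<Sum>k\<in>UNIV. h (Bt (t' k)) (t k))" if "bilinear h" "\<And>x y. h x y = - h y x" for h :: "'g \<Rightarrow> 'g \<Rightarrow> real"
    using contract_sym_skew[OF that gt_sym] by (simp add: E_decomp bilinear_ladd[OF that(1)] sum.distrib)
  have 1: "(\<Sum>k\<in>UNIV. M (t k) (br (E (t' k)) z)) = - \<alpha> z + (\<Sum>k\<in>UNIV. P (br (t k) z) (ET (t' k)))"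
    by (subst flip[where h = "\<lambda>x y. M y (br x z)"])
      (simp_all add: bilinear_def linear_iff lins M_ET sum.distrib trace_left maps_apply)
  have 2: "(\<Sum>k\<in>UNIV. \<eta> (br (E (t' k)) (t k))) = (\<Sum>k\<in>UNIV. \<eta> (br (Bt (t' k)) (t k)))"
    by (rule half[where h = "\<lambda>x y. \<eta> (br x y)"], simp add: bilinear_def linear_iff lin_simps)
      (use skews(1) in \<open>metis blinfun.minus_right\<close>)
  have 3: "(\<Sum>k\<in>UNIV. brs (M (t k)) \<eta> (E (t' k))) = - \<eta> \<a> + (\<Sum>k\<in>UNIV. brs (Pm (ET (t' k))) \<eta> (t k))"
    by (subst flip[where h = "\<lambda>x y. brs (M y) \<eta> x"])
      (simp_all add: bilinear_def linear_iff lins M_ET sum.distrib trace_dual_left)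
  have 4: "(\<Sum>k\<in>UNIV. brs (Pm (E (t' k))) (M (t k)) z) = (\<Sum>k\<in>UNIV. brs (Pm (t k)) (t' k) z) + (\<Sum>k\<in>UNIV. brs (Pm (Bt (t' k))) (Pm (t k)) z)"
  proof -
    have "(\<Sum>k\<in>UNIV. brs (Pm (E (t' k))) (M (t k)) z) = (\<Sum>k\<in>UNIV. brs (Pm (t k)) (t' k) z) + (\<Sum>k\<in>UNIV. brs (Pm (t k)) (Pm (ET (t' k))) z)"
      by (subst flip[where h = "\<lambda>x y. brs (Pm x) (M y) z"])
        (simp_all add: bilinear_def linear_iff lins M_ET sum.distrib)
    also have "(\<Sum>k\<in>UNIV. brs (Pm (t k)) (Pm (ET (t' k))) z) = (\<Sum>k\<in>UNIV. brs (Pm (E (t' k))) (Pm (t k)) z)"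
      by (rule flip[symmetric, where h = "\<lambda>x y. brs (Pm x) (Pm y) z"]) (simp add: bilinear_def linear_iff lins)
    also have "\<dots> = (\<Sum>k\<in>UNIV. brs (Pm (Bt (t' k))) (Pm (t k)) z)"
      by (rule half[where h = "\<lambda>x y. brs (Pm x) (Pm y) z"], simp add: bilinear_def linear_iff lins)
        (use skews(2) in \<open>metis blinfun.minus_left\<close>)
    finally show ?thesis .
  qed
  have 5: "(\<Sum>k\<in>UNIV. brs (t' k) (M (t k)) z) = - (\<Sum>k\<in>UNIV. brs (t' k) (B0m (t k)) z)"
  proof -
    have "(\<Sum>k\<in>UNIV. brs (g0m (ginv (t' k))) (g0m (t k)) z) = 0"
      by (rule contract_sym_skew[where h = "\<lambda>x y. brs (g0m x) (g0m y) z", OF _ _ ginv_sym], simp add: bilinear_def linear_iff lin_simps)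
        (use skews(2) in \<open>metis blinfun.minus_left\<close>)
    then show ?thesis
      by (simp add: M_def bilinear_rsub[OF bil(2)] blinfun.diff_left sum_subtractf)
  qed
  have EET: "E \<xi> - ET \<xi> = 2 *\<^sub>R Bt \<xi>" for \<xi>
    by (simp add: ET_def E_decomp scaleR_2)
  have 6: "(\<Sum>k\<in>UNIV. P (br (t k) z) (E (t' k))) - (\<Sum>k\<in>UNIV. P (br (t k) z) (ET (t' k))) = 2 * (\<Sum>k\<in>UNIV. P (br (t k) z) (Bt (t' k)))"
    unfolding sum_subtractf[symmetric] bilinear_rsub[OF bil(5), symmetric] EET
    by (simp add: bilinear_rmul[OF bil(5)] sum_distrib_left)
  have 7: "(\<Sum>k\<in>UNIV. brs (Pm (E (t' k))) \<eta> (t k)) - (\<Sum>k\<in>UNIV. brs (Pm (ET (t' k))) \<eta> (t k)) = 2 * (\<Sum>k\<in>UNIV. brs (Pm (Bt (t' k))) \<eta> (t k))"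
    unfolding sum_subtractf[symmetric] blinfun.diff_left[symmetric] bilinear_lsub[OF bil(2), symmetric] linear_diff[OF maps_linear(3), symmetric] EET
    by (simp add: lin_simps sum_distrib_left)
  have "(\<Sum>k\<in>UNIV. T3 (xp (E (t' k))) (xm (t k)) (z, \<eta>)) =
    (\<Sum>k\<in>UNIV. t' k (br (t k) z)) - (\<Sum>k\<in>UNIV. P (br (t k) z) (E (t' k)))
    + (\<Sum>k\<in>UNIV. M (t k) (br (E (t' k)) z)) + (\<Sum>k\<in>UNIV. \<eta> (br (E (t' k)) (t k)))
    - (\<Sum>k\<in>UNIV. brs (M (t k)) \<eta> (E (t' k)))
    - (\<Sum>k\<in>UNIV. brs (t' k) \<eta> (t k)) + (\<Sum>k\<in>UNIV. brs (Pm (E (t' k))) \<eta> (t k))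
    - (\<Sum>k\<in>UNIV. brs (t' k) (M (t k)) z) + (\<Sum>k\<in>UNIV. brs (Pm (E (t' k))) (M (t k)) z)"
    unfolding xp_def xm_def T3_apply sum.distrib[symmetric] sum_subtractf[symmetric] E0 M_def
    by (rule sum.cong[OF refl])
      (simp add: maps_apply blinfun.add_left blinfun.diff_left bilinear_lsub[OF bil(2)] bilinear_rsub[OF bil(2)])
  then show ?thesis
    using 6 7 unfolding 1 2 3 4 5 trace_left trace_dual_left by simp
qed

lemma contract_Bt:
  fixes h :: "'g \<Rightarrow> 'g \<Rightarrow> real"
  assumes "bilinear h"
  shows "(\<Sum>k\<in>UNIV. h (Bt (t' k)) (t k)) = - (\<Sum>k\<in>UNIV. h (t k) (Bt (t' k)))"
proof -
  have "blinfun_apply \<eta> (Bt \<xi>) = \<xi> (- Bt \<eta>)" for \<xi> \<eta> using Bt_skew[of \<eta> \<xi>] by (simp add: blinfun.minus_right)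
  from contract_flip[OF assms this] show ?thesis by (simp add: bilinear_rneg[OF assms] sum_negf)
qed

text \<open>By \<open>K = 2 E - ginv\<close> the two preceding sums enter with weights
  \<open>2\<close> and \<open>-1\<close>, exactly those for which the sums with \<open>B0\<close>
  cancel. The remaining combination of \<open>X1\<close> to \<open>X4\<close>, in which
  \<open>P\<close> and \<open>Bt \<zeta>\<close> occur together, is zero by the Jacobi
  identity.\<close>

lemma W_formula:
  "W \<zeta> = (1/2) * (\<Sum>k\<in>UNIV. \<zeta> (br (Bt (t' k)) (t k))) + (\<Sum>k\<in>UNIV. \<zeta> (coad_dual brs (Pm (t k)) (Bt (t' k))))
    + (1/2) * (\<zeta> \<a> - (\<alpha> - Pm \<a> + (\<Sum>k\<in>UNIV. brs (t' k) (Pm (t k)))) (Bt \<zeta>))"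
proof -
  let ?z = "Bt \<zeta>" let ?\<eta> = "\<zeta> - Pm ?z"
  note flip = contract_Bt
  define X1 where "X1 = (\<Sum>k\<in>UNIV. P (br (Bt (t' k)) (t k)) ?z)"
  define X2 where "X2 = (\<Sum>k\<in>UNIV. P (br (t k) ?z) (Bt (t' k)))"
  define X3 where "X3 = (\<Sum>k\<in>UNIV. brs (Pm (Bt (t' k))) (Pm ?z) (t k))"
  define X4 where "X4 = (\<Sum>k\<in>UNIV. brs (Pm (Bt (t' k))) (Pm (t k)) ?z)"
  \<comment> \<open>The identity for \<open>Bt (t' k)\<close>, \<open>t k\<close> and
    \<open>Bt \<zeta>\<close>, summed over \<open>k\<close>. Skewness of \<open>Bt\<close> and of
    the brackets makes two of the three cyclic terms on each side coincide.\<close>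
  have jac: "X1 + 2 * X2 = X4 - 2 * X3"
  proof -
    have "(\<Sum>k\<in>UNIV. P (br (Bt (t' k)) (t k)) ?z + P (br (t k) ?z) (Bt (t' k)) + P (br ?z (Bt (t' k))) (t k)) =
      (\<Sum>k\<in>UNIV. brs (Pm (t k)) (Pm ?z) (Bt (t' k)) + brs (Pm ?z) (Pm (Bt (t' k))) (t k) + brs (Pm (Bt (t' k))) (Pm (t k)) ?z)"
      by (simp only: jacobi)
    moreover have "(\<Sum>k\<in>UNIV. P (br ?z (Bt (t' k))) (t k)) = X2"
    proof -
      have "(\<Sum>k\<in>UNIV. P (br ?z (Bt (t' k))) (t k)) = - (\<Sum>k\<in>UNIV. P (br ?z (t k)) (Bt (t' k)))"
        by (rule flip[where h = "\<lambda>x y. P (br ?z x) y"]) (simp add: bilinear_def linear_iff lin_simps)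
      then show ?thesis using skews(1)[of ?z] by (simp add: X2_def bilinear_lneg[OF bil(5)] sum_negf)
    qed
    moreover have "(\<Sum>k\<in>UNIV. brs (Pm (t k)) (Pm ?z) (Bt (t' k))) = - X3"
      unfolding X3_def
      by (subst flip[where h = "\<lambda>x y. brs (Pm x) (Pm ?z) y"]) (simp_all add: bilinear_def linear_iff lin_simps)
    moreover have "(\<Sum>k\<in>UNIV. brs (Pm ?z) (Pm (Bt (t' k))) (t k)) = - X3"
      using skews(2)[of "Pm ?z"] by (simp add: X3_def blinfun.minus_left sum_negf)
    ultimately show ?thesis by (simp add: sum.distrib X1_def X2_def X4_def)
  qed
  have coad: "(\<Sum>k\<in>UNIV. \<zeta> (coad_dual brs (Pm (t k)) (Bt (t' k)))) = (\<Sum>k\<in>UNIV. brs (Pm (Bt (t' k))) \<zeta> (t k))"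
    by (subst flip[where h = "\<lambda>x y. brs (Pm x) \<zeta> y"])
      (simp_all add: bilinear_def linear_iff lin_simps coad_dual_apply[OF bil(2)] sum_negf)
  have a: "(\<Sum>k\<in>UNIV. ?\<eta> (br (Bt (t' k)) (t k))) = (\<Sum>k\<in>UNIV. \<zeta> (br (Bt (t' k)) (t k))) - X1"
    by (simp add: blinfun.diff_left sum_subtractf maps_apply X1_def)
  have b: "(\<Sum>k\<in>UNIV. brs (Pm (Bt (t' k))) ?\<eta> (t k)) = (\<Sum>k\<in>UNIV. brs (Pm (Bt (t' k))) \<zeta> (t k)) - X3"
    by (simp add: bilinear_rsub[OF bil(2)] blinfun.diff_left sum_subtractf X3_def)
  have c: "(\<Sum>k\<in>UNIV. brs (Pm (t k)) (t' k) ?z) = - (\<Sum>k\<in>UNIV. brs (t' k) (Pm (t k)) ?z)"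
    using skews(2)[of "Pm _"] by (simp add: blinfun.minus_left sum_negf)
  have d: "Pm ?z \<a> = - Pm \<a> ?z" using forms(3)[of \<a> ?z] by (simp add: maps_apply)
  have K: "T3 (xp (K \<xi>)) v w = 2 * T3 (xp (E \<xi>)) v w - T3 (xp (ginv \<xi>)) v w" for \<xi> v w
  proof -
    have "xp (K \<xi>) = 2 *\<^sub>R xp (E \<xi>) + (-1) *\<^sub>R xp (ginv \<xi>)"
      unfolding xp_lin(2)[symmetric] xp_lin(1)[symmetric] by (simp add: K_def)
    then show ?thesis by (simp only: T3_lin)
  qed
  have "4 * W \<zeta> = 2 * (\<Sum>k\<in>UNIV. T3 (xp (E (t' k))) (xm (t k)) (?z, ?\<eta>)) - (\<Sum>k\<in>UNIV. T3 (xp (ginv (t' k))) (xm (t k)) (?z, ?\<eta>))"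
    unfolding W_eq K sum_subtractf sum_distrib_left[symmetric] by simp
  also have "\<dots> = 2 * (- \<alpha> ?z + ?\<eta> \<a> - 2 * X2 + (\<Sum>k\<in>UNIV. ?\<eta> (br (Bt (t' k)) (t k)))
      + 2 * (\<Sum>k\<in>UNIV. brs (Pm (Bt (t' k))) ?\<eta> (t k)) + (\<Sum>k\<in>UNIV. brs (Pm (t k)) (t' k) ?z) + X4)"
    unfolding contract_E_sum contract_ginv_sum X2_def X4_def by simp
  finally show ?thesis
    unfolding a b c coad using jac d
    by (simp add: blinfun.diff_left blinfun.add_left blinfun.sum_left field_simps)
qed

end

section \<open>The logarithm of the determinant\<close>

text \<open>In the derivative of the Leibniz expansion each term omits one factor. A permutation
  other than the identity moves at least two points, so a vanishing off-diagonal entry of the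
  identity matrix is still left.\<close>

lemma DERIV_det_at_identity:
  fixes R :: "real \<Rightarrow> real^'n^'n"
  assumes R0: "R 0 = mat 1" and R: "\<And>i j. ((\<lambda>s. R s $ i $ j) has_real_derivative R' i j) (at 0)"
  shows "((\<lambda>s. det (R s)) has_real_derivative (\<Sum>i\<in>UNIV. R' i i)) (at 0)"
proof -
  let ?d = "\<lambda>p. of_int (sign p) * (\<Sum>i\<in>UNIV. R' i (p i) * (\<Prod>j\<in>UNIV-{i}. R 0 $ j $ p j))"
  have "((\<lambda>s. det (R s)) has_real_derivative (\<Sum>p | p permutes (UNIV::'n set). ?d p)) (at 0)"
    unfolding det_def by (intro DERIV_sum DERIV_cmult has_field_derivative_prod R)
  moreover have "?d p = 0" if p: "p permutes (UNIV::'n set)" "p \<noteq> id" for p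
  proof -
    have "(\<Prod>j\<in>UNIV-{i}. R 0 $ j $ p j) = 0" for i
    proof -
      have "\<exists>j. j \<noteq> i \<and> p j \<noteq> j"
      proof (rule ccontr)
        assume *: "\<not> ?thesis"
        then have "p i \<noteq> i" using p(2) by (metis eq_id_iff)
        with * have "p (p i) = p i" by blast
        then show False using \<open>p i \<noteq> i\<close> permutes_inj[OF p(1)] by (metis injD)
      qed
      then obtain j where "j \<noteq> i" "p j \<noteq> j" by blast
      then show ?thesis by (intro prod_zero) (auto simp: R0 mat_def intro!: bexI[of _ j])
    qed
    then show ?thesis by (simp only: mult_zero_right sum.neutral_const)
  qed
  then have "(\<Sum>p | p permutes (UNIV::'n set). ?d p) = ?d id"
    by (intro sum.remove[of _ id, THEN trans]) (auto simp: finite_permutations permutes_id intro!: sum.neutral)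
  moreover have "?d id = (\<Sum>i\<in>UNIV. R' i i)"
    by (simp add: R0 mat_def sign_id)
  ultimately show ?thesis by simp
qed

text \<open>Left multiplication by the constant matrix \<open>N\<close> moves the base point to the
  identity matrix; the constant factor \<open>det N\<close> drops out of the logarithmic
  derivative.\<close>

lemma DERIV_ln_abs_det:
  fixes M :: "real \<Rightarrow> real^'n^'n"
  assumes N: "N ** M 0 = mat 1" and M: "\<And>i j. ((\<lambda>s. M s $ i $ j) has_real_derivative M' i j) (at 0)"
  shows "((\<lambda>s. ln \<bar>det (M s)\<bar>) has_real_derivative (\<Sum>i\<in>UNIV. \<Sum>j\<in>UNIV. N $ i $ j * M' j i)) (at 0)"
proof -
  let ?d = "\<Sum>i\<in>UNIV. \<Sum>j\<in>UNIV. N $ i $ j * M' j i"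
  have NM: "det N * det (M 0) = 1" using N by (metis det_I det_mul)
  have "((\<lambda>s. det (N ** M s)) has_real_derivative ?d) (at 0)"
  proof (rule DERIV_det_at_identity[where R = "\<lambda>s. N ** M s" and R' = "\<lambda>i j. \<Sum>k\<in>UNIV. N $ i $ k * M' k j"])
    show "N ** M 0 = mat 1" by (rule N)
    show "((\<lambda>s. (N ** M s) $ i $ j) has_real_derivative (\<Sum>k\<in>UNIV. N $ i $ k * M' k j)) (at 0)" for i j
      unfolding matrix_matrix_mult_def vec_lambda_beta by (intro DERIV_sum DERIV_cmult M)
  qed
  from DERIV_cmult[OF this, of "det (M 0)"]
  have d: "((\<lambda>s. det (M s)) has_real_derivative det (M 0) * ?d) (at 0)"
    using NM by (simp add: det_mul mult.assoc[symmetric] mult.commute[of "det (M 0)"])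
  have "det (M 0) \<noteq> 0" using NM by auto
  from DERIV_chain2[OF DERIV_ln_abs[OF this] d] show ?thesis
    using \<open>det (M 0) \<noteq> 0\<close> by (simp add: mult.assoc[symmetric])
qed

context dual_basis begin

lemma matrix_of_comp:
  assumes f: "linear f"
  shows "(\<chi> i j. t' i (f (t j))) ** (\<chi> i j. t' i (h (t j))) = (\<chi> i j. t' i (f (h (t j))))"
proof -
  have "t' i (f (h (t j))) = (\<Sum>k\<in>UNIV. t' i (f (t k)) * t' k (h (t j)))" for i j
    by (subst linear_vec_expand[OF f, of "h (t j)"]) (simp add: blinfun.sum_right blinfun.scaleR_right mult.commute)
  then show ?thesis by (simp add: matrix_matrix_mult_def)
qed

lemma matrix_of_id: "(\<chi> i j. t' i (t j)) = mat 1"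
  by (simp add: mat_def)

end

section \<open>Traces of \<open>E\<close> against skew forms\<close>

context point_data begin

lemma trace_E_skew:
  assumes D: "bilinear D" "\<And>x y. D x y = - D y x"
  shows "(\<Sum>k\<in>UNIV. t' k (E (form_map D (t k)))) = (\<Sum>k\<in>UNIV. D (t k) (Bt (t' k)))"
proof -
  have "t' k (E (form_map D (t k))) = D (gt (t' k)) (t k) - D (Bt (t' k)) (t k)" for k
    unfolding ET_apply[symmetric] form_map_apply[OF D(1)] ET_def by (rule bilinear_lsub[OF D(1)])
  then show ?thesis
    using contract_sym_skew[OF D gt_sym] contract_Bt[OF D(1)] by (simp add: sum_subtractf)
qed

text \<open>\<open>D\<close> has the shape of the derivative of \<open>P\<close> along a
  right-invariant field. Its two terms with \<open>P\<close> have equal contractions, whence the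
  factor \<open>2\<close>, which later meets the \<open>-1/2\<close> in
  \<open>\<phi>\<close>.\<close>

lemma contract_bivector_derivative:
  fixes \<zeta> :: "'g dual"
  assumes D: "\<And>x y. D x y = \<zeta> (br x y) - P (coad_dual brs \<zeta> x) y - P x (coad_dual brs \<zeta> y)"
  shows "(\<Sum>k\<in>UNIV. t' k (E (form_map D (t k)))) =
    - (\<Sum>k\<in>UNIV. \<zeta> (br (Bt (t' k)) (t k))) - 2 * (\<Sum>k\<in>UNIV. \<zeta> (coad_dual brs (Pm (t k)) (Bt (t' k))))"
proof -
  let ?c = "coad_dual brs \<zeta>"
  have c: "linear ?c"
    by (intro linearI vec_eqI) (simp_all add: coad_dual_apply[OF bil(2)] blinfun.add_right blinfun.scaleR_right)
  have bl: "bilinear D"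
    unfolding D bilinear_def linear_iff
    by (simp add: lin_simps linear_add[OF c] linear_scale[OF c] algebra_simps)
  have sk: "D x y = - D y x" for x y
    using skews(1)[of x y] forms(3)[of "?c x" y] forms(3)[of x "?c y"] by (simp add: D blinfun.minus_right)
  have 1: "P (?c (Bt (t' k))) (t k) = - \<zeta> (coad_dual brs (Pm (t k)) (Bt (t' k)))" for k
    using skews(2)[of "Pm (t k)" \<zeta>]
    by (simp add: maps_apply[symmetric] coad_dual_apply[OF bil(2)] blinfun.minus_left)
  have 2: "(\<Sum>k\<in>UNIV. P (?c (t k)) (Bt (t' k))) = (\<Sum>k\<in>UNIV. \<zeta> (coad_dual brs (Pm (t k)) (Bt (t' k))))"
  proof -
    have "bilinear (\<lambda>x y. P (?c x) y)"
      by (simp add: bilinear_def linear_iff lin_simps linear_add[OF c] linear_scale[OF c])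
    from contract_Bt[OF this] show ?thesis by (simp add: 1 sum_negf)
  qed
  have "P (t k) (?c (Bt (t' k))) = \<zeta> (coad_dual brs (Pm (t k)) (Bt (t' k)))" for k
    using 1[of k] forms(3)[of "t k"] by simp
  then have "(\<Sum>k\<in>UNIV. D (t k) (Bt (t' k))) = (\<Sum>k\<in>UNIV. \<zeta> (br (t k) (Bt (t' k))))
      - 2 * (\<Sum>k\<in>UNIV. \<zeta> (coad_dual brs (Pm (t k)) (Bt (t' k))))"
    using 2 by (simp add: D sum_subtractf)
  then show ?thesis
    using skews(1)[of "t _"] by (simp add: trace_E_skew[OF bl sk] blinfun.minus_right sum_negf)
qed

end

section \<open>The function \<open>\<phi>\<close> and the assembly of both formulas\<close>

locale pl_metric = pl_grp A D S lam brs t t' br PiS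
  for A :: "('m::{second_countable_topology,t2_space}, 'e::euclidean_space) atlas"
    and D :: "'m monoid" (structure) and S :: "'m set"
    and lam :: "'g::euclidean_space dual \<Rightarrow> 'm tvec" and brs :: "'g dual \<Rightarrow> 'g dual \<Rightarrow> 'g dual"
    and t :: "'n::finite \<Rightarrow> 'g" and t' :: "'n \<Rightarrow> 'g dual"
    and br :: "'g \<Rightarrow> 'g \<Rightarrow> 'g" and PiS :: "'m bivec" +
  fixes g0 B0 :: "'g \<Rightarrow> 'g \<Rightarrow> real"
  assumes g0: "pos_def_form g0" and B0: "skew_form B0"
begin

lemma point_data: assumes g: "g \<in> S" shows "point_data t t' br brs g0 B0 (P g)"
proof unfold_locales
  show "skew_form (P g)"
    unfolding skew_form_def using P_bilinear[OF g] P_skew[OF g] by blast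
qed (rule lie_br lie_brs g0 B0 poisson_identity[OF g])+

text \<open>Expanding the inverse of \<open>g0\<close> in the dual basis exhibits the entries as
  affine functions of the components of \<open>P\<close>, for which smoothness and derivatives are
  known.\<close>

definition phi_matrix :: "'m \<Rightarrow> real^'n^'n" where
  "phi_matrix q = (\<chi> i j. t' i (t j) + (\<Sum>l\<in>UNIV. (P q (t l) (t j) + B0 (t l) (t j)) * t' i (inv_into UNIV (form_map g0) (t' l))))"

lemma phi_tilde_eq:
  assumes "g \<in> S"
  shows "phi_tilde g0 B0 t t' P g = - (1/2) * ln \<bar>det (phi_matrix g)\<bar>"
proof -
  interpret point_data t t' br brs g0 B0 "P g" by (rule point_data[OF assms])
  have "t' i (t j + ginv (Pm (t j) + B0m (t j))) = phi_matrix g $ i $ j" for i j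
    using linear_dual_expand[OF linear_ginv, of "Pm (t j) + B0m (t j)"]
    by (simp add: phi_matrix_def ginv_def blinfun.add_right blinfun.sum_right blinfun.scaleR_right blinfun.add_left maps_apply)
  then have "(\<chi> i j. t' i (t j + ginv (Pm (t j) + B0m (t j)))) = phi_matrix g"
    by (simp add: vec_eq_iff)
  then show ?thesis unfolding phi_tilde_def lin_det_def ginv_def by simp
qed

text \<open>\<open>phi_matrix\<close> is the matrix of \<open>ginv \<circ> L\<close>, and
  \<open>E \<circ> g0m\<close> inverts it. In particular the logarithm in \<open>\<phi>\<close> is
  never evaluated at \<open>0\<close>.\<close>

lemma phi_matrix_inverse:
  assumes "g \<in> S"
  shows "(\<chi> i j. t' i (E_tilde g0 B0 (P g) (form_map g0 (t j)))) ** phi_matrix g = mat 1"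
proof -
  interpret point_data t t' br brs g0 B0 "P g" by (rule point_data[OF assms])
  have "t' i (ginv (L (t j))) = phi_matrix g $ i $ j" for i j
  proof -
    have "ginv (L (t j)) = t j + ginv (Pm (t j) + B0m (t j))"
      unfolding L_def by (simp add: linear_add[OF linear_ginv] add.assoc add.commute add.left_commute)
    then show ?thesis
      using linear_dual_expand[OF linear_ginv, of "Pm (t j) + B0m (t j)"]
      by (simp add: phi_matrix_def ginv_def blinfun.add_right blinfun.sum_right blinfun.scaleR_right blinfun.add_left maps_apply)
  qed
  then have "phi_matrix g = (\<chi> i j. t' i (ginv (L (t j))))" by (simp add: vec_eq_iff)
  moreover have "linear (\<lambda>x. E (g0m x))"
    using linear_compose[OF maps_linear(1) linear_E] by (simp add: comp_def)
  ultimately show ?thesis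
    using matrix_of_comp[of "\<lambda>x. E (g0m x)" "\<lambda>x. ginv (L x)"] matrix_of_id by simp
qed

lemma det_phi_matrix: "g \<in> S \<Longrightarrow> det (phi_matrix g) \<noteq> 0"
  using phi_matrix_inverse[of g] by (metis det_I det_mul mult_zero_right zero_neq_one)

lemma smooth_near_phi: 
  assumes p: "p \<in> S"
  shows "smooth_near A S p (\<lambda>q. - (1/2) * ln \<bar>det (phi_matrix q)\<bar>)" "smooth_near A S p (phi_tilde g0 B0 t t' P)"
proof -
  have "smooth_near A S p (\<lambda>q. phi_matrix q $ i $ j)" for i j
    unfolding phi_matrix_def vec_lambda_beta
    by (intro smooth_near_add smooth_near_sum smooth_near_mult smooth_near_const smooth_near_P p)
  then show 1: "smooth_near A S p (\<lambda>q. - (1/2) * ln \<bar>det (phi_matrix q)\<bar>)"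
    by (intro smooth_near_mult smooth_near_const smooth_near_ln_abs smooth_near_det det_phi_matrix p)
  show "smooth_near A S p (phi_tilde g0 B0 t t' P)"
    by (rule smooth_near_transform[OF 1 p open_UNIV UNIV_I]) (rule phi_tilde_eq[symmetric])
qed

lemma right_deriv_phi:
  assumes g: "g \<in> S"
  shows "right_deriv \<zeta> (phi_tilde g0 B0 t t' P) g =
    (1/2) * (\<Sum>k\<in>UNIV. \<zeta> (br (skew_part (E_tilde g0 B0 (P g)) (t' k)) (t k)))
    + (\<Sum>k\<in>UNIV. \<zeta> (coad_dual brs (form_map (P g) (t k)) (skew_part (E_tilde g0 B0 (P g)) (t' k))))"
proof -
  interpret pt: point_data t t' br brs g0 B0 "P g" by (rule point_data[OF g])
  define DP where "DP = (\<lambda>x y. right_deriv \<zeta> (\<lambda>q. P q x y) g)"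
  let ?N = "(\<chi> i j. t' i (pt.E (pt.g0m (t j)))) :: real^'n^'n"
  let ?M' = "\<lambda>i j. \<Sum>l\<in>UNIV. DP (t l) (t j) * t' i (pt.ginv (t' l))"
  let ?d = "\<Sum>i\<in>UNIV. \<Sum>j\<in>UNIV. ?N $ i $ j * ?M' j i"
  have DP: "DP x y = \<zeta> (br x y) - P g (coad_dual brs \<zeta> x) y - P g x (coad_dual brs \<zeta> y)" for x y
    unfolding DP_def by (rule right_deriv_P[OF g])
  have c: "linear (coad_dual brs \<zeta>)"
    by (intro linearI vec_eqI) (simp_all add: coad_dual blinfun.add_right blinfun.scaleR_right)
  have DP_bilinear: "bilinear DP"
    unfolding DP bilinear_def linear_iff
    by (simp add: pt.lin_simps linear_add[OF c] linear_scale[OF c] algebra_simps)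
  have "right_deriv \<zeta> (phi_tilde g0 B0 t t' P) g = right_deriv \<zeta> (\<lambda>q. - (1/2) * ln \<bar>det (phi_matrix q)\<bar>) g"
    by (rule right_deriv_cong[OF g smooth_near_phi(2)[OF g] phi_tilde_eq])
  also have "\<dots> = - (1/2) * ?d"
    unfolding right_deriv_def
  proof (rule lam_DERIV)
    show "smooth_near A S \<one> (\<lambda>q. - (1/2) * ln \<bar>det (phi_matrix (q \<otimes> g))\<bar>)"
      by (rule smooth_near_right_translate[OF g smooth_near_phi(1)[OF g]])
    fix c assume c: "curve S \<one> c" "lam \<zeta> = velocity A S c"
    have dP: "((\<lambda>s. P (c s \<otimes> g) x y) has_real_derivative DP x y) (at 0)" for x y
      using has_derivative_along_curve[OF c(1) smooth_near_right_translate[OF g smooth_near_P[OF g]], of x y]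
      by (simp add: DP_def right_deriv_def c(2))
    show "((\<lambda>s. - (1/2) * ln \<bar>det (phi_matrix (c s \<otimes> g))\<bar>) has_real_derivative - (1/2) * ?d) (at 0)"
    proof (rule DERIV_cmult, rule DERIV_ln_abs_det)
      show "?N ** phi_matrix (c 0 \<otimes> g) = mat 1"
        using phi_matrix_inverse[OF g] by (simp add: curveD(1)[OF c(1)])
      show "((\<lambda>s. phi_matrix (c s \<otimes> g) $ i $ j) has_real_derivative ?M' i j) (at 0)" for i j
        unfolding phi_matrix_def vec_lambda_beta pt.ginv_def
        by (rule derivative_eq_intros dP refl | simp)+
    qed
  qed
  \<comment> \<open>The factor \<open>g0\<close> of the inverse matrix cancels the
    \<open>ginv\<close> in the differentiated one, leaving the trace of \<open>E\<close> against the
    derivative of \<open>P\<close>.\<close>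
  also have "?d = (\<Sum>k\<in>UNIV. t' k (pt.E (form_map DP (t k))))"
  proof (rule sum.cong[OF refl])
    fix i
    have "?M' j i = t' j (pt.ginv (form_map DP (t i)))" for j
      using linear_dual_expand[OF pt.linear_ginv, of "form_map DP (t i)"]
      by (simp add: form_map_apply[OF DP_bilinear] blinfun.sum_right blinfun.scaleR_right)
    moreover have "linear (\<lambda>x. blinfun_apply (t' i) (pt.E (pt.g0m x)))"
      by (simp add: linear_iff pt.lin_simps)
    ultimately show "(\<Sum>j\<in>UNIV. ?N $ i $ j * ?M' j i) = t' i (pt.E (form_map DP (t i)))"
      using linear_vec_expand[of "\<lambda>x. blinfun_apply (t' i) (pt.E (pt.g0m x))" "pt.ginv (form_map DP (t i))"]
      by (simp add: mult.commute)
  qed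
  also have "\<dots> = - (\<Sum>k\<in>UNIV. \<zeta> (br (pt.Bt (t' k)) (t k))) - 2 * (\<Sum>k\<in>UNIV. \<zeta> (coad_dual brs (pt.Pm (t k)) (pt.Bt (t' k))))"
    by (rule pt.contract_bivector_derivative[OF DP])
  finally show ?thesis by (simp add: field_simps)
qed

text \<open>The covector that \<open>W_formula\<close> evaluates on \<open>Bt \<zeta>\<close> is
  \<open>lie_Ad\<close> at \<open>g\<close> of the trace form, by \<open>Ad_trace_ad\<close>.
  Skewness of \<open>Bt\<close> turns this into a pairing of \<open>\<zeta>\<close> with
  \<open>Bt\<close> of that covector and reverses the sign.\<close>

lemma W_prime_right_field:
  assumes bi: "lie_bialgebra br brs"
    and r: "\<And>q. smooth_self q r" "\<And>q. r q \<in> S" "\<And>q. q \<in> S \<Longrightarrow> r q = q"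
    and conn: "connected S" and g: "g \<in> S"
  shows "W_prime D lam br brs g0 B0 t t' P g (right_field D lam \<zeta> g) =
    right_deriv \<zeta> (phi_tilde g0 B0 t t' P) g
    + (1/2) * \<zeta> (trace_ad_dual t t' brs + skew_part (E_tilde g0 B0 (P g)) (lie_Ad D lam g (trace_ad t t' br)))"
proof -
  interpret pt: point_data t t' br brs g0 B0 "P g" by (rule point_data[OF g])
  have "W_prime D lam br brs g0 B0 t t' P g (right_field D lam \<zeta> g) = pt.W \<zeta>"
    by (simp add: W_prime_def pt.W_def Let_def)
  moreover have "\<zeta> (pt.Bt (lie_Ad D lam g (trace_ad t t' br))) = - lie_Ad D lam g (trace_ad t t' br) (pt.Bt \<zeta>)"
    by (rule pt.Bt_skew)
  ultimately show ?thesis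
    unfolding pt.W_formula right_deriv_phi[OF g]
    by (simp add: blinfun.add_right) (simp add: Ad_trace_ad[OF bi r conn g])
qed

end

theorem proposition5p7:
  fixes br :: "'g::euclidean_space \<Rightarrow> 'g \<Rightarrow> 'g"
    and brs :: "'g dual \<Rightarrow> 'g dual \<Rightarrow> 'g dual"
    and t :: "'n::finite \<Rightarrow> 'g" and t' :: "'n \<Rightarrow> 'g dual"
    and D :: "('m::{second_countable_topology,t2_space}) monoid"
    and A :: "('m, 'e::euclidean_space) atlas"
    and G Gs :: "'m set"
    and lamD :: "'g double \<Rightarrow> 'm tvec"
    and lamG :: "'g \<Rightarrow> 'm tvec"
    and lam :: "'g dual \<Rightarrow> 'm tvec"
    and PiS :: "'m bivec"
    and g0 B0 :: "'g \<Rightarrow> 'g \<Rightarrow> real"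
    and Pb :: "'m \<Rightarrow> 'g \<Rightarrow> 'g \<Rightarrow> real"
    and Bt :: "'m \<Rightarrow> 'g dual \<Rightarrow> 'g"
    and \<phi> :: "'m \<Rightarrow> real"
    and W' :: "'m \<Rightarrow> 'm covec"
  assumes bialgebra: "lie_bialgebra br brs"
    and bases: "dual_bases t t'"
    and D: "lie_group D A" "lie_algebra_of D A UNIV lamD (dbr br brs)"
    and D_invariant: "\<And>d u v. dpair (lie_Ad D lamD d u) (lie_Ad D lamD d v) = dpair u v"
    and G: "subgroup G D" "closed G" "connected G" "lie_algebra_of D A G lamG br"
    and Gs: "subgroup Gs D" "closed Gs" "connected Gs" "lie_algebra_of D A Gs lam brs"
    and G_incl: "\<And>x f. smooth_near A UNIV \<one>\<^bsub>D\<^esub> f \<Longrightarrow> lamG x f = lamD (x, 0) f"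
    and Gs_incl: "\<And>\<xi> f. smooth_near A UNIV \<one>\<^bsub>D\<^esub> f \<Longrightarrow> lam \<xi> f = lamD (0, \<xi>) f"
    and diffeo: "bij_betw (\<lambda>(g, h). g \<otimes>\<^bsub>D\<^esub> h) (G \<times> Gs) UNIV"
      "smooth_map (prod_atlas A A) A (G \<times> Gs) (\<lambda>(g, h). g \<otimes>\<^bsub>D\<^esub> h)"
      "smooth_map A (prod_atlas A A) UNIV (inv_into (G \<times> Gs) (\<lambda>(g, h). g \<otimes>\<^bsub>D\<^esub> h))"
    and Pi: "poisson_bivector A Gs PiS" "multiplicative_bivec D A Gs PiS"
      "dual_bivec D A Gs lam br PiS"
    and g0: "pos_def_form g0"
    and B0: "skew_form B0"
    and Pb_eq: "Pb = Pi_bold D A Gs lam PiS"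
    and Bt_eq: "\<And>g. Bt g = skew_part (E_tilde g0 B0 (Pb g))"
    and \<phi>_eq: "\<phi> = phi_tilde g0 B0 t t' Pb"
    and W'_eq: "W' = W_prime D lam br brs g0 B0 t t' Pb"
  shows "smooth_map A std_atlas Gs \<phi> \<and>
    (\<forall>\<zeta>. \<forall>g\<in>Gs. differential A Gs \<phi> g (right_field D lam \<zeta> g) =
       \<zeta> (\<Sum>k\<in>UNIV. (1/2) *\<^sub>R br (Bt g (t' k)) (t k) +
                     coad_dual brs (form_map (Pb g) (t k)) (Bt g (t' k)))) \<and>
    (\<forall>\<zeta>. \<forall>g\<in>Gs. W' g (right_field D lam \<zeta> g) =
       differential A Gs \<phi> g (right_field D lam \<zeta> g) +
       (1/2) * \<zeta> (trace_ad_dual t t' brs + Bt g (lie_Ad D lam g (trace_ad t t' br))))"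
proof -
  interpret D: group D using D(1) by (simp add: lie_group_def)
  interpret pl_metric A D Gs lam brs t t' br PiS g0 B0
    using D(1) Gs(1,4) bases bialgebra Pi g0 B0
    by unfold_locales
      (simp_all add: lie_group_def lie_bialgebra_def subgroup.m_closed subgroup.one_closed subgroup.m_inv_closed)
  let ?m = "\<lambda>(g, h). g \<otimes>\<^bsub>D\<^esub> h"
  \<comment> \<open>The factor in \<open>Gs\<close> of the decomposition of \<open>d\<close>. It
    fixes \<open>Gs\<close> pointwise, because an element of \<open>Gs\<close> decomposes with the
    unit as its factor in \<open>G\<close>.\<close>
  define r where "r = (\<lambda>d. snd (inv_into (G \<times> Gs) ?m d))"
  have r_S: "r q \<in> Gs" for q
  proof -
    have "q \<in> ?m ` (G \<times> Gs)" using diffeo(1) unfolding bij_betw_def by (metis UNIV_I)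
    from inv_into_into[OF this] show ?thesis unfolding r_def by (rule mem_Times_iff[THEN iffD1, THEN conjunct2])
  qed
  have r_id: "r q = q" if "q \<in> Gs" for q
  proof -
    have "(\<one>\<^bsub>D\<^esub>, q) \<in> G \<times> Gs" using that subgroup.one_closed[OF G(1)] by simp
    from inv_into_f_f[OF _ this, of ?m] show ?thesis
      using diffeo(1) by (simp add: bij_betw_def r_def)
  qed
  have r_smooth: "smooth_self q r" for q
    unfolding smooth_self_def r_def
    by (intro allI impI plot_snd[where A = A] plot_smooth_map[OF diffeo(3)] plot_inv_chart) auto
  have "smooth_map A std_atlas Gs \<phi>"
    unfolding smooth_map_std_iff \<phi>_eq Pb_eq using smooth_near_phi(2) by blast
  moreover have "differential A Gs \<phi> g (right_field D lam \<zeta> g) =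
       \<zeta> (\<Sum>k\<in>UNIV. (1/2) *\<^sub>R br (Bt g (t' k)) (t k) +
                     coad_dual brs (form_map (Pb g) (t k)) (Bt g (t' k)))" if "g \<in> Gs" for g \<zeta>
    unfolding differential_right_field[OF that] \<phi>_eq Pb_eq Bt_eq right_deriv_phi[OF that]
    by (simp add: blinfun.sum_right blinfun.add_right blinfun.scaleR_right sum.distrib sum_divide_distrib)
  moreover have "W' g (right_field D lam \<zeta> g) =
       differential A Gs \<phi> g (right_field D lam \<zeta> g) +
       (1/2) * \<zeta> (trace_ad_dual t t' brs + Bt g (lie_Ad D lam g (trace_ad t t' br)))" if "g \<in> Gs" for g \<zeta>
    unfolding differential_right_field[OF that] \<phi>_eq Pb_eq Bt_eq W'_eq
    by (rule W_prime_right_field[OF bialgebra r_smooth r_S r_id Gs(3) that])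
  ultimately show ?thesis by blast
qed

end
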